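(* If $\mathcal X$ is a regular protomodular category, then its exact completion $\mathcal X_{\mathrm{ex/reg}}$ (as a regular category) is also protomodular.
   Context: Regular category: has finite limits, coequalizers of kernel pairs, and pullback-stable regular epimorphisms. Exact (Barr-exact) category: a regular category in which every equivalence relation is a kernel pair. Protomodular: a category with pullbacks is protomodular if, for every split epimorphism $p\colon E\to B$ with section $s\colon B\to E$ and every $f\colon A\to B$, with pullback $D=A\times_B E$ and projection $g\colon D\to E$, the pair $(g,s)$ is jointly strongly epimorphic (every monomorphism into $E$ through which both $g$ and $s$ factorize is invertible). Exact completion: for a regular category $\mathcal X$, $\mathcal X_{\mathrm{ex/reg}}$ is its exact completion as a regular category, i.e. the value at $\mathcal X$ of the left biadjoint to the inclusion of the 2-category of exact categories into that of regular categories, regular functors (preserving finite limits and regular epimorphisms) and natural transformations. Explicitly, objects are pairs $(X,R)$ with $R$ an equivalence relation on $X\in\mathcal X$; a morphism $(X,R)\to(Y,S)$ is a relation $\varphi$ from $X$ to $Y$ with $S\varphi R=\varphi$, $R\le\varphi^\circ\varphi$ and $\varphi\varphi^\circ\le S$, where $\varphi^\circ$ is the opposite relation; composition is that of relations, and the identity of $(X,R)$ is $R$. *)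

theory Defs
  imports Main
begin

section \<open>Categories\<close>

text \<open>
  \<open>Comp C g f\<close> is \<open>g\<close> after \<open>f\<close>. The fields are only meaningful on the carriers
  \<open>Obj\<close> and \<open>Arr\<close>, and \<open>Comp\<close> only on composable pairs.
\<close>

record ('o, 'a) cat =
  Obj  :: "'o set"
  Arr  :: "'a set"
  Dom  :: "'a \<Rightarrow> 'o"
  Cod  :: "'a \<Rightarrow> 'o"
  Ide  :: "'o \<Rightarrow> 'a"
  Comp :: "'a \<Rightarrow> 'a \<Rightarrow> 'a"  (infixr "\<cdot>\<index>" 70)

definition hom :: "('o, 'a) cat \<Rightarrow> 'o \<Rightarrow> 'o \<Rightarrow> 'a set" where
  "hom C X Y = {f \<in> Arr C. Dom C f = X \<and> Cod C f = Y}"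

locale category =
  fixes C :: "('o, 'a) cat" (structure)
  assumes Dom_in_Obj: "f \<in> Arr C \<Longrightarrow> Dom C f \<in> Obj C"
    and Cod_in_Obj: "f \<in> Arr C \<Longrightarrow> Cod C f \<in> Obj C"
    and Ide_in_hom: "X \<in> Obj C \<Longrightarrow> Ide C X \<in> hom C X X"
    and Comp_in_hom: "f \<in> hom C X Y \<Longrightarrow> g \<in> hom C Y Z \<Longrightarrow> g \<cdot> f \<in> hom C X Z"
    and Comp_assoc: "f \<in> hom C W X \<Longrightarrow> g \<in> hom C X Y \<Longrightarrow> h \<in> hom C Y Z \<Longrightarrow>
          (h \<cdot> g) \<cdot> f = h \<cdot> (g \<cdot> f)"
    and Comp_Ide_right: "f \<in> hom C X Y \<Longrightarrow> f \<cdot> Ide C X = f"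
    and Comp_Ide_left: "f \<in> hom C X Y \<Longrightarrow> Ide C Y \<cdot> f = f"

definition is_mono :: "('o, 'a) cat \<Rightarrow> 'a \<Rightarrow> bool" where
  "is_mono C m \<longleftrightarrow> m \<in> Arr C \<and>
     (\<forall>T. \<forall>f \<in> hom C T (Dom C m). \<forall>g \<in> hom C T (Dom C m).
        m \<cdot>\<^bsub>C\<^esub> f = m \<cdot>\<^bsub>C\<^esub> g \<longrightarrow> f = g)"

definition is_iso :: "('o, 'a) cat \<Rightarrow> 'a \<Rightarrow> bool" where
  "is_iso C f \<longleftrightarrow> f \<in> Arr C \<and>
     (\<exists>g \<in> hom C (Cod C f) (Dom C f).
        g \<cdot>\<^bsub>C\<^esub> f = Ide C (Dom C f) \<and> f \<cdot>\<^bsub>C\<^esub> g = Ide C (Cod C f))"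

text \<open>
  \<open>p\<close> and \<open>q\<close> are the projections of a pullback of \<open>f\<close> and \<open>g\<close>, with \<open>f \<cdot> p = g \<cdot> q\<close>.
\<close>

definition is_pullback :: "('o, 'a) cat \<Rightarrow> 'a \<Rightarrow> 'a \<Rightarrow> 'a \<Rightarrow> 'a \<Rightarrow> bool" where
  "is_pullback C f g p q \<longleftrightarrow>
     f \<in> Arr C \<and> g \<in> Arr C \<and> Cod C f = Cod C g \<and>
     p \<in> hom C (Dom C p) (Dom C f) \<and> q \<in> hom C (Dom C p) (Dom C g) \<and>
     f \<cdot>\<^bsub>C\<^esub> p = g \<cdot>\<^bsub>C\<^esub> q \<and>
     (\<forall>T. \<forall>a \<in> hom C T (Dom C f). \<forall>b \<in> hom C T (Dom C g).
        f \<cdot>\<^bsub>C\<^esub> a = g \<cdot>\<^bsub>C\<^esub> b \<longrightarrow>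
        (\<exists>!h. h \<in> hom C T (Dom C p) \<and> p \<cdot>\<^bsub>C\<^esub> h = a \<and> q \<cdot>\<^bsub>C\<^esub> h = b))"

definition has_pullbacks :: "('o, 'a) cat \<Rightarrow> bool" where
  "has_pullbacks C \<longleftrightarrow>
     (\<forall>f \<in> Arr C. \<forall>g \<in> Arr C. Cod C f = Cod C g \<longrightarrow> (\<exists>p q. is_pullback C f g p q))"

definition is_kernel_pair :: "('o, 'a) cat \<Rightarrow> 'a \<Rightarrow> 'a \<Rightarrow> 'a \<Rightarrow> bool" where
  "is_kernel_pair C f p q \<longleftrightarrow> is_pullback C f f p q"

definition is_coequalizer :: "('o, 'a) cat \<Rightarrow> 'a \<Rightarrow> 'a \<Rightarrow> 'a \<Rightarrow> bool" where
  "is_coequalizer C f g e \<longleftrightarrow>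
     f \<in> Arr C \<and> g \<in> Arr C \<and> Dom C f = Dom C g \<and> Cod C f = Cod C g \<and>
     e \<in> hom C (Cod C f) (Cod C e) \<and> e \<cdot>\<^bsub>C\<^esub> f = e \<cdot>\<^bsub>C\<^esub> g \<and>
     (\<forall>T. \<forall>h \<in> hom C (Cod C f) T.
        h \<cdot>\<^bsub>C\<^esub> f = h \<cdot>\<^bsub>C\<^esub> g \<longrightarrow> (\<exists>!k. k \<in> hom C (Cod C e) T \<and> k \<cdot>\<^bsub>C\<^esub> e = h))"

definition is_regular_epi :: "('o, 'a) cat \<Rightarrow> 'a \<Rightarrow> bool" where
  "is_regular_epi C e \<longleftrightarrow> (\<exists>f g. is_coequalizer C f g e)"


section \<open>Finite limits\<close>

definition is_functor ::
  "('i, 'b) cat \<Rightarrow> ('o, 'a) cat \<Rightarrow> ('i \<Rightarrow> 'o) \<Rightarrow> ('b \<Rightarrow> 'a) \<Rightarrow> bool" where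
  "is_functor J C Fo Fa \<longleftrightarrow> category J \<and> category C \<and>
     (\<forall>i \<in> Obj J. Fo i \<in> Obj C \<and> Fa (Ide J i) = Ide C (Fo i)) \<and>
     (\<forall>u \<in> Arr J. Fa u \<in> hom C (Fo (Dom J u)) (Fo (Cod J u))) \<and>
     (\<forall>u \<in> Arr J. \<forall>v \<in> Arr J. Dom J v = Cod J u \<longrightarrow>
        Fa (v \<cdot>\<^bsub>J\<^esub> u) = Fa v \<cdot>\<^bsub>C\<^esub> Fa u)"

definition is_cone ::
  "('i, 'b) cat \<Rightarrow> ('o, 'a) cat \<Rightarrow> ('i \<Rightarrow> 'o) \<Rightarrow> ('b \<Rightarrow> 'a) \<Rightarrow> 'o \<Rightarrow> ('i \<Rightarrow> 'a) \<Rightarrow> bool" where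
  "is_cone J C Fo Fa L \<pi> \<longleftrightarrow> L \<in> Obj C \<and>
     (\<forall>i \<in> Obj J. \<pi> i \<in> hom C L (Fo i)) \<and>
     (\<forall>u \<in> Arr J. Fa u \<cdot>\<^bsub>C\<^esub> \<pi> (Dom J u) = \<pi> (Cod J u))"

definition is_limit ::
  "('i, 'b) cat \<Rightarrow> ('o, 'a) cat \<Rightarrow> ('i \<Rightarrow> 'o) \<Rightarrow> ('b \<Rightarrow> 'a) \<Rightarrow> 'o \<Rightarrow> ('i \<Rightarrow> 'a) \<Rightarrow> bool" where
  "is_limit J C Fo Fa L \<pi> \<longleftrightarrow> is_cone J C Fo Fa L \<pi> \<and>
     (\<forall>M \<mu>. is_cone J C Fo Fa M \<mu> \<longrightarrow>
        (\<exists>!h. h \<in> hom C M L \<and> (\<forall>i \<in> Obj J. \<pi> i \<cdot>\<^bsub>C\<^esub> h = \<mu> i)))"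

text \<open>
  Every finite category is isomorphic to one whose objects and arrows are natural numbers,
  so nothing is lost by taking the finite index categories of that type.
\<close>

definition has_finite_limits :: "('o, 'a) cat \<Rightarrow> bool" where
  "has_finite_limits C \<longleftrightarrow>
     (\<forall>(J :: (nat, nat) cat) Fo Fa.
        finite (Obj J) \<and> finite (Arr J) \<and> is_functor J C Fo Fa \<longrightarrow>
        (\<exists>L \<pi>. is_limit J C Fo Fa L \<pi>))"


section \<open>Regular and protomodular categories\<close>

locale regular_category = category C for C :: "('o, 'a) cat" (structure) +
  assumes finite_limits: "has_finite_limits C"
    and coequalizers_of_kernel_pairs:
      "is_kernel_pair C f p q \<Longrightarrow> \<exists>e. is_coequalizer C p q e"
    and regular_epis_pullback_stable:
      "is_regular_epi C e \<Longrightarrow> is_pullback C f e p q \<Longrightarrow> is_regular_epi C p"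

definition jointly_strongly_epic :: "('o, 'a) cat \<Rightarrow> 'a \<Rightarrow> 'a \<Rightarrow> bool" where
  "jointly_strongly_epic C g s \<longleftrightarrow> g \<in> Arr C \<and> s \<in> Arr C \<and> Cod C g = Cod C s \<and>
     (\<forall>m. is_mono C m \<and> Cod C m = Cod C g \<and>
        (\<exists>a \<in> hom C (Dom C g) (Dom C m). m \<cdot>\<^bsub>C\<^esub> a = g) \<and>
        (\<exists>b \<in> hom C (Dom C s) (Dom C m). m \<cdot>\<^bsub>C\<^esub> b = s) \<longrightarrow> is_iso C m)"

text \<open>
  Below, \<open>p : E \<rightarrow> B\<close> is split by \<open>s : B \<rightarrow> E\<close>, and \<open>q : D \<rightarrow> A\<close> and \<open>g : D \<rightarrow> E\<close> are the
  projections of the pullback of \<open>p\<close> along \<open>f : A \<rightarrow> B\<close>.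
\<close>

locale protomodular_category = category C for C :: "('o, 'a) cat" (structure) +
  assumes pullbacks: "has_pullbacks C"
    and protomodular:
      "p \<in> hom C E B \<Longrightarrow> s \<in> hom C B E \<Longrightarrow> p \<cdot> s = Ide C B \<Longrightarrow> f \<in> hom C A B \<Longrightarrow>
       is_pullback C f p q g \<Longrightarrow> jointly_strongly_epic C g s"


section \<open>Relations\<close>

text \<open>
  A relation from \<open>X\<close> to \<open>Y\<close> is a subobject of \<open>X \<times> Y\<close>, that is, an isomorphism class of
  jointly monic spans; the span with legs \<open>u : T \<rightarrow> X\<close> and \<open>v : T \<rightarrow> Y\<close> is the pair \<open>(u, v)\<close>.
\<close>

definition jointly_monic :: "('o, 'a) cat \<Rightarrow> 'a \<Rightarrow> 'a \<Rightarrow> bool" where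
  "jointly_monic C u v \<longleftrightarrow> u \<in> Arr C \<and> v \<in> Arr C \<and> Dom C u = Dom C v \<and>
     (\<forall>T. \<forall>f \<in> hom C T (Dom C u). \<forall>g \<in> hom C T (Dom C u).
        u \<cdot>\<^bsub>C\<^esub> f = u \<cdot>\<^bsub>C\<^esub> g \<and> v \<cdot>\<^bsub>C\<^esub> f = v \<cdot>\<^bsub>C\<^esub> g \<longrightarrow> f = g)"

definition monic_spans :: "('o, 'a) cat \<Rightarrow> 'o \<Rightarrow> 'o \<Rightarrow> ('a \<times> 'a) set" where
  "monic_spans C X Y = {(u, v). jointly_monic C u v \<and> Cod C u = X \<and> Cod C v = Y}"

definition span_iso :: "('o, 'a) cat \<Rightarrow> 'o \<Rightarrow> 'o \<Rightarrow> (('a \<times> 'a) \<times> ('a \<times> 'a)) set" where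
  "span_iso C X Y =
     {((u, v), (u', v')). (u, v) \<in> monic_spans C X Y \<and> (u', v') \<in> monic_spans C X Y \<and>
        (\<exists>i \<in> hom C (Dom C u') (Dom C u). is_iso C i \<and> u \<cdot>\<^bsub>C\<^esub> i = u' \<and> v \<cdot>\<^bsub>C\<^esub> i = v')}"

definition Rel :: "('o, 'a) cat \<Rightarrow> 'o \<Rightarrow> 'o \<Rightarrow> ('a \<times> 'a) set set" where
  "Rel C X Y = monic_spans C X Y // span_iso C X Y"

definition span_factors :: "('o, 'a) cat \<Rightarrow> 'a \<times> 'a \<Rightarrow> 'a \<times> 'a \<Rightarrow> bool" where
  "span_factors C s t \<longleftrightarrow>
     (\<exists>h \<in> hom C (Dom C (fst s)) (Dom C (fst t)).
        fst t \<cdot>\<^bsub>C\<^esub> h = fst s \<and> snd t \<cdot>\<^bsub>C\<^esub> h = snd s)"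

definition rel_le :: "('o, 'a) cat \<Rightarrow> ('a \<times> 'a) set \<Rightarrow> ('a \<times> 'a) set \<Rightarrow> bool" where
  "rel_le C \<phi> \<psi> \<longleftrightarrow> (\<exists>s \<in> \<phi>. \<exists>t \<in> \<psi>. span_factors C s t)"

text \<open>
  The regular image of the span \<open>(a, b)\<close>: all jointly monic spans through which \<open>(a, b)\<close>
  factorizes by a regular epimorphism.
\<close>

definition span_image :: "('o, 'a) cat \<Rightarrow> 'a \<Rightarrow> 'a \<Rightarrow> ('a \<times> 'a) set" where
  "span_image C a b =
     {(u, v). jointly_monic C u v \<and>
        (\<exists>e \<in> hom C (Dom C a) (Dom C u). is_regular_epi C e \<and>
           u \<cdot>\<^bsub>C\<^esub> e = a \<and> v \<cdot>\<^bsub>C\<^esub> e = b)}"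

text \<open>
  \<open>rel_comp C \<psi> \<phi>\<close> is \<open>\<psi>\<close> after \<open>\<phi>\<close>. Ranging over all representatives, pullbacks and images
  yields a single isomorphism class, because each of these is unique up to isomorphism.
  The opposite of a relation \<open>\<phi>\<close>, exchanging the legs of each span, is the set-theoretic
  converse \<open>\<phi>\<inverse>\<close>.
\<close>

definition rel_comp ::
  "('o, 'a) cat \<Rightarrow> ('a \<times> 'a) set \<Rightarrow> ('a \<times> 'a) set \<Rightarrow> ('a \<times> 'a) set" where
  "rel_comp C \<psi> \<phi> =
     {w. \<exists>u v u' v' p q. (u, v) \<in> \<phi> \<and> (u', v') \<in> \<psi> \<and> is_pullback C v u' p q \<and>
        w \<in> span_image C (u \<cdot>\<^bsub>C\<^esub> p) (v' \<cdot>\<^bsub>C\<^esub> q)}"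

definition equivalence_relation :: "('o, 'a) cat \<Rightarrow> 'o \<Rightarrow> ('a \<times> 'a) set \<Rightarrow> bool" where
  "equivalence_relation C X R \<longleftrightarrow> R \<in> Rel C X X \<and>
     (\<forall>(u, v) \<in> R.
        span_factors C (Ide C X, Ide C X) (u, v) \<and>
        span_factors C (v, u) (u, v) \<and>
        (\<forall>p q. is_pullback C v u p q \<longrightarrow>
           span_factors C (u \<cdot>\<^bsub>C\<^esub> p, v \<cdot>\<^bsub>C\<^esub> q) (u, v)))"


section \<open>The exact completion of a regular category\<close>

definition ex_reg_Obj :: "('o, 'a) cat \<Rightarrow> ('o \<times> ('a \<times> 'a) set) set" where
  "ex_reg_Obj C = {(X, R). X \<in> Obj C \<and> equivalence_relation C X R}"

definition ex_reg_rel ::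
  "('o, 'a) cat \<Rightarrow> 'o \<times> ('a \<times> 'a) set \<Rightarrow> 'o \<times> ('a \<times> 'a) set \<Rightarrow> ('a \<times> 'a) set \<Rightarrow> bool" where
  "ex_reg_rel C A B \<phi> \<longleftrightarrow>
     (case A of (X, R) \<Rightarrow> case B of (Y, S) \<Rightarrow>
        \<phi> \<in> Rel C X Y \<and>
        rel_comp C S (rel_comp C \<phi> R) = \<phi> \<and>
        rel_le C R (rel_comp C (\<phi>\<inverse>) \<phi>) \<and>
        rel_le C (rel_comp C \<phi> (\<phi>\<inverse>)) S)"

text \<open>
  An arrow \<open>A \<rightarrow> B\<close> is a triple \<open>(A, \<phi>, B)\<close>, so that domain and codomain can be read off.
\<close>

definition ex_reg ::
  "('o, 'a) cat \<Rightarrow>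
   ('o \<times> ('a \<times> 'a) set,
    ('o \<times> ('a \<times> 'a) set) \<times> ('a \<times> 'a) set \<times> ('o \<times> ('a \<times> 'a) set)) cat" where
  "ex_reg C =
     \<lparr>Obj = ex_reg_Obj C,
      Arr = {(A, \<phi>, B). A \<in> ex_reg_Obj C \<and> B \<in> ex_reg_Obj C \<and> ex_reg_rel C A B \<phi>},
      Dom = (\<lambda>(A, \<phi>, B). A),
      Cod = (\<lambda>(A, \<phi>, B). B),
      Ide = (\<lambda>(X, R). ((X, R), R, (X, R))),
      Comp = (\<lambda>(A', \<psi>, B') (A, \<phi>, B). (A, rel_comp C \<psi> \<phi>, B'))\<rparr>"

end

theory Submission
  imports Defs
begin

text \<open>
  The proof works with generalized elements. A relation \<open>\<phi>\<close> from \<open>X\<close> to \<open>Y\<close> in a regular category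
  is determined by the pairs of arrows \<open>x : T \<rightarrow> X\<close>, \<open>y : T \<rightarrow> Y\<close> that factor through it
  (\<open>Rel_eqI\<close>), and such statements may be checked after precomposition with a regular epimorphism
  (\<open>related_local\<close>). Composition of relations becomes existential quantification over a cover of
  the stage \<open>T\<close> (\<open>Rel_rel_comp\<close>). In this language the arrows of the exact completion are
  functional relations (\<open>ex_reg_rel_iff\<close>), which are computed with like functions between quotients
  of sets: a composite may be evaluated at any value of its first factor
  (\<open>functional_comp_value\<close>), and two arrows with a common local value everywhere are equal
  (\<open>functional_eqI\<close>). The category axioms and the construction of pullbacks follow.

  For protomodularity, let \<open>p : E \<rightarrow> B\<close> be split by \<open>s\<close> in the exact completion, let \<open>f : A \<rightarrow> B\<close>,
  and let \<open>m\<close> be a monomorphism into \<open>E\<close> through which \<open>s\<close> and the projection \<open>g\<close> from the pullback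
  of \<open>f\<close> and \<open>p\<close> factor. The object \<open>E = (X, R)\<close> is covered by the object \<open>X\<close> of the base
  category, but for an arbitrary cover of \<open>B\<close> the section \<open>s\<close> need not lift to \<open>X\<close>. Therefore pull
  the cover \<open>X\<close> of \<open>E\<close> back along \<open>s\<close> to a cover \<open>K\<close> of \<open>B\<close>. As \<open>s\<close> is monic, \<open>K\<close> is a subobject of \<open>X\<close>, and the pullback \<open>Z\<close> of \<open>X\<close>
  and \<open>K\<close> over \<open>B\<close> is a subobject of \<open>X \<times> K\<close>; both are subobjects of objects of the base category,
  hence in it. The projection \<open>Z \<rightarrow> K\<close> is split by the diagonal, and this split epimorphism covers
  the pair \<open>(p, s)\<close>. Pulling \<open>m\<close> back to \<open>Z\<close> gives a monomorphism of the base category to which its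
  protomodularity applies, so that it is invertible. Hence \<open>m\<close> is surjective
  (\<open>split_epi_covering_elements\<close>), and an arrow of the exact completion that is both monic and
  surjective is invertible (\<open>ex_reg_mono_injective\<close>, \<open>ex_reg_iso_of_injective_surjective\<close>).
\<close>

section \<open>Composition and pullbacks\<close>

context category
begin

lemma comp_arr [simp]:
  assumes "f \<in> Arr C" "g \<in> Arr C" "Cod C f = Dom C g"
  shows "g \<cdot> f \<in> Arr C" "Dom C (g \<cdot> f) = Dom C f" "Cod C (g \<cdot> f) = Cod C g"
  using Comp_in_hom[of f "Dom C f" "Cod C f" g "Cod C g"] assms by (auto simp: hom_def)

lemma comp_assoc [simp]:
  assumes "f \<in> Arr C" "g \<in> Arr C" "h \<in> Arr C" "Cod C f = Dom C g" "Cod C g = Dom C h"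
  shows "(h \<cdot> g) \<cdot> f = h \<cdot> (g \<cdot> f)"
  by (rule Comp_assoc[of f "Dom C f" "Cod C f" g "Cod C g" h "Cod C h"])
     (use assms in \<open>auto simp: hom_def\<close>)

lemma ide_arr [simp]:
  assumes "X \<in> Obj C"
  shows "Ide C X \<in> Arr C" "Dom C (Ide C X) = X" "Cod C (Ide C X) = X"
  using Ide_in_hom[OF assms] by (auto simp: hom_def)

lemma comp_ide [simp]:
  assumes "f \<in> Arr C"
  shows "Cod C f = Y \<Longrightarrow> Ide C Y \<cdot> f = f" "Dom C f = X \<Longrightarrow> f \<cdot> Ide C X = f"
  using Comp_Ide_left[of f "Dom C f" Y] Comp_Ide_right[of f X "Cod C f"] assms
  by (auto simp: hom_def)

lemma hom_obj:
  assumes "f \<in> hom C X Y"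
  shows "X \<in> Obj C" "Y \<in> Obj C"
  using assms Dom_in_Obj Cod_in_Obj by (auto simp: hom_def)

lemma comp_eq_comp:
  assumes "a \<cdot> b = c \<cdot> d" "b \<in> hom C X Y" "a \<in> hom C Y Z" "d \<in> hom C X W" "c \<in> hom C W Z" "h \<in> hom C T X"
  shows "a \<cdot> (b \<cdot> h) = c \<cdot> (d \<cdot> h)"
  unfolding Comp_assoc[OF assms(6,2,3), symmetric] Comp_assoc[OF assms(6,4,5), symmetric] assms(1) ..

lemma comp_eq:
  assumes "a \<cdot> b = c" "b \<in> hom C X Y" "a \<in> hom C Y Z" "h \<in> hom C T X"
  shows "a \<cdot> (b \<cdot> h) = c \<cdot> h"
  unfolding Comp_assoc[OF assms(4,2,3), symmetric] assms(1) ..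

lemma is_monoI:
  assumes "m \<in> hom C X Y"
    and "\<And>T f g. f \<in> hom C T X \<Longrightarrow> g \<in> hom C T X \<Longrightarrow> m \<cdot> f = m \<cdot> g \<Longrightarrow> f = g"
  shows "is_mono C m"
  using assms unfolding is_mono_def hom_def by blast

lemma is_monoD:
  assumes "is_mono C m" "m \<in> hom C X Y" "f \<in> hom C T X" "g \<in> hom C T X" "m \<cdot> f = m \<cdot> g"
  shows "f = g"
  using assms unfolding is_mono_def hom_def by blast

lemma jointly_monicI:
  assumes "u \<in> hom C Z X" "v \<in> hom C Z Y"
    and "\<And>T f g. f \<in> hom C T Z \<Longrightarrow> g \<in> hom C T Z \<Longrightarrow> u \<cdot> f = u \<cdot> g \<Longrightarrow> v \<cdot> f = v \<cdot> g \<Longrightarrow> f = g"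
  shows "jointly_monic C u v"
  using assms unfolding jointly_monic_def hom_def by simp

lemma jointly_monicD:
  assumes "jointly_monic C u v" "u \<in> hom C Z X" "f \<in> hom C T Z" "g \<in> hom C T Z"
    "u \<cdot> f = u \<cdot> g" "v \<cdot> f = v \<cdot> g"
  shows "f = g"
  using assms unfolding jointly_monic_def hom_def by blast

lemma is_isoI:
  assumes "f \<in> hom C X Y" "g \<in> hom C Y X" "g \<cdot> f = Ide C X" "f \<cdot> g = Ide C Y"
  shows "is_iso C f"
  using assms unfolding is_iso_def hom_def by auto

lemma is_isoD:
  assumes "is_iso C f" "f \<in> hom C X Y"
  shows "\<exists>g \<in> hom C Y X. g \<cdot> f = Ide C X \<and> f \<cdot> g = Ide C Y"
  using assms unfolding is_iso_def hom_def by auto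

lemma is_pullbackI:
  assumes "f \<in> hom C X Z" "g \<in> hom C Y Z" "p \<in> hom C P X" "q \<in> hom C P Y" "f \<cdot> p = g \<cdot> q"
    and "\<And>T a b. a \<in> hom C T X \<Longrightarrow> b \<in> hom C T Y \<Longrightarrow> f \<cdot> a = g \<cdot> b \<Longrightarrow>
      \<exists>h \<in> hom C T P. p \<cdot> h = a \<and> q \<cdot> h = b"
    and "\<And>T h k. h \<in> hom C T P \<Longrightarrow> k \<in> hom C T P \<Longrightarrow> p \<cdot> h = p \<cdot> k \<Longrightarrow> q \<cdot> h = q \<cdot> k \<Longrightarrow> h = k"
  shows "is_pullback C f g p q"
proof -
  have D: "Dom C f = X" "Dom C g = Y" "Dom C p = P" using assms(1-3) by (auto simp: hom_def)
  have "\<exists>!h. h \<in> hom C T P \<and> p \<cdot> h = a \<and> q \<cdot> h = b"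
    if "a \<in> hom C T X" "b \<in> hom C T Y" "f \<cdot> a = g \<cdot> b" for T a b
  proof -
    from assms(6)[OF that] obtain h where h: "h \<in> hom C T P" "p \<cdot> h = a" "q \<cdot> h = b" by (elim bexE conjE)
    show ?thesis by (rule ex1I[of _ h]) (use h assms(7) in auto)
  qed
  then show ?thesis unfolding is_pullback_def D using assms(1-5) by (auto simp: hom_def)
qed

lemma pullback_lift:
  assumes "is_pullback C f g p q" "f \<in> hom C X Z" "g \<in> hom C Y Z" "p \<in> hom C P X"
    "a \<in> hom C T X" "b \<in> hom C T Y" "f \<cdot> a = g \<cdot> b"
  shows "\<exists>h \<in> hom C T P. p \<cdot> h = a \<and> q \<cdot> h = b"
proof -
  have D: "Dom C f = X" "Dom C g = Y" "Dom C p = P" using assms(2-4) by (auto simp: hom_def)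
  show ?thesis using assms(1,5-7) unfolding is_pullback_def D by blast
qed

lemma pullback_square:
  assumes "is_pullback C f g p q" "f \<in> hom C X Z" "g \<in> hom C Y Z"
  shows "p \<in> hom C (Dom C p) X" "q \<in> hom C (Dom C p) Y" "f \<cdot> p = g \<cdot> q"
  using assms unfolding is_pullback_def hom_def by auto

lemma pullback_jointly_monic:
  assumes "is_pullback C f g p q"
  shows "jointly_monic C p q"
proof -
  have pq: "f \<in> Arr C" "g \<in> Arr C" "Cod C f = Cod C g"
    "p \<in> hom C (Dom C p) (Dom C f)" "q \<in> hom C (Dom C p) (Dom C g)" "f \<cdot> p = g \<cdot> q"
    and u: "\<And>T a b. a \<in> hom C T (Dom C f) \<Longrightarrow> b \<in> hom C T (Dom C g) \<Longrightarrow> f \<cdot> a = g \<cdot> b \<Longrightarrow>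
        \<exists>!h. h \<in> hom C T (Dom C p) \<and> p \<cdot> h = a \<and> q \<cdot> h = b"
    using assms unfolding is_pullback_def by auto
  show ?thesis
  proof (rule jointly_monicI[OF pq(4,5)])
    fix T h k
    assume hk: "h \<in> hom C T (Dom C p)" "k \<in> hom C T (Dom C p)" "p \<cdot> h = p \<cdot> k" "q \<cdot> h = q \<cdot> k"
    have "f \<cdot> (p \<cdot> h) = g \<cdot> (q \<cdot> h)"
      by (rule comp_eq_comp[OF pq(6,4) _ pq(5) _ hk(1)]) (use pq in \<open>auto simp: hom_def\<close>)
    then have "\<exists>!l. l \<in> hom C T (Dom C p) \<and> p \<cdot> l = p \<cdot> h \<and> q \<cdot> l = q \<cdot> h"
      by (intro u Comp_in_hom[OF hk(1)] pq)
    then show "h = k" by (rule ex1E) (use hk in auto)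
  qed
qed

end

section \<open>Pullbacks and products from finite limits\<close>

text \<open>The shape of a cospan: the arrows 3 and 4 run from the objects 0 and 1 to the object 2.\<close>

definition cospan_cat :: "(nat, nat) cat" where
  "cospan_cat = \<lparr>Obj = {0, 1, 2}, Arr = {0, 1, 2, 3, 4},
     Dom = (\<lambda>u. if u = 3 then 0 else if u = 4 then 1 else u),
     Cod = (\<lambda>u. if u < 3 then u else 2),
     Ide = (\<lambda>i. i),
     Comp = (\<lambda>v u. if v < 3 then u else v)\<rparr>"

lemma category_cospan_cat: "category cospan_cat"
proof
  show "(h \<cdot>\<^bsub>cospan_cat\<^esub> g) \<cdot>\<^bsub>cospan_cat\<^esub> f = h \<cdot>\<^bsub>cospan_cat\<^esub> (g \<cdot>\<^bsub>cospan_cat\<^esub> f)" for f g h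
    by (simp add: cospan_cat_def)
  show "g \<cdot>\<^bsub>cospan_cat\<^esub> f \<in> hom cospan_cat X Z"
    if "f \<in> hom cospan_cat X Y" "g \<in> hom cospan_cat Y Z" for f g X Y Z
  proof (cases "g < 3")
    case True
    then show ?thesis using that by (simp add: cospan_cat_def hom_def)
  next
    case False
    then have "g = 3 \<or> g = 4" using that(2) by (auto simp: cospan_cat_def hom_def)
    then show ?thesis using that by (auto simp: cospan_cat_def hom_def)
  qed
qed (auto simp: cospan_cat_def hom_def)

definition empty_cat :: "(nat, nat) cat" where
  "empty_cat = \<lparr>Obj = {}, Arr = {}, Dom = id, Cod = id, Ide = id, Comp = (\<lambda>_. id)\<rparr>"

lemma category_empty_cat: "category empty_cat"
  by unfold_locales (auto simp: empty_cat_def hom_def)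

context regular_category
begin

text \<open>
  A terminal object is a limit of the empty diagram. Binary products are then pullbacks over it.
\<close>

lemma terminal_object: "\<exists>I \<in> Obj C. \<forall>T \<in> Obj C. \<exists>!h. h \<in> hom C T I"
proof -
  have "is_functor empty_cat C (\<lambda>_. undefined) (\<lambda>_. undefined)"
    unfolding is_functor_def using category_empty_cat category_axioms by (auto simp: empty_cat_def)
  moreover have "finite (Obj empty_cat)" "finite (Arr empty_cat)" by (auto simp: empty_cat_def)
  ultimately obtain L \<pi> where L: "is_limit empty_cat C (\<lambda>_. undefined) (\<lambda>_. undefined) L \<pi>"
    using finite_limits unfolding has_finite_limits_def by blast
  have "L \<in> Obj C" using L unfolding is_limit_def is_cone_def by blast
  moreover have "\<exists>!h. h \<in> hom C T L" if "T \<in> Obj C" for T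
  proof -
    have "is_cone empty_cat C (\<lambda>_. undefined) (\<lambda>_. undefined) T \<pi>"
      using that unfolding is_cone_def by (auto simp: empty_cat_def)
    with L show ?thesis unfolding is_limit_def by (auto simp: empty_cat_def)
  qed
  ultimately show ?thesis by blast
qed

lemma pullback_exists:
  assumes f: "f \<in> hom C X Z" and g: "g \<in> hom C Y Z"
  obtains P p q where "p \<in> hom C P X" "q \<in> hom C P Y" "f \<cdot> p = g \<cdot> q" "is_pullback C f g p q"
proof -
  define Fo where "Fo = (\<lambda>i::nat. if i = 0 then X else if i = 1 then Y else Z)"
  define Fa where "Fa = (\<lambda>u::nat. if u = 3 then f else if u = 4 then g else Ide C (Fo u))"
  have obj: "X \<in> Obj C" "Y \<in> Obj C" "Z \<in> Obj C" using hom_obj f g by blast+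
  have F: "is_functor cospan_cat C Fo Fa"
    unfolding is_functor_def using category_cospan_cat category_axioms f g obj
    by (auto simp: cospan_cat_def Fo_def Fa_def hom_def)
  have cone: "is_cone cospan_cat C Fo Fa L \<pi> \<longleftrightarrow>
      L \<in> Obj C \<and> \<pi> 0 \<in> hom C L X \<and> \<pi> 1 \<in> hom C L Y \<and> \<pi> 2 \<in> hom C L Z \<and>
      f \<cdot> \<pi> 0 = \<pi> 2 \<and> g \<cdot> \<pi> 1 = \<pi> 2" for L \<pi>
    unfolding is_cone_def using obj
    by (auto simp: cospan_cat_def Fo_def Fa_def hom_def)
  have "finite (Obj cospan_cat)" "finite (Arr cospan_cat)" by (auto simp: cospan_cat_def)
  with F obtain L \<pi> where L: "is_limit cospan_cat C Fo Fa L \<pi>"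
    using finite_limits unfolding has_finite_limits_def by blast
  then have \<pi>: "L \<in> Obj C" "\<pi> 0 \<in> hom C L X" "\<pi> 1 \<in> hom C L Y" "\<pi> 2 \<in> hom C L Z"
      "f \<cdot> \<pi> 0 = \<pi> 2" "g \<cdot> \<pi> 1 = \<pi> 2"
    unfolding is_limit_def cone by blast+
  have univ: "\<exists>!h. h \<in> hom C T L \<and> \<pi> 0 \<cdot> h = a \<and> \<pi> 1 \<cdot> h = b"
    if ab: "a \<in> hom C T X" "b \<in> hom C T Y" "f \<cdot> a = g \<cdot> b" for T a b
  proof -
    define \<mu> where "\<mu> = (\<lambda>i::nat. if i = 0 then a else if i = 1 then b else f \<cdot> a)"
    have "is_cone cospan_cat C Fo Fa T \<mu>"
      unfolding cone using ab f g hom_obj by (auto simp: \<mu>_def intro: Comp_in_hom)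
    then have "\<exists>!h. h \<in> hom C T L \<and> (\<forall>i \<in> Obj cospan_cat. \<pi> i \<cdot> h = \<mu> i)"
      using L unfolding is_limit_def by blast
    moreover have "(\<forall>i \<in> Obj cospan_cat. \<pi> i \<cdot> h = \<mu> i) \<longleftrightarrow> \<pi> 0 \<cdot> h = a \<and> \<pi> 1 \<cdot> h = b"
      if h: "h \<in> hom C T L" for h
      using \<pi>(5) comp_eq[OF \<pi>(5,2) f h] by (auto simp: cospan_cat_def \<mu>_def)
    ultimately show ?thesis by (metis (no_types, lifting))
  qed
  have "is_pullback C f g (\<pi> 0) (\<pi> 1)"
  proof (rule is_pullbackI[OF f g \<pi>(2,3)])
    show "f \<cdot> \<pi> 0 = g \<cdot> \<pi> 1" using \<pi> by simp
    show "\<exists>h \<in> hom C T L. \<pi> 0 \<cdot> h = a \<and> \<pi> 1 \<cdot> h = b"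
      if "a \<in> hom C T X" "b \<in> hom C T Y" "f \<cdot> a = g \<cdot> b" for T a b
      using univ[OF that] by blast
    show "h = k" if hk: "h \<in> hom C T L" "k \<in> hom C T L" "\<pi> 0 \<cdot> h = \<pi> 0 \<cdot> k" "\<pi> 1 \<cdot> h = \<pi> 1 \<cdot> k" for T h k
    proof -
      have "f \<cdot> (\<pi> 0 \<cdot> h) = g \<cdot> (\<pi> 1 \<cdot> h)"
        by (rule comp_eq_comp[OF _ \<pi>(2) f \<pi>(3) g hk(1)]) (use \<pi> in simp)
      from univ[OF Comp_in_hom[OF hk(1) \<pi>(2)] Comp_in_hom[OF hk(1) \<pi>(3)] this]
      show ?thesis by (rule ex1E) (use hk in auto)
    qed
  qed
  moreover have "f \<cdot> \<pi> 0 = g \<cdot> \<pi> 1" using \<pi> by simp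
  ultimately show thesis by (rule that[OF \<pi>(2,3), rotated])
qed

lemma product_exists:
  assumes "X \<in> Obj C" "Y \<in> Obj C"
  obtains P p q where "p \<in> hom C P X" "q \<in> hom C P Y" "jointly_monic C p q"
    "\<forall>T. \<forall>a \<in> hom C T X. \<forall>b \<in> hom C T Y. \<exists>h \<in> hom C T P. p \<cdot> h = a \<and> q \<cdot> h = b"
proof -
  obtain I where I: "\<forall>T \<in> Obj C. \<exists>!h. h \<in> hom C T I"
    using terminal_object by (elim bexE)
  have "\<exists>f. f \<in> hom C X I" "\<exists>g. g \<in> hom C Y I"
    using bspec[OF I assms(1)] bspec[OF I assms(2)] by (auto elim: ex1_implies_ex)
  then obtain f g where fg: "f \<in> hom C X I" "g \<in> hom C Y I" by (elim exE)
  obtain P p q where pq: "p \<in> hom C P X" "q \<in> hom C P Y" "is_pullback C f g p q"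
    by (rule pullback_exists[OF fg])
  have univ: "\<exists>h \<in> hom C T P. p \<cdot> h = a \<and> q \<cdot> h = b"
    if ab: "a \<in> hom C T X" "b \<in> hom C T Y" for T a b
  proof (rule pullback_lift[OF pq(3) fg pq(1) ab])
    have "\<exists>!h. h \<in> hom C T I" using bspec[OF I hom_obj(1)[OF ab(1)]] .
    with Comp_in_hom[OF ab(1) fg(1)] Comp_in_hom[OF ab(2) fg(2)] show "f \<cdot> a = g \<cdot> b" by auto
  qed
  show thesis by (rule that[OF pq(1,2) pullback_jointly_monic[OF pq(3)]]) (use univ in blast)
qed

text \<open>
  The limit over two spans with the same feet: the pullback of the two arrows into the product.
  It gives equalizers and intersections of relations.
\<close>

lemma span_pullback_exists:
  assumes u: "u \<in> hom C A X" and v: "v \<in> hom C A Y" and u': "u' \<in> hom C B X" and v': "v' \<in> hom C B Y"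
  obtains L l l' where "l \<in> hom C L A" "l' \<in> hom C L B" "u \<cdot> l = u' \<cdot> l'" "v \<cdot> l = v' \<cdot> l'"
    "jointly_monic C l l'"
    "\<forall>T. \<forall>a \<in> hom C T A. \<forall>b \<in> hom C T B. u \<cdot> a = u' \<cdot> b \<longrightarrow> v \<cdot> a = v' \<cdot> b \<longrightarrow>
       (\<exists>h \<in> hom C T L. l \<cdot> h = a \<and> l' \<cdot> h = b)"
proof -
  obtain P p q where P: "p \<in> hom C P X" "q \<in> hom C P Y" "jointly_monic C p q"
    "\<forall>T. \<forall>a \<in> hom C T X. \<forall>b \<in> hom C T Y. \<exists>h \<in> hom C T P. p \<cdot> h = a \<and> q \<cdot> h = b"
    by (rule product_exists[OF hom_obj(2)[OF u] hom_obj(2)[OF v]])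
  note p = P(1) and q = P(2) and jm = P(3) and univ = P(4)[rule_format]
  obtain w where w: "w \<in> hom C A P" "p \<cdot> w = u" "q \<cdot> w = v" using univ[OF u v] by blast
  obtain w' where w': "w' \<in> hom C B P" "p \<cdot> w' = u'" "q \<cdot> w' = v'" using univ[OF u' v'] by blast
  obtain L l l' where l: "l \<in> hom C L A" "l' \<in> hom C L B" "w \<cdot> l = w' \<cdot> l'" "is_pullback C w w' l l'"
    by (rule pullback_exists[OF w(1) w'(1)])
  have ul: "u \<cdot> l = u' \<cdot> l'" using comp_eq[OF w(2) w(1) p l(1)]
      comp_eq[OF w'(2) w'(1) p l(2)] l(3) by simp
  have vl: "v \<cdot> l = v' \<cdot> l'"
    using comp_eq[OF w(3) w(1) q l(1)] comp_eq[OF w'(3) w'(1) q l(2)] l(3) by simp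
  have univL: "\<exists>h \<in> hom C T L. l \<cdot> h = a \<and> l' \<cdot> h = b"
    if ab: "a \<in> hom C T A" "b \<in> hom C T B" "u \<cdot> a = u' \<cdot> b" "v \<cdot> a = v' \<cdot> b" for T a b
  proof (rule pullback_lift[OF l(4) w(1) w'(1) l(1) ab(1,2)])
    show "w \<cdot> a = w' \<cdot> b"
      using jointly_monicD[OF jm p Comp_in_hom[OF ab(1) w(1)] Comp_in_hom[OF ab(2) w'(1)]] ab
        comp_eq[OF w(2,1) p ab(1)] comp_eq[OF w(3,1) q ab(1)]
        comp_eq[OF w'(2,1) p ab(2)] comp_eq[OF w'(3,1) q ab(2)] by simp
  qed
  show thesis by (rule that[OF l(1,2) ul vl pullback_jointly_monic[OF l(4)]]) (use univL in blast)
qed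

end

section \<open>Regular epimorphisms as covers\<close>

context category
begin

text \<open>
  A regular epimorphism \<open>e : S \<rightarrow> T\<close> is read as a covering of the stage \<open>T\<close>: it is where the
  witnesses of an existential statement at stage \<open>T\<close> live.
\<close>

definition cover :: "'a \<Rightarrow> 'o \<Rightarrow> 'o \<Rightarrow> bool" where
  "cover e S T \<longleftrightarrow> is_regular_epi C e \<and> e \<in> hom C S T"

lemma cover_hom: "cover e S T \<Longrightarrow> e \<in> hom C S T"
  unfolding cover_def by simp

lemma cover_obj: "cover e S T \<Longrightarrow> S \<in> Obj C" "cover e S T \<Longrightarrow> T \<in> Obj C"
  using hom_obj[OF cover_hom] by auto

lemma cover_coequalizer:
  assumes "cover e S T"
  obtains K f g where "f \<in> hom C K S" "g \<in> hom C K S" "e \<cdot> f = e \<cdot> g"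
    "\<forall>Z. \<forall>h \<in> hom C S Z. h \<cdot> f = h \<cdot> g \<longrightarrow> (\<exists>!k. k \<in> hom C T Z \<and> k \<cdot> e = h)"
proof -
  from assms obtain f g where fg: "is_coequalizer C f g e" and e: "e \<in> hom C S T"
    unfolding cover_def is_regular_epi_def by (elim conjE exE)
  have S: "Cod C f = S" "Cod C e = T" using fg e unfolding is_coequalizer_def hom_def by auto
  show thesis
    by (rule that[of f "Dom C f" g]) (use fg in \<open>auto simp: is_coequalizer_def hom_def S\<close>)
qed

lemma coverI:
  assumes "is_coequalizer C f g e" "e \<in> hom C S T"
  shows "cover e S T"
  using assms unfolding cover_def is_regular_epi_def by auto

lemma cover_epi:
  assumes "cover e S T" "h \<in> hom C T Z" "k \<in> hom C T Z" "h \<cdot> e = k \<cdot> e"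
  shows "h = k"
proof -
  obtain K f g where fg: "f \<in> hom C K S" "g \<in> hom C K S" "e \<cdot> f = e \<cdot> g"
    "\<forall>Z. \<forall>h \<in> hom C S Z. h \<cdot> f = h \<cdot> g \<longrightarrow> (\<exists>!k. k \<in> hom C T Z \<and> k \<cdot> e = h)"
    by (rule cover_coequalizer[OF assms(1)])
  have e: "e \<in> hom C S T" using assms(1) by (rule cover_hom)
  have "(h \<cdot> e) \<cdot> f = (h \<cdot> e) \<cdot> g"
    using Comp_assoc[OF fg(1) e assms(2)] Comp_assoc[OF fg(2) e assms(2)] fg(3) by simp
  with fg(4) Comp_in_hom[OF e assms(2)] have "\<exists>!l. l \<in> hom C T Z \<and> l \<cdot> e = h \<cdot> e" by blast
  then show ?thesis by (rule ex1E) (use assms in auto)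
qed

lemma cover_ide:
  assumes T: "T \<in> Obj C"
  shows "cover (Ide C T) T T"
proof (rule coverI)
  show "Ide C T \<in> hom C T T" using T by (rule Ide_in_hom)
  have "\<exists>!k. k \<in> hom C T Z \<and> k \<cdot> Ide C T = h" if "h \<in> hom C T Z" for Z h
    using that Comp_Ide_right[of _ T Z] by (intro ex1I[of _ h]) auto
  then show "is_coequalizer C (Ide C T) (Ide C T) (Ide C T)"
    unfolding is_coequalizer_def using T by (simp add: hom_def)
qed

text \<open>
  Regular epimorphisms are orthogonal to jointly monic spans, since the diagonal comes out of the
  coequalizer property of \<open>e\<close>.
\<close>

lemma cover_diagonal:
  assumes e: "cover e S T" and jm: "jointly_monic C u v" "u \<in> hom C Z X" "v \<in> hom C Z Y"
    and xy: "x \<in> hom C T X" "y \<in> hom C T Y"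
    and l: "l \<in> hom C S Z" "u \<cdot> l = x \<cdot> e" "v \<cdot> l = y \<cdot> e"
  shows "\<exists>d \<in> hom C T Z. u \<cdot> d = x \<and> v \<cdot> d = y \<and> d \<cdot> e = l"
proof -
  obtain K f g where fg: "f \<in> hom C K S" "g \<in> hom C K S" "e \<cdot> f = e \<cdot> g"
    and univ: "\<forall>Z. \<forall>h \<in> hom C S Z. h \<cdot> f = h \<cdot> g \<longrightarrow> (\<exists>!k. k \<in> hom C T Z \<and> k \<cdot> e = h)"
    by (rule cover_coequalizer[OF e])
  note e' = cover_hom[OF e]
  have eq: "w \<cdot> (l \<cdot> f) = w \<cdot> (l \<cdot> g)" if w: "w \<in> hom C Z W" "z \<in> hom C T W" "w \<cdot> l = z \<cdot> e" for w W z
    using comp_eq_comp[OF w(3) l(1) w(1) e' w(2) fg(1)] comp_eq_comp[OF w(3) l(1) w(1) e' w(2) fg(2)]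
      fg(3) by simp
  have "l \<cdot> f = l \<cdot> g"
    by (rule jointly_monicD[OF jm(1,2) Comp_in_hom[OF fg(1) l(1)] Comp_in_hom[OF fg(2) l(1)]
          eq[OF jm(2) xy(1) l(2)] eq[OF jm(3) xy(2) l(3)]])
  then have "\<exists>!d. d \<in> hom C T Z \<and> d \<cdot> e = l" using univ l(1) by blast
  then obtain d where d: "d \<in> hom C T Z" "d \<cdot> e = l" by blast
  have "u \<cdot> d = x" "v \<cdot> d = y"
    using cover_epi[OF e Comp_in_hom[OF d(1) jm(2)] xy(1)] cover_epi[OF e Comp_in_hom[OF d(1) jm(3)] xy(2)]
      Comp_assoc[OF e' d(1) jm(2)] Comp_assoc[OF e' d(1) jm(3)] d(2) l by auto
  with d show ?thesis by blast
qed

text \<open>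
  A monomorphism paired with itself is a jointly monic span, so statements about jointly monic
  spans, such as the diagonal above, apply to single monomorphisms too.
\<close>

lemma mono_jointly_monic:
  assumes "is_mono C m" "m \<in> hom C X Y"
  shows "jointly_monic C m m"
  using jointly_monicI[OF assms(2,2)] is_monoD[OF assms] by blast

lemma mono_jointly_monic_comp:
  assumes m: "is_mono C m" "m \<in> hom C Z P" and uv: "jointly_monic C u v" "u \<in> hom C P X" "v \<in> hom C P Y"
  shows "jointly_monic C (u \<cdot> m) (v \<cdot> m)"
proof (rule jointly_monicI[OF Comp_in_hom[OF m(2) uv(2)] Comp_in_hom[OF m(2) uv(3)]])
  fix T f g
  assume fg: "f \<in> hom C T Z" "g \<in> hom C T Z" "(u \<cdot> m) \<cdot> f = (u \<cdot> m) \<cdot> g" "(v \<cdot> m) \<cdot> f = (v \<cdot> m) \<cdot> g"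
  have "m \<cdot> f = m \<cdot> g"
    by (rule jointly_monicD[OF uv(1,2) Comp_in_hom[OF fg(1) m(2)] Comp_in_hom[OF fg(2) m(2)]])
       (use fg uv m in \<open>auto simp: hom_def\<close>)
  then show "f = g" using is_monoD[OF m fg(1,2)] by simp
qed

end

context regular_category
begin

lemma cover_pullback:
  assumes e: "cover e S T" and x: "x \<in> hom C T' T"
  obtains S' e' x' where "cover e' S' T'" "x' \<in> hom C S' S" "x \<cdot> e' = e \<cdot> x'"
proof -
  obtain S' e' x' where P: "e' \<in> hom C S' T'" "x' \<in> hom C S' S" "x \<cdot> e' = e \<cdot> x'" "is_pullback C x e e' x'"
    by (rule pullback_exists[OF x cover_hom[OF e]])
  have "cover e' S' T'"
    using regular_epis_pullback_stable[OF _ P(4)] e P(1) unfolding cover_def by blast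
  then show thesis by (rule that[OF _ P(2,3)])
qed

text \<open>
  The coequalizer \<open>e\<close> of the kernel pair of \<open>f\<close> leaves a monomorphism \<open>m\<close>: two arrows that \<open>m\<close>
  identifies lift along \<open>e\<close> after passing to a cover, and the lifts form a pair in the kernel pair
  of \<open>f\<close>, which \<open>e\<close> identifies.
\<close>

lemma image_factorization:
  assumes f: "f \<in> hom C A B"
  obtains I e m where "cover e A I" "m \<in> hom C I B" "is_mono C m" "m \<cdot> e = f"
proof -
  obtain K p q where pq: "p \<in> hom C K A" "q \<in> hom C K A" "f \<cdot> p = f \<cdot> q" "is_pullback C f f p q"
    by (rule pullback_exists[OF f f])
  then obtain e where e: "is_coequalizer C p q e"
    using coequalizers_of_kernel_pairs unfolding is_kernel_pair_def by blast
  define I where "I = Cod C e"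
  have cA: "Cod C p = A" using pq by (simp add: hom_def)
  have eA: "e \<in> hom C A I" and epq: "e \<cdot> p = e \<cdot> q"
    and univ: "\<forall>T. \<forall>h \<in> hom C A T. h \<cdot> p = h \<cdot> q \<longrightarrow> (\<exists>!k. k \<in> hom C I T \<and> k \<cdot> e = h)"
    using e unfolding is_coequalizer_def I_def cA by auto
  have cov: "cover e A I" by (rule coverI[OF e eA])
  have "\<exists>!k. k \<in> hom C I B \<and> k \<cdot> e = f" using univ f pq(3) by blast
  then obtain m where m: "m \<in> hom C I B" "m \<cdot> e = f" by blast
  have "is_mono C m"
  proof (rule is_monoI[OF m(1)])
    fix T a b
    assume ab: "a \<in> hom C T I" "b \<in> hom C T I" "m \<cdot> a = m \<cdot> b"
    obtain S c a' where c: "cover c S T" "a' \<in> hom C S A" "a \<cdot> c = e \<cdot> a'"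
      by (rule cover_pullback[OF cov ab(1)])
    note c' = cover_hom[OF c(1)]
    obtain R d b' where d: "cover d R S" "b' \<in> hom C R A" "(b \<cdot> c) \<cdot> d = e \<cdot> b'"
      by (rule cover_pullback[OF cov Comp_in_hom[OF c' ab(2)]])
    note d' = cover_hom[OF d(1)]
    have a1: "(a \<cdot> c) \<cdot> d = e \<cdot> (a' \<cdot> d)" using c(3) Comp_assoc[OF d' c(2) eA] by simp
    have mac: "m \<cdot> ((a \<cdot> c) \<cdot> d) = m \<cdot> ((b \<cdot> c) \<cdot> d)"
      using comp_eq_comp[OF ab(3,1) m(1) ab(2) m(1) Comp_in_hom[OF d' c']] ab c' d'
      by (simp add: hom_def)
    have ad: "a' \<cdot> d \<in> hom C R A" by (rule Comp_in_hom[OF d' c(2)])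
    have "f \<cdot> (a' \<cdot> d) = f \<cdot> b'"
      using mac comp_eq[OF m(2) eA m(1) ad] comp_eq[OF m(2) eA m(1) d(2)] a1 d(3) by simp
    from pullback_lift[OF pq(4) f f pq(1) ad d(2) this] obtain h
      where h: "h \<in> hom C R K" "p \<cdot> h = a' \<cdot> d" "q \<cdot> h = b'" by (elim bexE conjE)
    have "e \<cdot> (a' \<cdot> d) = e \<cdot> b'"
      using comp_eq_comp[OF epq pq(1) eA pq(2) eA h(1)] h by simp
    then have "(a \<cdot> c) \<cdot> d = (b \<cdot> c) \<cdot> d" using a1 d(3) by simp
    from cover_epi[OF d(1) Comp_in_hom[OF c' ab(1)] Comp_in_hom[OF c' ab(2)] this]
    show "a = b" by (rule cover_epi[OF c(1) ab(1,2)])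
  qed
  with cov m(1) show thesis by (rule that[OF _ _ _ m(2)])
qed

lemma span_image_factorization:
  assumes a: "a \<in> hom C A X" and b: "b \<in> hom C A Y"
  obtains I e u v where "cover e A I" "u \<in> hom C I X" "v \<in> hom C I Y" "jointly_monic C u v"
    "u \<cdot> e = a" "v \<cdot> e = b"
proof -
  obtain P p q where P: "p \<in> hom C P X" "q \<in> hom C P Y" "jointly_monic C p q"
    "\<forall>T. \<forall>a \<in> hom C T X. \<forall>b \<in> hom C T Y. \<exists>h \<in> hom C T P. p \<cdot> h = a \<and> q \<cdot> h = b"
    by (rule product_exists[OF hom_obj(2)[OF a] hom_obj(2)[OF b]])
  from P(4)[rule_format, OF a b] obtain f where f: "f \<in> hom C A P" "p \<cdot> f = a" "q \<cdot> f = b"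
    by (elim bexE conjE)
  obtain I e m where m: "cover e A I" "m \<in> hom C I P" "is_mono C m" "m \<cdot> e = f"
    by (rule image_factorization[OF f(1)])
  show thesis
    by (rule that[OF m(1) Comp_in_hom[OF m(2) P(1)] Comp_in_hom[OF m(2) P(2)]
          mono_jointly_monic_comp[OF m(3,2) P(3,1,2)]])
       (use Comp_assoc[OF cover_hom[OF m(1)] m(2) P(1)] Comp_assoc[OF cover_hom[OF m(1)] m(2) P(2)] m f in auto)
qed

text \<open>
  Composing coequalizers gives no coequalizer directly, but the mono part of the image of \<open>f \<cdot> e\<close>
  turns out to be invertible, which makes \<open>f \<cdot> e\<close> as good as its regular epi part.
\<close>

lemma cover_comp:
  assumes e: "cover e R S" and f: "cover f S T"
  shows "cover (f \<cdot> e) R T"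
proof -
  note e' = cover_hom[OF e] and f' = cover_hom[OF f]
  obtain I r m where m: "cover r R I" "m \<in> hom C I T" "is_mono C m" "m \<cdot> r = f \<cdot> e"
    by (rule image_factorization[OF Comp_in_hom[OF e' f']])
  note r' = cover_hom[OF m(1)]
  \<comment> \<open>Both \<open>e\<close> and \<open>f\<close> are orthogonal to \<open>m\<close>, so \<open>m\<close> has a section and is invertible.\<close>
  have mm: "jointly_monic C m m" using mono_jointly_monic m by blast
  obtain d where d: "d \<in> hom C S I" "m \<cdot> d = f"
    using cover_diagonal[OF e mm m(2,2) f' f' r' m(4,4)] by blast
  note T = cover_obj(2)[OF f]
  have mf: "m \<cdot> d = Ide C T \<cdot> f" using d(2) Comp_Ide_left[OF f'] by simp
  obtain s where s: "s \<in> hom C T I" "m \<cdot> s = Ide C T"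
    using cover_diagonal[OF f mm m(2,2) Ide_in_hom[OF T] Ide_in_hom[OF T] d(1) mf mf] by blast
  have I: "I \<in> Obj C" using hom_obj(1)[OF m(2)] .
  have sm: "s \<cdot> m = Ide C I"
    by (rule is_monoD[OF m(3,2) Comp_in_hom[OF m(2) s(1)] Ide_in_hom[OF I]])
       (use comp_eq[OF s(2,1) m(2,2)] Comp_Ide_left[OF m(2)] Comp_Ide_right[OF m(2)] in simp)
  obtain K p q where pq: "p \<in> hom C K R" "q \<in> hom C K R" "r \<cdot> p = r \<cdot> q"
    "\<forall>Z. \<forall>h \<in> hom C R Z. h \<cdot> p = h \<cdot> q \<longrightarrow> (\<exists>!k. k \<in> hom C I Z \<and> k \<cdot> r = h)"
    by (rule cover_coequalizer[OF m(1)])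
  have fe: "f \<cdot> e \<in> hom C R T" by (rule Comp_in_hom[OF e' f'])
  show ?thesis
  proof (rule coverI[OF _ fe])
    have "(f \<cdot> e) \<cdot> p = (f \<cdot> e) \<cdot> q"
      unfolding m(4)[symmetric] Comp_assoc[OF pq(1) r' m(2)] Comp_assoc[OF pq(2) r' m(2)] pq(3) ..
    moreover have "\<exists>!k. k \<in> hom C T Z \<and> k \<cdot> (f \<cdot> e) = h" if h: "h \<in> hom C R Z" "h \<cdot> p = h \<cdot> q" for Z h
    proof -
      obtain k where k: "k \<in> hom C I Z" "k \<cdot> r = h" using pq(4) h by blast
      have sfe: "s \<cdot> (f \<cdot> e) = r"
        unfolding m(4)[symmetric] using comp_eq[OF sm m(2) s(1) r'] Comp_Ide_left[OF r'] by simp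
      show ?thesis
      proof (rule ex1I[of _ "k \<cdot> s"])
        show "k \<cdot> s \<in> hom C T Z \<and> (k \<cdot> s) \<cdot> (f \<cdot> e) = h"
          using Comp_in_hom[OF s(1) k(1)] Comp_assoc[OF fe s(1) k(1)] sfe k(2) by simp
        fix l assume l: "l \<in> hom C T Z \<and> l \<cdot> (f \<cdot> e) = h"
        have lm: "l \<cdot> m \<in> hom C I Z" using Comp_in_hom[OF m(2)] l by blast
        have "(l \<cdot> m) \<cdot> r = k \<cdot> r" using Comp_assoc[OF r' m(2), of l Z] l k m(4) by simp
        then have "l \<cdot> m = k" by (rule cover_epi[OF m(1) lm k(1)])
        then show "l = k \<cdot> s" using Comp_assoc[OF s(1) m(2), of l Z] l s(2) Comp_Ide_right[of l T Z] by simp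
      qed
    qed
    ultimately show "is_coequalizer C p q (f \<cdot> e)"
      unfolding is_coequalizer_def using pq fe by (simp add: hom_def)
  qed
qed

end

section \<open>Relations on generalized elements\<close>

context category
begin

text \<open>
  The generalized elements \<open>x : T \<rightarrow> X\<close> and \<open>y : T \<rightarrow> Y\<close> are related by \<open>\<phi>\<close> when the span they form
  factors through \<open>\<phi>\<close>. A relation is determined by the pairs it relates, which is what makes
  elementwise reasoning possible.
\<close>

definition related :: "('a \<times> 'a) set \<Rightarrow> 'a \<Rightarrow> 'a \<Rightarrow> bool" where
  "related \<phi> x y \<longleftrightarrow> (\<exists>s \<in> \<phi>. span_factors C (x, y) s)"

lemma monic_spans_iff:
  "(u, v) \<in> monic_spans C X Y \<longleftrightarrow>
     jointly_monic C u v \<and> u \<in> hom C (Dom C u) X \<and> v \<in> hom C (Dom C u) Y"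
  unfolding monic_spans_def jointly_monic_def hom_def by auto

lemma span_factors_iff:
  "span_factors C (x, y) (u, v) \<longleftrightarrow> (\<exists>h \<in> hom C (Dom C x) (Dom C u). u \<cdot> h = x \<and> v \<cdot> h = y)"
  unfolding span_factors_def by simp

lemma span_factorsI:
  assumes "h \<in> hom C T Z" "u \<in> hom C Z X" "u \<cdot> h = x" "v \<cdot> h = y"
  shows "span_factors C (x, y) (u, v)"
proof -
  have "Dom C x = T" "Dom C u = Z" using assms by (auto simp: hom_def)
  with assms show ?thesis unfolding span_factors_iff by auto
qed

lemma span_factors_refl:
  assumes "(u, v) \<in> monic_spans C X Y"
  shows "span_factors C (u, v) (u, v)"
proof -
  have uv: "u \<in> hom C (Dom C u) X" "v \<in> hom C (Dom C u) Y" using assms unfolding monic_spans_iff by auto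
  show ?thesis
    by (rule span_factorsI[OF Ide_in_hom[OF hom_obj(1)[OF uv(1)]] uv(1)])
       (use Comp_Ide_right[OF uv(1)] Comp_Ide_right[OF uv(2)] in auto)
qed

lemma span_factors_trans:
  assumes s: "span_factors C (x, y) (u, v)" and t: "span_factors C (u, v) (u', v')"
    and uv: "(u, v) \<in> monic_spans C X Y" and uv': "(u', v') \<in> monic_spans C X Y"
  shows "span_factors C (x, y) (u', v')"
proof -
  obtain h where h: "h \<in> hom C (Dom C x) (Dom C u)" "u \<cdot> h = x" "v \<cdot> h = y"
    using s unfolding span_factors_iff by blast
  obtain k where k: "k \<in> hom C (Dom C u) (Dom C u')" "u' \<cdot> k = u" "v' \<cdot> k = v"
    using t unfolding span_factors_iff by blast
  have u': "u' \<in> hom C (Dom C u') X" "v' \<in> hom C (Dom C u') Y" using uv' monic_spans_iff by auto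
  show ?thesis
    by (rule span_factorsI[OF Comp_in_hom[OF h(1) k(1)] u'(1)])
       (use comp_eq[OF k(2,1) u'(1) h(1)] comp_eq[OF k(3,1) u'(2) h(1)] h in auto)
qed

text \<open>
  Factorizations in both directions are mutually inverse because the spans are jointly monic, so
  isomorphism of spans is equality in the factorization preorder.
\<close>

lemma span_iso_iff:
  "((u, v), (u', v')) \<in> span_iso C X Y \<longleftrightarrow>
     (u, v) \<in> monic_spans C X Y \<and> (u', v') \<in> monic_spans C X Y \<and>
     span_factors C (u, v) (u', v') \<and> span_factors C (u', v') (u, v)"
  (is "?l \<longleftrightarrow> ?r")
proof
  assume ?l
  then obtain i where ms: "(u, v) \<in> monic_spans C X Y" "(u', v') \<in> monic_spans C X Y"
    and i: "i \<in> hom C (Dom C u') (Dom C u)" "is_iso C i" "u \<cdot> i = u'" "v \<cdot> i = v'"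
    unfolding span_iso_def by auto
  obtain j where j: "j \<in> hom C (Dom C u) (Dom C u')" "i \<cdot> j = Ide C (Dom C u)"
    using is_isoD[OF i(2,1)] by blast
  note uv = ms[unfolded monic_spans_iff]
  have "u' \<cdot> j = u" "v' \<cdot> j = v"
    using comp_eq[OF i(3,1) _ j(1), of X] comp_eq[OF i(4,1) _ j(1), of Y] uv j(2)
      Comp_Ide_right by metis+
  then have "span_factors C (u, v) (u', v')" "span_factors C (u', v') (u, v)"
    using i j unfolding span_factors_iff by blast+
  with ms show ?r by blast
next
  assume r: ?r
  then obtain h k where h: "h \<in> hom C (Dom C u) (Dom C u')" "u' \<cdot> h = u" "v' \<cdot> h = v"
    and k: "k \<in> hom C (Dom C u') (Dom C u)" "u \<cdot> k = u'" "v \<cdot> k = v'"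
    unfolding span_factors_iff by blast
  have inverse: "k \<cdot> h = Ide C (Dom C u)"
    if "(u, v) \<in> monic_spans C X Y" "(u', v') \<in> monic_spans C X Y"
      "h \<in> hom C (Dom C u) (Dom C u')" "u' \<cdot> h = u" "v' \<cdot> h = v"
      "k \<in> hom C (Dom C u') (Dom C u)" "u \<cdot> k = u'" "v \<cdot> k = v'" for u v u' v' h k
  proof -
    have uv: "jointly_monic C u v" "u \<in> hom C (Dom C u) X" "v \<in> hom C (Dom C u) Y"
      using that(1) monic_spans_iff by auto
    show ?thesis
      by (rule jointly_monicD[OF uv(1,2) Comp_in_hom[OF that(3,6)] Ide_in_hom[OF hom_obj(1)[OF uv(2)]]])
         (use comp_eq[OF that(7,6) uv(2) that(3)] comp_eq[OF that(8,6) uv(3) that(3)] that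
            Comp_Ide_right[OF uv(2)] Comp_Ide_right[OF uv(3)] in auto)
  qed
  have "is_iso C k"
    by (rule is_isoI[OF k(1) h(1)]) (use inverse[of u' v' u v k h] inverse[of u v u' v' h k] r h k in auto)
  with r k show ?l unfolding span_iso_def by auto
qed

lemma Rel_of_span:
  assumes "(u, v) \<in> monic_spans C X Y"
  obtains \<phi> where "\<phi> \<in> Rel C X Y" "(u, v) \<in> \<phi>"
proof (rule that)
  show "span_iso C X Y `` {(u, v)} \<in> Rel C X Y" unfolding Rel_def using assms by (rule quotientI)
  show "(u, v) \<in> span_iso C X Y `` {(u, v)}"
    using assms span_factors_refl span_iso_iff by auto
qed

lemma Rel_mem_iff:
  assumes \<phi>: "\<phi> \<in> Rel C X Y" and uv: "(u, v) \<in> \<phi>"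
  shows "(u', v') \<in> \<phi> \<longleftrightarrow> ((u, v), (u', v')) \<in> span_iso C X Y"
proof -
  obtain u0 v0 where e: "\<phi> = span_iso C X Y `` {(u0, v0)}" using \<phi> unfolding Rel_def quotient_def by auto
  have "((u0, v0), (u, v)) \<in> span_iso C X Y" using uv e by auto
  then show ?thesis unfolding e Image_singleton_iff span_iso_iff using span_factors_trans by blast
qed

lemma Rel_nonempty:
  assumes "\<phi> \<in> Rel C X Y"
  obtains u v where "(u, v) \<in> \<phi>"
proof -
  obtain u v where "\<phi> = span_iso C X Y `` {(u, v)}" "(u, v) \<in> monic_spans C X Y"
    using assms unfolding Rel_def quotient_def by auto
  then show thesis using that[of u v] span_factors_refl span_iso_iff by auto
qed

lemma Rel_rep:
  assumes \<phi>: "\<phi> \<in> Rel C X Y" and uv: "(u, v) \<in> \<phi>"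
  shows "(u, v) \<in> monic_spans C X Y" "related \<phi> x y \<longleftrightarrow> span_factors C (x, y) (u, v)"
proof -
  show ms: "(u, v) \<in> monic_spans C X Y" using Rel_mem_iff[OF \<phi> uv, of u v] uv span_iso_iff by auto
  show "related \<phi> x y \<longleftrightarrow> span_factors C (x, y) (u, v)"
  proof
    assume "related \<phi> x y"
    then obtain u' v' where s: "(u', v') \<in> \<phi>" "span_factors C (x, y) (u', v')"
      unfolding related_def by auto
    then show "span_factors C (x, y) (u, v)"
      using Rel_mem_iff[OF \<phi> uv, of u' v'] span_factors_trans unfolding span_iso_iff by blast
  next
    show "span_factors C (x, y) (u, v) \<Longrightarrow> related \<phi> x y" using uv unfolding related_def by blast
  qed
qed

lemma related_hom:
  assumes \<phi>: "\<phi> \<in> Rel C X Y" and xy: "related \<phi> x y"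
  shows "x \<in> hom C (Dom C x) X" "y \<in> hom C (Dom C x) Y"
proof -
  obtain u v where uv: "(u, v) \<in> \<phi>" using \<phi> by (rule Rel_nonempty)
  note ms = Rel_rep(1)[OF \<phi> uv, unfolded monic_spans_iff]
  obtain h where "h \<in> hom C (Dom C x) (Dom C u)" "u \<cdot> h = x" "v \<cdot> h = y"
    using xy unfolding Rel_rep(2)[OF \<phi> uv] span_factors_iff by blast
  with ms show "x \<in> hom C (Dom C x) X" "y \<in> hom C (Dom C x) Y" using Comp_in_hom by blast+
qed

lemma related_hom_right:
  assumes "\<phi> \<in> Rel C X Y" "related \<phi> x y" "x \<in> hom C T X'"
  shows "y \<in> hom C T Y"
  using related_hom[OF assms(1,2)] assms(3) by (simp add: hom_def)

lemma related_hom_left: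
  assumes "\<phi> \<in> Rel C X Y" "related \<phi> x y" "y \<in> hom C T Y'"
  shows "x \<in> hom C T X"
  using related_hom[OF assms(1,2)] assms(3) by (simp add: hom_def)

lemma related_comp:
  assumes \<phi>: "\<phi> \<in> Rel C X Y" and xy: "related \<phi> x y" and x: "x \<in> hom C T X'" and t: "t \<in> hom C S T"
  shows "related \<phi> (x \<cdot> t) (y \<cdot> t)"
proof -
  obtain u v where uv: "(u, v) \<in> \<phi>" using \<phi> by (rule Rel_nonempty)
  note ms = Rel_rep(1)[OF \<phi> uv, unfolded monic_spans_iff]
  have "Dom C x = T" using x by (simp add: hom_def)
  then obtain h where h: "h \<in> hom C T (Dom C u)" "u \<cdot> h = x" "v \<cdot> h = y"
    using xy unfolding Rel_rep(2)[OF \<phi> uv] span_factors_iff by blast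
  show ?thesis unfolding Rel_rep(2)[OF \<phi> uv]
    by (rule span_factorsI[OF Comp_in_hom[OF t h(1)]])
       (use ms comp_eq[OF h(2,1) _ t] comp_eq[OF h(3,1) _ t] in blast)+
qed

text \<open>
  Relations have the sheaf property for covers: a factorization through a jointly monic span that
  exists after covering descends along the diagonal.
\<close>

lemma related_local:
  assumes \<phi>: "\<phi> \<in> Rel C X Y" and e: "cover e S T" and x: "x \<in> hom C T X" and y: "y \<in> hom C T Y"
    and r: "related \<phi> (x \<cdot> e) (y \<cdot> e)"
  shows "related \<phi> x y"
proof -
  obtain u v where uv: "(u, v) \<in> \<phi>" using \<phi> by (rule Rel_nonempty)
  have ms: "jointly_monic C u v" "u \<in> hom C (Dom C u) X" "v \<in> hom C (Dom C u) Y"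
    using Rel_rep(1)[OF \<phi> uv] unfolding monic_spans_iff by auto
  have "Dom C (x \<cdot> e) = S" using Comp_in_hom[OF cover_hom[OF e] x] by (simp add: hom_def)
  then obtain h where h: "h \<in> hom C S (Dom C u)" "u \<cdot> h = x \<cdot> e" "v \<cdot> h = y \<cdot> e"
    using r unfolding Rel_rep(2)[OF \<phi> uv] span_factors_iff by metis
  obtain d where "d \<in> hom C T (Dom C u)" "u \<cdot> d = x" "v \<cdot> d = y"
    using cover_diagonal[OF e ms x y h] by blast
  then show ?thesis unfolding Rel_rep(2)[OF \<phi> uv] using ms span_factorsI by blast
qed

lemma Rel_subset:
  assumes \<phi>: "\<phi> \<in> Rel C X Y" and \<psi>: "\<psi> \<in> Rel C X Y"
    and eq: "\<And>T x y. x \<in> hom C T X \<Longrightarrow> y \<in> hom C T Y \<Longrightarrow> related \<phi> x y \<longleftrightarrow> related \<psi> x y"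
  shows "\<phi> \<subseteq> \<psi>"
proof clarify
  fix u v assume uv: "(u, v) \<in> \<phi>"
  obtain u' v' where uv': "(u', v') \<in> \<psi>" using \<psi> by (rule Rel_nonempty)
  note ms = Rel_rep(1)[OF \<phi> uv] and ms' = Rel_rep(1)[OF \<psi> uv']
  have "span_factors C (u, v) (u', v')" "span_factors C (u', v') (u, v)"
    using eq[of u "Dom C u" v] eq[of u' "Dom C u'" v'] ms ms' span_factors_refl[OF ms]
      span_factors_refl[OF ms']
    unfolding Rel_rep(2)[OF \<phi> uv] Rel_rep(2)[OF \<psi> uv'] monic_spans_iff by blast+
  with ms ms' show "(u, v) \<in> \<psi>" unfolding Rel_mem_iff[OF \<psi> uv'] span_iso_iff by blast
qed

lemma Rel_eqI:
  assumes "\<phi> \<in> Rel C X Y" "\<psi> \<in> Rel C X Y"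
    and "\<And>T x y. x \<in> hom C T X \<Longrightarrow> y \<in> hom C T Y \<Longrightarrow> related \<phi> x y \<longleftrightarrow> related \<psi> x y"
  shows "\<phi> = \<psi>"
  using Rel_subset[OF assms(1,2)] Rel_subset[OF assms(2,1)] assms(3) by blast

lemma rel_le_iff:
  assumes \<phi>: "\<phi> \<in> Rel C X Y" and \<psi>: "\<psi> \<in> Rel C X Y"
  shows "rel_le C \<phi> \<psi> \<longleftrightarrow> (\<forall>x y. related \<phi> x y \<longrightarrow> related \<psi> x y)"
proof
  assume "rel_le C \<phi> \<psi>"
  then obtain u v u' v' where uv: "(u, v) \<in> \<phi>" "(u', v') \<in> \<psi>" "span_factors C (u, v) (u', v')"
    unfolding rel_le_def by auto
  then show "\<forall>x y. related \<phi> x y \<longrightarrow> related \<psi> x y"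
    unfolding Rel_rep(2)[OF \<phi> uv(1)] Rel_rep(2)[OF \<psi> uv(2)]
    using span_factors_trans Rel_rep(1)[OF \<phi> uv(1)] Rel_rep(1)[OF \<psi> uv(2)] by blast
next
  assume r: "\<forall>x y. related \<phi> x y \<longrightarrow> related \<psi> x y"
  obtain u v u' v' where uv: "(u, v) \<in> \<phi>" "(u', v') \<in> \<psi>" using \<phi> \<psi> Rel_nonempty by metis
  have "span_factors C (u, v) (u', v')"
    using r span_factors_refl[OF Rel_rep(1)[OF \<phi> uv(1)]]
    unfolding Rel_rep(2)[OF \<phi> uv(1)] Rel_rep(2)[OF \<psi> uv(2)] by blast
  with uv show "rel_le C \<phi> \<psi>" unfolding rel_le_def by blast
qed

lemma monic_spans_swap: "(u, v) \<in> monic_spans C X Y \<Longrightarrow> (v, u) \<in> monic_spans C Y X"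
  unfolding monic_spans_def jointly_monic_def by auto

lemma span_factors_swap:
  assumes "(x, y) \<in> monic_spans C X Y" "(u, v) \<in> monic_spans C X Y" "span_factors C (x, y) (u, v)"
  shows "span_factors C (y, x) (v, u)"
proof -
  have "Dom C y = Dom C x" "Dom C v = Dom C u" using assms unfolding monic_spans_iff hom_def by auto
  with assms(3) show ?thesis unfolding span_factors_iff by auto
qed

lemma span_iso_swap:
  "((u, v), (u', v')) \<in> span_iso C X Y \<Longrightarrow> ((v, u), (v', u')) \<in> span_iso C Y X"
  unfolding span_iso_iff using monic_spans_swap span_factors_swap by blast

lemma Rel_converse:
  assumes \<phi>: "\<phi> \<in> Rel C X Y"
  shows "\<phi>\<inverse> \<in> Rel C Y X" "related (\<phi>\<inverse>) y x \<longleftrightarrow> related \<phi> x y"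
proof -
  obtain u v where uv: "(u, v) \<in> \<phi>" using \<phi> by (rule Rel_nonempty)
  note ms = Rel_rep(1)[OF \<phi> uv]
  obtain \<psi> where \<psi>: "\<psi> \<in> Rel C Y X" "(v, u) \<in> \<psi>" by (rule Rel_of_span[OF monic_spans_swap[OF ms]])
  have "\<phi>\<inverse> = \<psi>"
  proof (rule set_eqI, clarify)
    fix b a
    have "(b, a) \<in> \<phi>\<inverse> \<longleftrightarrow> ((u, v), (a, b)) \<in> span_iso C X Y" using Rel_mem_iff[OF \<phi> uv] by simp
    also have "\<dots> \<longleftrightarrow> ((v, u), (b, a)) \<in> span_iso C Y X" using span_iso_swap by blast
    finally show "(b, a) \<in> \<phi>\<inverse> \<longleftrightarrow> (b, a) \<in> \<psi>" using Rel_mem_iff[OF \<psi>] by simp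
  qed
  with \<psi> show conv: "\<phi>\<inverse> \<in> Rel C Y X" by simp
  have vu: "(v, u) \<in> \<phi>\<inverse>" using uv by simp
  have swap: "related (\<phi>\<inverse>) y x \<longleftrightarrow> related \<phi> x y" if "Dom C x = Dom C y"
    unfolding Rel_rep(2)[OF conv vu] Rel_rep(2)[OF \<phi> uv] span_factors_iff
    using that ms unfolding monic_spans_iff hom_def by auto
  show "related (\<phi>\<inverse>) y x \<longleftrightarrow> related \<phi> x y"
  proof (cases "Dom C x = Dom C y")
    case False
    then show ?thesis
      using related_hom(2)[OF conv, of y x] related_hom(2)[OF \<phi>, of x y] unfolding hom_def by auto
  qed (rule swap)
qed

lemma iso_cover:
  assumes "is_iso C k" "k \<in> hom C X Y"
  shows "cover k X Y"
proof (rule coverI[OF _ assms(2)])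
  obtain j where j: "j \<in> hom C Y X" "j \<cdot> k = Ide C X" "k \<cdot> j = Ide C Y" using is_isoD[OF assms] by blast
  note XY = hom_obj[OF assms(2)]
  have "\<exists>!l. l \<in> hom C Y T \<and> l \<cdot> k = h" if h: "h \<in> hom C X T" for T h
  proof (rule ex1I[of _ "h \<cdot> j"])
    show "h \<cdot> j \<in> hom C Y T \<and> (h \<cdot> j) \<cdot> k = h"
      using Comp_in_hom[OF j(1) h] Comp_assoc[OF assms(2) j(1) h] j(2) Comp_Ide_right[OF h] by simp
    fix l assume l: "l \<in> hom C Y T \<and> l \<cdot> k = h"
    then show "l = h \<cdot> j" using Comp_assoc[OF j(1) assms(2), of l T] j(3) Comp_Ide_right[of l Y T] by simp
  qed
  then show "is_coequalizer C (Ide C X) (Ide C X) k"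
    unfolding is_coequalizer_def using XY assms(2) by (simp add: hom_def)
qed

end

context regular_category
begin

text \<open>
  The image of a span is its existential quantification: \<open>x\<close> and \<open>y\<close> are in the image when, on a
  cover, they come from a common element of the apex.
\<close>

lemma span_image:
  assumes a: "a \<in> hom C A X" and b: "b \<in> hom C A Y" and uv: "(u, v) \<in> span_image C a b"
  shows "(u, v) \<in> monic_spans C X Y"
    and "x \<in> hom C T X \<Longrightarrow> y \<in> hom C T Y \<Longrightarrow> span_factors C (x, y) (u, v) \<longleftrightarrow>
      (\<exists>S e t. cover e S T \<and> t \<in> hom C S A \<and> a \<cdot> t = x \<cdot> e \<and> b \<cdot> t = y \<cdot> e)"
proof -
  have A: "Dom C a = A" using a by (simp add: hom_def)
  obtain r where jm: "jointly_monic C u v" and r: "cover r A (Dom C u)" "u \<cdot> r = a" "v \<cdot> r = b"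
    using uv unfolding span_image_def cover_def A by blast
  note r' = cover_hom[OF r(1)]
  have uh: "u \<in> hom C (Dom C u) X"
    using jm a r r' comp_arr(3)[of r u] unfolding jointly_monic_def hom_def by auto
  have vh: "v \<in> hom C (Dom C u) Y"
    using jm b r r' comp_arr(3)[of r v] unfolding jointly_monic_def hom_def by auto
  show "(u, v) \<in> monic_spans C X Y" unfolding monic_spans_iff using jm uh vh by blast
  assume x: "x \<in> hom C T X" and y: "y \<in> hom C T Y"
  have T: "Dom C x = T" using x by (simp add: hom_def)
  show "span_factors C (x, y) (u, v) \<longleftrightarrow>
      (\<exists>S e t. cover e S T \<and> t \<in> hom C S A \<and> a \<cdot> t = x \<cdot> e \<and> b \<cdot> t = y \<cdot> e)"
  proof
    assume "span_factors C (x, y) (u, v)"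
    then obtain h where h: "h \<in> hom C T (Dom C u)" "u \<cdot> h = x" "v \<cdot> h = y"
      unfolding span_factors_iff T by blast
    obtain S e t where e: "cover e S T" "t \<in> hom C S A" "h \<cdot> e = r \<cdot> t"
      by (rule cover_pullback[OF r(1) h(1)])
    note e' = cover_hom[OF e(1)]
    have "a \<cdot> t = x \<cdot> e"
      using comp_eq[OF r(2) r' uh e(2)] comp_eq[OF h(2,1) uh e'] e(3) by simp
    moreover have "b \<cdot> t = y \<cdot> e"
      using comp_eq[OF r(3) r' vh e(2)] comp_eq[OF h(3,1) vh e'] e(3) by simp
    ultimately show "\<exists>S e t. cover e S T \<and> t \<in> hom C S A \<and> a \<cdot> t = x \<cdot> e \<and> b \<cdot> t = y \<cdot> e"
      using e by blast
  next
    assume "\<exists>S e t. cover e S T \<and> t \<in> hom C S A \<and> a \<cdot> t = x \<cdot> e \<and> b \<cdot> t = y \<cdot> e"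
    then obtain S e t where e: "cover e S T" "t \<in> hom C S A" "a \<cdot> t = x \<cdot> e" "b \<cdot> t = y \<cdot> e" by blast
    obtain d where "d \<in> hom C T (Dom C u)" "u \<cdot> d = x" "v \<cdot> d = y"
      using cover_diagonal[OF e(1) jm uh vh x y Comp_in_hom[OF e(2) r']]
        comp_eq[OF r(2) r' uh e(2)] comp_eq[OF r(3) r' vh e(2)] e by auto
    then show "span_factors C (x, y) (u, v)" using span_factorsI uh by blast
  qed
qed

lemma span_image_nonempty:
  assumes a: "a \<in> hom C A X" and b: "b \<in> hom C A Y"
  obtains u v where "(u, v) \<in> span_image C a b"
proof -
  have A: "Dom C a = A" using a by (simp add: hom_def)
  obtain I e u v where I: "cover e A I" "u \<in> hom C I X" "v \<in> hom C I Y" "jointly_monic C u v"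
    "u \<cdot> e = a" "v \<cdot> e = b"
    by (rule span_image_factorization[OF a b])
  have "Dom C u = I" using I by (simp add: hom_def)
  then show thesis using that[of u v] I unfolding span_image_def A cover_def by blast
qed

lemma span_image_iso_closed:
  assumes a: "a \<in> hom C A X" and b: "b \<in> hom C A Y" and uv: "(u, v) \<in> span_image C a b"
    and iso: "((u, v), (u', v')) \<in> span_iso C X Y"
  shows "(u', v') \<in> span_image C a b"
proof -
  have A: "Dom C a = A" using a by (simp add: hom_def)
  obtain r where r: "cover r A (Dom C u)" "u \<cdot> r = a" "v \<cdot> r = b"
    using uv unfolding span_image_def cover_def A by blast
  from iso have ms: "(u, v) \<in> monic_spans C X Y" "(u', v') \<in> monic_spans C X Y"
    unfolding span_iso_iff by blast+
  have "((u', v'), (u, v)) \<in> span_iso C X Y" using iso unfolding span_iso_iff by blast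
  then obtain k where k: "k \<in> hom C (Dom C u) (Dom C u')" "is_iso C k" "u' \<cdot> k = u" "v' \<cdot> k = v"
    unfolding span_iso_def by auto
  have c: "cover (k \<cdot> r) A (Dom C u')" by (rule cover_comp[OF r(1) iso_cover[OF k(2,1)]])
  have uv': "jointly_monic C u' v'" "u' \<in> hom C (Dom C u') X" "v' \<in> hom C (Dom C u') Y"
    using ms(2) unfolding monic_spans_iff by auto
  have "u' \<cdot> (k \<cdot> r) = a" "v' \<cdot> (k \<cdot> r) = b"
    using comp_eq[OF k(3,1) uv'(2) cover_hom[OF r(1)]] comp_eq[OF k(4,1) uv'(3) cover_hom[OF r(1)]] r
    by auto
  with c uv'(1) show ?thesis unfolding span_image_def A cover_def by blast
qed

lemma rel_comp_rep:
  assumes \<phi>: "\<phi> \<in> Rel C X Y" and \<psi>: "\<psi> \<in> Rel C Y Z"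
    and uv: "(u, v) \<in> \<phi>" and uv': "(u', v') \<in> \<psi>" and P: "is_pullback C v u' p q"
    and w: "(a, b) \<in> span_image C (u \<cdot> p) (v' \<cdot> q)"
  shows "(a, b) \<in> monic_spans C X Z"
    and "x \<in> hom C T X \<Longrightarrow> z \<in> hom C T Z \<Longrightarrow> span_factors C (x, z) (a, b) \<longleftrightarrow>
      (\<exists>S e y. cover e S T \<and> related \<phi> (x \<cdot> e) y \<and> related \<psi> y (z \<cdot> e))"
proof -
  have u: "u \<in> hom C (Dom C u) X" "v \<in> hom C (Dom C u) Y"
    using Rel_rep(1)[OF \<phi> uv] unfolding monic_spans_iff by auto
  have u': "u' \<in> hom C (Dom C u') Y" "v' \<in> hom C (Dom C u') Z"
    using Rel_rep(1)[OF \<psi> uv'] unfolding monic_spans_iff by auto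
  note pq = pullback_square[OF P u(2) u'(1)]
  have up: "u \<cdot> p \<in> hom C (Dom C p) X" and vq: "v' \<cdot> q \<in> hom C (Dom C p) Z"
    using Comp_in_hom pq u u' by blast+
  show "(a, b) \<in> monic_spans C X Z" by (rule span_image(1)[OF up vq w])
  assume x: "x \<in> hom C T X" and z: "z \<in> hom C T Z"
  show "span_factors C (x, z) (a, b) \<longleftrightarrow>
      (\<exists>S e y. cover e S T \<and> related \<phi> (x \<cdot> e) y \<and> related \<psi> y (z \<cdot> e))"
    unfolding span_image(2)[OF up vq w x z] Rel_rep(2)[OF \<phi> uv] Rel_rep(2)[OF \<psi> uv']
  proof
    assume "\<exists>S e t. cover e S T \<and> t \<in> hom C S (Dom C p) \<and> (u \<cdot> p) \<cdot> t = x \<cdot> e \<and> (v' \<cdot> q) \<cdot> t = z \<cdot> e"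
    then obtain S e t where e: "cover e S T" and t: "t \<in> hom C S (Dom C p)"
      "(u \<cdot> p) \<cdot> t = x \<cdot> e" "(v' \<cdot> q) \<cdot> t = z \<cdot> e" by blast
    have "span_factors C (x \<cdot> e, v \<cdot> (p \<cdot> t)) (u, v)"
      by (rule span_factorsI[OF Comp_in_hom[OF t(1) pq(1)] u(1)])
         (use Comp_assoc[OF t(1) pq(1) u(1)] t in auto)
    moreover have "span_factors C (v \<cdot> (p \<cdot> t), z \<cdot> e) (u', v')"
      by (rule span_factorsI[OF Comp_in_hom[OF t(1) pq(2)] u'(1)])
         (use Comp_assoc[OF t(1) pq(2) u'(2)] t comp_eq_comp[OF pq(3) pq(1) u(2) pq(2) u'(1) t(1)] in auto)
    ultimately show "\<exists>S e y. cover e S T \<and> span_factors C (x \<cdot> e, y) (u, v) \<and> span_factors C (y, z \<cdot> e) (u', v')"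
      using e by blast
  next
    assume "\<exists>S e y. cover e S T \<and> span_factors C (x \<cdot> e, y) (u, v) \<and> span_factors C (y, z \<cdot> e) (u', v')"
    then obtain S e y where e: "cover e S T" and s: "span_factors C (x \<cdot> e, y) (u, v)"
      and s': "span_factors C (y, z \<cdot> e) (u', v')" by blast
    have xe: "Dom C (x \<cdot> e) = S" using Comp_in_hom[OF cover_hom[OF e] x] by (simp add: hom_def)
    obtain h where h: "h \<in> hom C S (Dom C u)" "u \<cdot> h = x \<cdot> e" "v \<cdot> h = y"
      using s unfolding span_factors_iff xe by blast
    have "Dom C y = S" using h Comp_in_hom[OF h(1) u(2)] by (simp add: hom_def)
    then obtain k where k: "k \<in> hom C S (Dom C u')" "u' \<cdot> k = y" "v' \<cdot> k = z \<cdot> e"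
      using s' unfolding span_factors_iff by blast
    have "v \<cdot> h = u' \<cdot> k" using h(3) k(2) by simp
    then obtain t where t: "t \<in> hom C S (Dom C p)" "p \<cdot> t = h" "q \<cdot> t = k"
      using pullback_lift[OF P u(2) u'(1) pq(1) h(1) k(1)] by blast
    show "\<exists>S e t. cover e S T \<and> t \<in> hom C S (Dom C p) \<and> (u \<cdot> p) \<cdot> t = x \<cdot> e \<and> (v' \<cdot> q) \<cdot> t = z \<cdot> e"
      using e t(1) Comp_assoc[OF t(1) pq(1) u(1)] Comp_assoc[OF t(1) pq(2) u'(2)] t h k by auto
  qed
qed

text \<open>
  Both the pullback and the image that enter a composite are determined up to isomorphism by
  their generalized elements, so the set of all choices is one isomorphism class.
\<close>

lemma Rel_rel_comp:
  assumes \<phi>: "\<phi> \<in> Rel C X Y" and \<psi>: "\<psi> \<in> Rel C Y Z"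
  shows "rel_comp C \<psi> \<phi> \<in> Rel C X Z"
    and "x \<in> hom C T X \<Longrightarrow> z \<in> hom C T Z \<Longrightarrow> related (rel_comp C \<psi> \<phi>) x z \<longleftrightarrow>
      (\<exists>S e y. cover e S T \<and> related \<phi> (x \<cdot> e) y \<and> related \<psi> y (z \<cdot> e))"
proof -
  obtain u v where uv: "(u, v) \<in> \<phi>" using \<phi> by (rule Rel_nonempty)
  obtain u' v' where uv': "(u', v') \<in> \<psi>" using \<psi> by (rule Rel_nonempty)
  have u: "u \<in> hom C (Dom C u) X" "v \<in> hom C (Dom C u) Y"
    using Rel_rep(1)[OF \<phi> uv] unfolding monic_spans_iff by auto
  have u': "u' \<in> hom C (Dom C u') Y" "v' \<in> hom C (Dom C u') Z"
    using Rel_rep(1)[OF \<psi> uv'] unfolding monic_spans_iff by auto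
  obtain P p q where P: "p \<in> hom C P (Dom C u)" "q \<in> hom C P (Dom C u')" "v \<cdot> p = u' \<cdot> q" "is_pullback C v u' p q"
    by (rule pullback_exists[OF u(2) u'(1)])
  note up = Comp_in_hom[OF P(1) u(1)] and vq = Comp_in_hom[OF P(2) u'(2)]
  obtain a b where ab: "(a, b) \<in> span_image C (u \<cdot> p) (v' \<cdot> q)" by (rule span_image_nonempty[OF up vq])
  note rep = rel_comp_rep[OF \<phi> \<psi> uv uv' P(4) ab]
  obtain \<chi> where \<chi>: "\<chi> \<in> Rel C X Z" "(a, b) \<in> \<chi>" by (rule Rel_of_span[OF rep(1)])
  have "rel_comp C \<psi> \<phi> = \<chi>"
  proof (rule set_eqI, clarify)
    fix c d
    show "(c, d) \<in> rel_comp C \<psi> \<phi> \<longleftrightarrow> (c, d) \<in> \<chi>"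
    proof
      assume "(c, d) \<in> rel_comp C \<psi> \<phi>"
      then obtain u1 v1 u1' v1' p1 q1 where 1: "(u1, v1) \<in> \<phi>" "(u1', v1') \<in> \<psi>" "is_pullback C v1 u1' p1 q1"
        "(c, d) \<in> span_image C (u1 \<cdot> p1) (v1' \<cdot> q1)"
        unfolding rel_comp_def by blast
      note rep1 = rel_comp_rep[OF \<phi> \<psi> 1]
      have same: "span_factors C (x, z) (a, b) \<longleftrightarrow> span_factors C (x, z) (c, d)"
        if "(x, z) \<in> monic_spans C X Z" for x z
        using rep(2)[of x "Dom C x" z] rep1(2)[of x "Dom C x" z] that unfolding monic_spans_iff by blast
      show "(c, d) \<in> \<chi>"
        unfolding Rel_mem_iff[OF \<chi>] span_iso_iff
        using same[OF rep(1)] same[OF rep1(1)] span_factors_refl[OF rep(1)] span_factors_refl[OF rep1(1)]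
          rep(1) rep1(1) by blast
    next
      assume "(c, d) \<in> \<chi>"
      then have "((a, b), (c, d)) \<in> span_iso C X Z" using Rel_mem_iff[OF \<chi>] by blast
      from span_image_iso_closed[OF up vq ab this] show "(c, d) \<in> rel_comp C \<psi> \<phi>"
        unfolding rel_comp_def using uv uv' P(4) by blast
    qed
  qed
  then show "rel_comp C \<psi> \<phi> \<in> Rel C X Z"
    and "x \<in> hom C T X \<Longrightarrow> z \<in> hom C T Z \<Longrightarrow> related (rel_comp C \<psi> \<phi>) x z \<longleftrightarrow>
      (\<exists>S e y. cover e S T \<and> related \<phi> (x \<cdot> e) y \<and> related \<psi> y (z \<cdot> e))"
    using \<chi>(1) rep(2) Rel_rep(2)[OF \<chi>] by simp_all
qed

section \<open>Composition of relations on elements\<close>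

lemma rel_compI:
  assumes \<phi>: "\<phi> \<in> Rel C X Y" and \<psi>: "\<psi> \<in> Rel C Y Z" and xy: "related \<phi> x y" and yz: "related \<psi> y z"
  shows "related (rel_comp C \<psi> \<phi>) x z"
proof -
  note x = related_hom(1)[OF \<phi> xy] and y = related_hom(2)[OF \<phi> xy]
  note z = related_hom_right[OF \<psi> yz y]
  have "x \<cdot> Ide C (Dom C x) = x" "z \<cdot> Ide C (Dom C x) = z" using Comp_Ide_right x z by blast+
  then show ?thesis unfolding Rel_rel_comp(2)[OF \<phi> \<psi> x z] using cover_ide[OF hom_obj(1)[OF x]] xy yz by metis
qed

lemma rel_compE:
  assumes \<phi>: "\<phi> \<in> Rel C X Y" and \<psi>: "\<psi> \<in> Rel C Y Z" and xz: "related (rel_comp C \<psi> \<phi>) x z"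
    and x: "x \<in> hom C T X"
  obtains S e y where "cover e S T" "related \<phi> (x \<cdot> e) y" "related \<psi> y (z \<cdot> e)"
  using xz unfolding Rel_rel_comp(2)[OF \<phi> \<psi> x related_hom_right[OF Rel_rel_comp(1)[OF \<phi> \<psi>] xz x]]
  by blast

text \<open>
  The goal relates elements \<open>f\<close> and \<open>g\<close> at the original stage, so the cover on which the witness
  \<open>y\<close> of the composite lives disappears from the conclusion.
\<close>

lemma rel_comp_elim:
  assumes \<phi>: "\<phi> \<in> Rel C X Y" and \<psi>: "\<psi> \<in> Rel C Y Z" and xz: "related (rel_comp C \<psi> \<phi>) x z"
    and \<chi>: "\<chi> \<in> Rel C V W" and f: "f \<in> hom C (Dom C x) V" and g: "g \<in> hom C (Dom C x) W"
    and step: "\<And>S e y. cover e S (Dom C x) \<Longrightarrow> related \<phi> (x \<cdot> e) y \<Longrightarrow> related \<psi> y (z \<cdot> e) \<Longrightarrow>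
      related \<chi> (f \<cdot> e) (g \<cdot> e)"
  shows "related \<chi> f g"
proof -
  note x = related_hom(1)[OF Rel_rel_comp(1)[OF \<phi> \<psi>] xz]
  obtain S e y where "cover e S (Dom C x)" "related \<phi> (x \<cdot> e) y" "related \<psi> y (z \<cdot> e)"
    by (rule rel_compE[OF \<phi> \<psi> xz x])
  then show ?thesis using related_local[OF \<chi> _ f g step] by blast
qed

lemma rel_comp_le:
  assumes \<phi>: "\<phi> \<in> Rel C X Y" and \<psi>: "\<psi> \<in> Rel C Y Z" and \<chi>: "\<chi> \<in> Rel C X Z"
    and step: "\<And>x y z. related \<phi> x y \<Longrightarrow> related \<psi> y z \<Longrightarrow> related \<chi> x z"
    and xz: "related (rel_comp C \<psi> \<phi>) x z"
  shows "related \<chi> x z"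
proof -
  note 1 = related_hom[OF Rel_rel_comp(1)[OF \<phi> \<psi>] xz]
  show ?thesis by (rule rel_comp_elim[OF \<phi> \<psi> xz \<chi> 1]) (rule step)
qed

lemma rel_comp_assoc:
  assumes \<phi>: "\<phi> \<in> Rel C X Y" and \<psi>: "\<psi> \<in> Rel C Y Z" and \<chi>: "\<chi> \<in> Rel C Z W"
  shows "rel_comp C (rel_comp C \<chi> \<psi>) \<phi> = rel_comp C \<chi> (rel_comp C \<psi> \<phi>)"
proof -
  note \<psi>\<phi> = Rel_rel_comp(1)[OF \<phi> \<psi>] and \<chi>\<psi> = Rel_rel_comp(1)[OF \<psi> \<chi>]
  note l = Rel_rel_comp(1)[OF \<phi> \<chi>\<psi>] and r = Rel_rel_comp(1)[OF \<psi>\<phi> \<chi>]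
  have 1: "related (rel_comp C \<chi> (rel_comp C \<psi> \<phi>)) x w"
    if xy: "related \<phi> x y" and yw: "related (rel_comp C \<chi> \<psi>) y w" for x y w
  proof -
    note x = related_hom(1)[OF \<phi> xy] and y = related_hom(2)[OF \<phi> xy]
    have D: "Dom C y = Dom C x" using y by (simp add: hom_def)
    note w = related_hom_right[OF \<chi>\<psi> yw y]
    show ?thesis
    proof (rule rel_comp_elim[OF \<psi> \<chi> yw r], unfold D, rule x, rule w)
      fix S e z assume e: "cover e S (Dom C x)" "related \<psi> (y \<cdot> e) z" "related \<chi> z (w \<cdot> e)"
      show "related (rel_comp C \<chi> (rel_comp C \<psi> \<phi>)) (x \<cdot> e) (w \<cdot> e)"
        by (rule rel_compI[OF \<psi>\<phi> \<chi> rel_compI[OF \<phi> \<psi> related_comp[OF \<phi> xy x cover_hom[OF e(1)]] e(2)] e(3)])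
    qed
  qed
  have 2: "related (rel_comp C (rel_comp C \<chi> \<psi>) \<phi>) x w"
    if xz: "related (rel_comp C \<psi> \<phi>) x z" and zw: "related \<chi> z w" for x z w
  proof -
    note x = related_hom(1)[OF \<psi>\<phi> xz] and z = related_hom(2)[OF \<psi>\<phi> xz]
    note w = related_hom_right[OF \<chi> zw z]
    show ?thesis
    proof (rule rel_comp_elim[OF \<phi> \<psi> xz l x w])
      fix S e y assume e: "cover e S (Dom C x)" "related \<phi> (x \<cdot> e) y" "related \<psi> y (z \<cdot> e)"
      show "related (rel_comp C (rel_comp C \<chi> \<psi>) \<phi>) (x \<cdot> e) (w \<cdot> e)"
        by (rule rel_compI[OF \<phi> \<chi>\<psi> e(2) rel_compI[OF \<psi> \<chi> e(3) related_comp[OF \<chi> zw z cover_hom[OF e(1)]]]])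
    qed
  qed
  show ?thesis
  proof (rule Rel_eqI[OF l r], rule iffI)
    show "related (rel_comp C \<chi> (rel_comp C \<psi> \<phi>)) x w" if "related (rel_comp C (rel_comp C \<chi> \<psi>) \<phi>) x w" for x w
      by (rule rel_comp_le[OF \<phi> \<chi>\<psi> r _ that]) (rule 1)
    show "related (rel_comp C (rel_comp C \<chi> \<psi>) \<phi>) x w" if "related (rel_comp C \<chi> (rel_comp C \<psi> \<phi>)) x w" for x w
      by (rule rel_comp_le[OF \<psi>\<phi> \<chi> l _ that]) (rule 2)
  qed
qed

section \<open>Comprehension of relations and subobjects\<close>

lemma Rel_ide:
  assumes "X \<in> Obj C"
  obtains \<Delta> where "\<Delta> \<in> Rel C X X" "\<forall>x y. related \<Delta> x y \<longleftrightarrow> x = y \<and> x \<in> hom C (Dom C x) X"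
proof -
  note i = Ide_in_hom[OF assms]
  have D: "Dom C (Ide C X) = X" using i by (simp add: hom_def)
  have "jointly_monic C (Ide C X) (Ide C X)"
    by (rule jointly_monicI[OF i i]) (use Comp_Ide_left in metis)
  then have ms: "(Ide C X, Ide C X) \<in> monic_spans C X X" unfolding monic_spans_iff D using i by blast
  obtain \<Delta> where \<Delta>: "\<Delta> \<in> Rel C X X" "(Ide C X, Ide C X) \<in> \<Delta>" by (rule Rel_of_span[OF ms])
  have "related \<Delta> x y \<longleftrightarrow> x = y \<and> x \<in> hom C (Dom C x) X" for x y
    unfolding Rel_rep(2)[OF \<Delta>] span_factors_iff D
    using Comp_Ide_left[of _ "Dom C x" X] by auto
  then show thesis by (intro that[OF \<Delta>(1)]) blast
qed

lemma Rel_inter: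
  assumes \<phi>: "\<phi> \<in> Rel C X Y" and \<psi>: "\<psi> \<in> Rel C X Y"
  obtains \<rho> where "\<rho> \<in> Rel C X Y" "\<forall>x y. related \<rho> x y \<longleftrightarrow> related \<phi> x y \<and> related \<psi> x y"
proof -
  obtain u v where uv: "(u, v) \<in> \<phi>" using \<phi> by (rule Rel_nonempty)
  obtain u' v' where uv': "(u', v') \<in> \<psi>" using \<psi> by (rule Rel_nonempty)
  have u: "jointly_monic C u v" "u \<in> hom C (Dom C u) X" "v \<in> hom C (Dom C u) Y"
    using Rel_rep(1)[OF \<phi> uv] unfolding monic_spans_iff by auto
  have u': "jointly_monic C u' v'" "u' \<in> hom C (Dom C u') X" "v' \<in> hom C (Dom C u') Y"
    using Rel_rep(1)[OF \<psi> uv'] unfolding monic_spans_iff by auto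
  obtain L l l' where L: "l \<in> hom C L (Dom C u)" "l' \<in> hom C L (Dom C u')"
    "u \<cdot> l = u' \<cdot> l'" "v \<cdot> l = v' \<cdot> l'" "jointly_monic C l l'"
    "\<forall>T. \<forall>a \<in> hom C T (Dom C u). \<forall>b \<in> hom C T (Dom C u'). u \<cdot> a = u' \<cdot> b \<longrightarrow> v \<cdot> a = v' \<cdot> b \<longrightarrow>
       (\<exists>h \<in> hom C T L. l \<cdot> h = a \<and> l' \<cdot> h = b)"
    by (rule span_pullback_exists[OF u(2,3) u'(2,3)])
  note ul = Comp_in_hom[OF L(1) u(2)] and vl = Comp_in_hom[OF L(1) u(3)]
  have D: "Dom C (u \<cdot> l) = L" using ul by (simp add: hom_def)
  have mono: "is_mono C l"
  proof (rule is_monoI[OF L(1)])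
    fix T f g assume fg: "f \<in> hom C T L" "g \<in> hom C T L" "l \<cdot> f = l \<cdot> g"
    have "l' \<cdot> f = l' \<cdot> g"
      by (rule jointly_monicD[OF u'(1,2) Comp_in_hom[OF fg(1) L(2)] Comp_in_hom[OF fg(2) L(2)]])
         (use comp_eq_comp[OF L(3,1) u(2) L(2) u'(2)] comp_eq_comp[OF L(4,1) u(3) L(2) u'(3)] fg in metis)+
    then show "f = g" using jointly_monicD[OF L(5,1) fg] by blast
  qed
  have ms: "(u \<cdot> l, v \<cdot> l) \<in> monic_spans C X Y"
    unfolding monic_spans_iff D using ul vl mono_jointly_monic_comp[OF mono L(1) u] by blast
  obtain \<rho> where \<rho>: "\<rho> \<in> Rel C X Y" "(u \<cdot> l, v \<cdot> l) \<in> \<rho>" by (rule Rel_of_span[OF ms])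
  have "related \<rho> x y \<longleftrightarrow> related \<phi> x y \<and> related \<psi> x y" for x y
    unfolding Rel_rep(2)[OF \<rho>] Rel_rep(2)[OF \<phi> uv] Rel_rep(2)[OF \<psi> uv'] span_factors_iff D
  proof
    assume "\<exists>h \<in> hom C (Dom C x) L. (u \<cdot> l) \<cdot> h = x \<and> (v \<cdot> l) \<cdot> h = y"
    then obtain h where h: "h \<in> hom C (Dom C x) L" "(u \<cdot> l) \<cdot> h = x" "(v \<cdot> l) \<cdot> h = y" by blast
    have "u \<cdot> (l \<cdot> h) = x" "v \<cdot> (l \<cdot> h) = y" "u' \<cdot> (l' \<cdot> h) = x" "v' \<cdot> (l' \<cdot> h) = y"
      using h(2,3) Comp_assoc[OF h(1) L(1) u(2)] Comp_assoc[OF h(1) L(1) u(3)]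
        comp_eq_comp[OF L(3,1) u(2) L(2) u'(2) h(1)] comp_eq_comp[OF L(4,1) u(3) L(2) u'(3) h(1)] by simp_all
    with Comp_in_hom[OF h(1) L(1)] Comp_in_hom[OF h(1) L(2)]
    show "(\<exists>h \<in> hom C (Dom C x) (Dom C u). u \<cdot> h = x \<and> v \<cdot> h = y) \<and>
        (\<exists>k \<in> hom C (Dom C x) (Dom C u'). u' \<cdot> k = x \<and> v' \<cdot> k = y)"
      by blast
  next
    assume "(\<exists>h \<in> hom C (Dom C x) (Dom C u). u \<cdot> h = x \<and> v \<cdot> h = y) \<and>
        (\<exists>k \<in> hom C (Dom C x) (Dom C u'). u' \<cdot> k = x \<and> v' \<cdot> k = y)"
    then obtain h k where h: "h \<in> hom C (Dom C x) (Dom C u)" "u \<cdot> h = x" "v \<cdot> h = y"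
      and k: "k \<in> hom C (Dom C x) (Dom C u')" "u' \<cdot> k = x" "v' \<cdot> k = y" by blast
    have "u \<cdot> h = u' \<cdot> k" "v \<cdot> h = v' \<cdot> k" using h k by simp_all
    then obtain t where t: "t \<in> hom C (Dom C x) L" "l \<cdot> t = h" using L(6) h(1) k(1) by blast
    then show "\<exists>h \<in> hom C (Dom C x) L. (u \<cdot> l) \<cdot> h = x \<and> (v \<cdot> l) \<cdot> h = y"
      using Comp_assoc[OF t(1) L(1) u(2)] Comp_assoc[OF t(1) L(1) u(3)] h by auto
  qed
  then show thesis by (intro that[OF \<rho>(1)]) blast
qed

text \<open>
  Substitution into a relation: the pullback of its span along \<open>f \<times> g\<close>, formed on a product of the
  two objects.
\<close>

lemma Rel_vimage:
  assumes \<phi>: "\<phi> \<in> Rel C X' Y'" and f: "f \<in> hom C X X'" and g: "g \<in> hom C Y Y'"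
  obtains \<rho> where "\<rho> \<in> Rel C X Y"
    "\<forall>T. \<forall>x \<in> hom C T X. \<forall>y \<in> hom C T Y. related \<rho> x y \<longleftrightarrow> related \<phi> (f \<cdot> x) (g \<cdot> y)"
proof -
  obtain u v where uv: "(u, v) \<in> \<phi>" using \<phi> by (rule Rel_nonempty)
  have u: "jointly_monic C u v" "u \<in> hom C (Dom C u) X'" "v \<in> hom C (Dom C u) Y'"
    using Rel_rep(1)[OF \<phi> uv] unfolding monic_spans_iff by auto
  obtain P p q where P: "p \<in> hom C P X" "q \<in> hom C P Y" "jointly_monic C p q"
    "\<forall>T. \<forall>a \<in> hom C T X. \<forall>b \<in> hom C T Y. \<exists>h \<in> hom C T P. p \<cdot> h = a \<and> q \<cdot> h = b"
    by (rule product_exists[OF hom_obj(1)[OF f] hom_obj(1)[OF g]])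
  note fp = Comp_in_hom[OF P(1) f] and gq = Comp_in_hom[OF P(2) g]
  obtain L l l' where L: "l \<in> hom C L P" "l' \<in> hom C L (Dom C u)"
    "(f \<cdot> p) \<cdot> l = u \<cdot> l'" "(g \<cdot> q) \<cdot> l = v \<cdot> l'" "jointly_monic C l l'"
    "\<forall>T. \<forall>a \<in> hom C T P. \<forall>b \<in> hom C T (Dom C u). (f \<cdot> p) \<cdot> a = u \<cdot> b \<longrightarrow> (g \<cdot> q) \<cdot> a = v \<cdot> b \<longrightarrow>
       (\<exists>h \<in> hom C T L. l \<cdot> h = a \<and> l' \<cdot> h = b)"
    by (rule span_pullback_exists[OF fp gq u(2,3)])
  note pl = Comp_in_hom[OF L(1) P(1)] and ql = Comp_in_hom[OF L(1) P(2)]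
  have D: "Dom C (p \<cdot> l) = L" using pl by (simp add: hom_def)
  have mono: "is_mono C l"
  proof (rule is_monoI[OF L(1)])
    fix T h k assume hk: "h \<in> hom C T L" "k \<in> hom C T L" "l \<cdot> h = l \<cdot> k"
    have "l' \<cdot> h = l' \<cdot> k"
      by (rule jointly_monicD[OF u(1,2) Comp_in_hom[OF hk(1) L(2)] Comp_in_hom[OF hk(2) L(2)]])
         (use comp_eq_comp[OF L(3,1) fp L(2) u(2)] comp_eq_comp[OF L(4,1) gq L(2) u(3)] hk in metis)+
    then show "h = k" using jointly_monicD[OF L(5,1) hk] by blast
  qed
  have ms: "(p \<cdot> l, q \<cdot> l) \<in> monic_spans C X Y"
    unfolding monic_spans_iff D using pl ql mono_jointly_monic_comp[OF mono L(1) P(3,1,2)] by blast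
  obtain \<rho> where \<rho>: "\<rho> \<in> Rel C X Y" "(p \<cdot> l, q \<cdot> l) \<in> \<rho>" by (rule Rel_of_span[OF ms])
  have "related \<rho> x y \<longleftrightarrow> related \<phi> (f \<cdot> x) (g \<cdot> y)" if x: "x \<in> hom C T X" and y: "y \<in> hom C T Y" for T x y
  proof -
    have T: "Dom C x = T" "Dom C (f \<cdot> x) = T" using x Comp_in_hom[OF x f] by (simp_all add: hom_def)
    show ?thesis unfolding Rel_rep(2)[OF \<rho>] Rel_rep(2)[OF \<phi> uv] span_factors_iff D T
    proof
      assume "\<exists>h \<in> hom C T L. (p \<cdot> l) \<cdot> h = x \<and> (q \<cdot> l) \<cdot> h = y"
      then obtain h where h: "h \<in> hom C T L" "(p \<cdot> l) \<cdot> h = x" "(q \<cdot> l) \<cdot> h = y" by blast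
      have "u \<cdot> (l' \<cdot> h) = f \<cdot> x" "v \<cdot> (l' \<cdot> h) = g \<cdot> y"
        using Comp_assoc[OF h(1) pl f] Comp_assoc[OF L(1) P(1) f] comp_eq[OF L(3)[symmetric] L(2) u(2) h(1)]
          Comp_assoc[OF h(1) ql g] Comp_assoc[OF L(1) P(2) g] comp_eq[OF L(4)[symmetric] L(2) u(3) h(1)] h(2,3)
        by simp_all
      then show "\<exists>h \<in> hom C T (Dom C u). u \<cdot> h = f \<cdot> x \<and> v \<cdot> h = g \<cdot> y" using Comp_in_hom[OF h(1) L(2)] by blast
    next
      assume "\<exists>h \<in> hom C T (Dom C u). u \<cdot> h = f \<cdot> x \<and> v \<cdot> h = g \<cdot> y"
      then obtain h where h: "h \<in> hom C T (Dom C u)" "u \<cdot> h = f \<cdot> x" "v \<cdot> h = g \<cdot> y" by blast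
      obtain w where w: "w \<in> hom C T P" "p \<cdot> w = x" "q \<cdot> w = y" using P(4) x y by blast
      have "(f \<cdot> p) \<cdot> w = u \<cdot> h" "(g \<cdot> q) \<cdot> w = v \<cdot> h"
        using Comp_assoc[OF w(1) P(1) f] Comp_assoc[OF w(1) P(2) g] w h by simp_all
      then obtain t where t: "t \<in> hom C T L" "l \<cdot> t = w" using L(6) h(1) w(1) by blast
      then show "\<exists>h \<in> hom C T L. (p \<cdot> l) \<cdot> h = x \<and> (q \<cdot> l) \<cdot> h = y"
        using Comp_assoc[OF t(1) L(1) P(1)] Comp_assoc[OF t(1) L(1) P(2)] w by auto
    qed
  qed
  then show thesis by (intro that[OF \<rho>(1)]) blast
qed

text \<open>
  The subobject \<open>{x | \<phi> x x}\<close> is the equalizer of the two legs of \<open>\<phi>\<close>. A subset is thereby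
  handled as a relation, to which descent along covers applies.
\<close>

lemma subobject_of_reflexive_elements:
  assumes \<phi>: "\<phi> \<in> Rel C X X"
  obtains D j where "j \<in> hom C D X" "is_mono C j"
    "\<forall>T. \<forall>x \<in> hom C T X. related \<phi> x x \<longleftrightarrow> (\<exists>h \<in> hom C T D. j \<cdot> h = x)"
proof -
  obtain u v where uv: "(u, v) \<in> \<phi>" using \<phi> by (rule Rel_nonempty)
  have u: "jointly_monic C u v" "u \<in> hom C (Dom C u) X" "v \<in> hom C (Dom C u) X"
    using Rel_rep(1)[OF \<phi> uv] unfolding monic_spans_iff by auto
  note i = Ide_in_hom[OF hom_obj(2)[OF u(2)]]
  obtain D l j where L: "l \<in> hom C D (Dom C u)" "j \<in> hom C D X"
    "u \<cdot> l = Ide C X \<cdot> j" "v \<cdot> l = Ide C X \<cdot> j" "jointly_monic C l j"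
    "\<forall>T. \<forall>a \<in> hom C T (Dom C u). \<forall>b \<in> hom C T X. u \<cdot> a = Ide C X \<cdot> b \<longrightarrow> v \<cdot> a = Ide C X \<cdot> b \<longrightarrow>
       (\<exists>h \<in> hom C T D. l \<cdot> h = a \<and> j \<cdot> h = b)"
    by (rule span_pullback_exists[OF u(2,3) i i])
  have j: "u \<cdot> l = j" "v \<cdot> l = j" using L(3,4) Comp_Ide_left[OF L(2)] by simp_all
  have "is_mono C j"
  proof (rule is_monoI[OF L(2)])
    fix T h k assume hk: "h \<in> hom C T D" "k \<in> hom C T D" "j \<cdot> h = j \<cdot> k"
    have "l \<cdot> h = l \<cdot> k"
      by (rule jointly_monicD[OF u(1,2) Comp_in_hom[OF hk(1) L(1)] Comp_in_hom[OF hk(2) L(1)]])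
         (use comp_eq[OF j(1) L(1) u(2)] comp_eq[OF j(2) L(1) u(3)] hk in simp_all)
    then show "h = k" using jointly_monicD[OF L(5,1) hk(1,2)] hk(3) by blast
  qed
  moreover have "related \<phi> x x \<longleftrightarrow> (\<exists>h \<in> hom C T D. j \<cdot> h = x)" if x: "x \<in> hom C T X" for T x
  proof -
    have T: "Dom C x = T" using x by (simp add: hom_def)
    show ?thesis unfolding Rel_rep(2)[OF \<phi> uv] span_factors_iff T
    proof
      assume "\<exists>h \<in> hom C T (Dom C u). u \<cdot> h = x \<and> v \<cdot> h = x"
      then show "\<exists>h \<in> hom C T D. j \<cdot> h = x" using L(6) x Comp_Ide_left[OF x] by metis
    next
      assume "\<exists>h \<in> hom C T D. j \<cdot> h = x"
      then obtain h where h: "h \<in> hom C T D" "j \<cdot> h = x" by blast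
      then show "\<exists>h \<in> hom C T (Dom C u). u \<cdot> h = x \<and> v \<cdot> h = x"
        using comp_eq[OF j(1) L(1) u(2) h(1)] comp_eq[OF j(2) L(1) u(3) h(1)] Comp_in_hom[OF h(1) L(1)] by auto
    qed
  qed
  ultimately show thesis by (intro that[OF L(2)]) blast+
qed

section \<open>Equivalence relations and functional relations\<close>

text \<open>
  Each of the three conditions in the definition asks that one universal pair of elements be
  related: the identities, the swapped legs, and the outer legs of the pullback of composable
  pairs. Every other instance is a restriction of the universal one.
\<close>

lemma equivalence_relation_iff:
  "equivalence_relation C X R \<longleftrightarrow> R \<in> Rel C X X \<and> (\<forall>T. \<forall>x \<in> hom C T X. related R x x) \<and>
     (\<forall>x y. related R x y \<longrightarrow> related R y x) \<and>
     (\<forall>x y z. related R x y \<longrightarrow> related R y z \<longrightarrow> related R x z)"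
  (is "_ \<longleftrightarrow> _ \<and> ?refl \<and> ?sym \<and> ?trans")
proof (cases "R \<in> Rel C X X")
  case R: True
  have r: "span_factors C (Ide C X, Ide C X) (u, v) \<longleftrightarrow> ?refl" if uv: "(u, v) \<in> R" for u v
  proof
    have u: "u \<in> hom C (Dom C u) X" using Rel_rep(1)[OF R uv] unfolding monic_spans_iff by auto
    have i: "Ide C X \<in> hom C X X" by (rule Ide_in_hom[OF hom_obj(2)[OF u]])
    show "?refl \<Longrightarrow> span_factors C (Ide C X, Ide C X) (u, v)" unfolding Rel_rep(2)[OF R uv] using i by blast
    assume "span_factors C (Ide C X, Ide C X) (u, v)"
    then have "related R (Ide C X) (Ide C X)" unfolding Rel_rep(2)[OF R uv] .
    then show ?refl using related_comp[OF R _ i] Comp_Ide_left by metis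
  qed
  have s: "span_factors C (v, u) (u, v) \<longleftrightarrow> ?sym" if uv: "(u, v) \<in> R" for u v
  proof
    have u: "u \<in> hom C (Dom C u) X" "v \<in> hom C (Dom C u) X"
      using Rel_rep(1)[OF R uv] unfolding monic_spans_iff by auto
    have ruv: "related R u v" unfolding Rel_rep(2)[OF R uv] by (rule span_factors_refl[OF Rel_rep(1)[OF R uv]])
    then show "?sym \<Longrightarrow> span_factors C (v, u) (u, v)" unfolding Rel_rep(2)[OF R uv, symmetric] by blast
    assume "span_factors C (v, u) (u, v)"
    then have vu: "related R v u" unfolding Rel_rep(2)[OF R uv] .
    show ?sym
    proof (intro allI impI)
      fix x y assume "related R x y"
      then obtain h where h: "h \<in> hom C (Dom C x) (Dom C u)" "u \<cdot> h = x" "v \<cdot> h = y"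
        unfolding Rel_rep(2)[OF R uv] span_factors_iff by blast
      then show "related R y x" using related_comp[OF R vu u(2) h(1)] by simp
    qed
  qed
  have t: "(\<forall>p q. is_pullback C v u p q \<longrightarrow> span_factors C (u \<cdot> p, v \<cdot> q) (u, v)) \<longleftrightarrow> ?trans"
    (is "?l \<longleftrightarrow> _") if uv: "(u, v) \<in> R" for u v
  proof
    have u: "u \<in> hom C (Dom C u) X" "v \<in> hom C (Dom C u) X"
      using Rel_rep(1)[OF R uv] unfolding monic_spans_iff by auto
    have ruv: "related R u v" unfolding Rel_rep(2)[OF R uv] by (rule span_factors_refl[OF Rel_rep(1)[OF R uv]])
    show ?l if t: ?trans
    proof (intro allI impI)
      fix p q assume P: "is_pullback C v u p q"
      note pq = pullback_square[OF P u(2,1)]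
      have "related R (u \<cdot> p) (v \<cdot> p)" "related R (u \<cdot> q) (v \<cdot> q)"
        using related_comp[OF R ruv u(1)] pq(1,2) by blast+
      then show "span_factors C (u \<cdot> p, v \<cdot> q) (u, v)"
        unfolding Rel_rep(2)[OF R uv, symmetric] using t pq(3) by metis
    qed
    assume l: ?l
    obtain P p q where P: "p \<in> hom C P (Dom C u)" "q \<in> hom C P (Dom C u)" "v \<cdot> p = u \<cdot> q" "is_pullback C v u p q"
      by (rule pullback_exists[OF u(2,1)])
    have pq: "related R (u \<cdot> p) (v \<cdot> q)" using l P(4) unfolding Rel_rep(2)[OF R uv] by blast
    show ?trans
    proof (intro allI impI)
      fix x y z assume "related R x y" and yz: "related R y z"
      then obtain h where h: "h \<in> hom C (Dom C x) (Dom C u)" "u \<cdot> h = x" "v \<cdot> h = y"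
        unfolding Rel_rep(2)[OF R uv] span_factors_iff by blast
      have "Dom C y = Dom C x" using Comp_in_hom[OF h(1) u(2)] h(3) by (simp add: hom_def)
      with yz obtain k where k: "k \<in> hom C (Dom C x) (Dom C u)" "u \<cdot> k = y" "v \<cdot> k = z"
        unfolding Rel_rep(2)[OF R uv] span_factors_iff by metis
      have "v \<cdot> h = u \<cdot> k" using h k by simp
      then obtain t where t: "t \<in> hom C (Dom C x) P" "p \<cdot> t = h" "q \<cdot> t = k"
        using pullback_lift[OF P(4) u(2,1) P(1) h(1) k(1)] by blast
      show "related R x z"
        using related_comp[OF R pq Comp_in_hom[OF P(1) u(1)] t(1)]
          Comp_assoc[OF t(1) P(1) u(1)] Comp_assoc[OF t(1) P(2) u(2)] t h k by simp
    qed
  qed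
  obtain u v where uv: "(u, v) \<in> R" using R by (rule Rel_nonempty)
  have "equivalence_relation C X R \<longleftrightarrow> R \<in> Rel C X X \<and> (\<forall>(u, v) \<in> R. ?refl \<and> ?sym \<and> ?trans)"
    unfolding equivalence_relation_def
    by (intro conj_cong ball_cong refl) (simp only: split_paired_all prod.case r s t)
  then show ?thesis using uv by (simp only: split_def) blast
qed (simp add: equivalence_relation_def)

lemma equivalenceD:
  assumes "equivalence_relation C X R"
  shows "R \<in> Rel C X X" "x \<in> hom C T X \<Longrightarrow> related R x x" "related R x y \<Longrightarrow> related R y x"
    "related R x y \<Longrightarrow> related R y z \<Longrightarrow> related R x z"
  using assms unfolding equivalence_relation_iff by blast+

lemma equivalence_obj:
  assumes "equivalence_relation C X R"
  shows "X \<in> Obj C"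
proof -
  note R = equivalenceD(1)[OF assms]
  obtain u v where "(u, v) \<in> R" using R by (rule Rel_nonempty)
  from Rel_rep(1)[OF R this] show ?thesis unfolding monic_spans_iff using hom_obj by blast
qed

text \<open>
  The arrows \<open>(X, R) \<rightarrow> (Y, S)\<close> of the exact completion on elements: relations that are
  extensional, total up to covers, and single-valued up to \<open>S\<close>.
\<close>

definition functional :: "'o \<Rightarrow> ('a \<times> 'a) set \<Rightarrow> 'o \<Rightarrow> ('a \<times> 'a) set \<Rightarrow> ('a \<times> 'a) set \<Rightarrow> bool" where
  "functional X R Y S \<phi> \<longleftrightarrow> equivalence_relation C X R \<and> equivalence_relation C Y S \<and> \<phi> \<in> Rel C X Y \<and>
     (\<forall>x x' y y'. related \<phi> x y \<longrightarrow> related R x x' \<longrightarrow> related S y y' \<longrightarrow> related \<phi> x' y') \<and>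
     (\<forall>T. \<forall>x \<in> hom C T X. \<exists>T' e y. cover e T' T \<and> related \<phi> (x \<cdot> e) y) \<and>
     (\<forall>x y y'. related \<phi> x y \<longrightarrow> related \<phi> x y' \<longrightarrow> related S y y')"

lemma functionalD:
  assumes "functional X R Y S \<phi>"
  shows "\<phi> \<in> Rel C X Y" "related \<phi> x y \<Longrightarrow> related R x x' \<Longrightarrow> related S y y' \<Longrightarrow> related \<phi> x' y'"
    "related \<phi> x y \<Longrightarrow> related \<phi> x y' \<Longrightarrow> related S y y'"
    "equivalence_relation C X R" "equivalence_relation C Y S"
  using assms unfolding functional_def by blast+

lemma functional_total:
  assumes "functional X R Y S \<phi>" "x \<in> hom C T X"
  obtains T' e y where "cover e T' T" "related \<phi> (x \<cdot> e) y"
  using assms unfolding functional_def by blast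

lemma ex_reg_rel_iff:
  assumes R: "equivalence_relation C X R" and S: "equivalence_relation C Y S"
  shows "ex_reg_rel C (X, R) (Y, S) \<phi> \<longleftrightarrow> functional X R Y S \<phi>"
proof (cases "\<phi> \<in> Rel C X Y")
  case \<phi>: True
  note R' = equivalenceD(1)[OF R] and S' = equivalenceD(1)[OF S]
  note conv = Rel_converse(1)[OF \<phi>]
  note \<phi>R = Rel_rel_comp(1)[OF R' \<phi>]
  note S\<phi>R = Rel_rel_comp(1)[OF \<phi>R S'] and cc = Rel_rel_comp(1)[OF \<phi> conv] and cc' = Rel_rel_comp(1)[OF conv \<phi>]
  have le: "rel_le C R (rel_comp C (\<phi>\<inverse>) \<phi>) \<longleftrightarrow> (\<forall>x y. related R x y \<longrightarrow> related (rel_comp C (\<phi>\<inverse>) \<phi>) x y)"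
    by (rule rel_le_iff[OF R' cc])
  have le': "rel_le C (rel_comp C \<phi> (\<phi>\<inverse>)) S \<longleftrightarrow> (\<forall>x y. related (rel_comp C \<phi> (\<phi>\<inverse>)) x y \<longrightarrow> related S x y)"
    by (rule rel_le_iff[OF cc' S'])
  show ?thesis
  proof
    assume "ex_reg_rel C (X, R) (Y, S) \<phi>"
    then have eq: "rel_comp C S (rel_comp C \<phi> R) = \<phi>"
      and total: "\<And>x y. related R x y \<Longrightarrow> related (rel_comp C (\<phi>\<inverse>) \<phi>) x y"
      and fn: "\<And>x y. related (rel_comp C \<phi> (\<phi>\<inverse>)) x y \<Longrightarrow> related S x y"
      unfolding ex_reg_rel_def le[symmetric] le'[symmetric] using le le' by auto
    show "functional X R Y S \<phi>" unfolding functional_def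
    proof (intro conjI allI impI ballI)
      show "equivalence_relation C X R" "equivalence_relation C Y S" "\<phi> \<in> Rel C X Y" by fact+
    next
      fix x x' y y' assume xy: "related \<phi> x y" and xx: "related R x x'" and yy: "related S y y'"
      have "related (rel_comp C S (rel_comp C \<phi> R)) x' y'"
        by (rule rel_compI[OF \<phi>R S' rel_compI[OF R' \<phi> equivalenceD(3)[OF R xx] xy] yy])
      then show "related \<phi> x' y'" unfolding eq .
    next
      fix T x assume x: "x \<in> hom C T X"
      have "related (rel_comp C (\<phi>\<inverse>) \<phi>) x x" by (rule total[OF equivalenceD(2)[OF R x]])
      then show "\<exists>T' e y. cover e T' T \<and> related \<phi> (x \<cdot> e) y"
        using rel_compE[OF \<phi> conv _ x] by metis
    next
      fix x y y' assume "related \<phi> x y" "related \<phi> x y'"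
      then show "related S y y'" using fn rel_compI[OF conv \<phi>] Rel_converse(2)[OF \<phi>] by blast
    qed
  next
    assume f: "functional X R Y S \<phi>"
    have "related \<phi> x y" if "related (rel_comp C S (rel_comp C \<phi> R)) x y" for x y
    proof (rule rel_comp_le[OF \<phi>R S' \<phi> _ that])
      fix x y y' assume xy: "related (rel_comp C \<phi> R) x y" and yy: "related S y y'"
      have "related \<phi> x y"
      proof (rule rel_comp_le[OF R' \<phi> \<phi> _ xy])
        fix x x' y assume xx: "related R x x'" and xy: "related \<phi> x' y"
        show "related \<phi> x y"
          by (rule functionalD(2)[OF f xy equivalenceD(3)[OF R xx] equivalenceD(2)[OF S related_hom(2)[OF \<phi> xy]]])
      qed
      then show "related \<phi> x y'"
        using functionalD(2)[OF f _ equivalenceD(2)[OF R] yy] related_hom(1)[OF \<phi>] by blast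
    qed
    moreover have "related (rel_comp C S (rel_comp C \<phi> R)) x y" if xy: "related \<phi> x y" for x y
      by (rule rel_compI[OF \<phi>R S' rel_compI[OF R' \<phi> _ xy]])
         (rule equivalenceD(2)[OF R related_hom(1)[OF \<phi> xy]] equivalenceD(2)[OF S related_hom(2)[OF \<phi> xy]])+
    ultimately have "rel_comp C S (rel_comp C \<phi> R) = \<phi>" by (intro Rel_eqI[OF S\<phi>R \<phi>]) blast
    moreover have "related (rel_comp C (\<phi>\<inverse>) \<phi>) x x'" if xx: "related R x x'" for x x'
    proof -
      note x = related_hom[OF R' xx]
      obtain T e y where e: "cover e T (Dom C x)" "related \<phi> (x \<cdot> e) y" by (rule functional_total[OF f x(1)])
      have "related \<phi> (x' \<cdot> e) y"
        by (rule functionalD(2)[OF f e(2) related_comp[OF R' xx x(1) cover_hom[OF e(1)]]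
              equivalenceD(2)[OF S related_hom(2)[OF \<phi> e(2)]]])
      then have "related (rel_comp C (\<phi>\<inverse>) \<phi>) (x \<cdot> e) (x' \<cdot> e)"
        using rel_compI[OF \<phi> conv e(2)] Rel_converse(2)[OF \<phi>] by blast
      then show ?thesis by (rule related_local[OF cc e(1) x])
    qed
    moreover have "related S y y'" if yy: "related (rel_comp C \<phi> (\<phi>\<inverse>)) y y'" for y y'
      by (rule rel_comp_le[OF conv \<phi> S' _ yy]) (use Rel_converse(2)[OF \<phi>] functionalD(3)[OF f] in blast)
    ultimately show "ex_reg_rel C (X, R) (Y, S) \<phi>" unfolding ex_reg_rel_def using \<phi> le le' by auto
  qed
qed (auto simp: ex_reg_rel_def functional_def)

lemma functional_ide:
  assumes R: "equivalence_relation C X R"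
  shows "functional X R X R R"
  unfolding functional_def
proof (intro conjI allI impI ballI)
  show "equivalence_relation C X R" "equivalence_relation C X R" "R \<in> Rel C X X"
    using R equivalenceD(1)[OF R] by blast+
next
  fix T x assume x: "x \<in> hom C T X"
  then have "related R (x \<cdot> Ide C T) x" using Comp_Ide_right[OF x] equivalenceD(2)[OF R x] by simp
  then show "\<exists>T' e y. cover e T' T \<and> related R (x \<cdot> e) y" using cover_ide[OF hom_obj(1)[OF x]] by blast
qed (use equivalenceD(3,4)[OF R] in blast)+

text \<open>
  The value of \<open>\<phi>\<close> that witnesses the composite is \<open>S\<close>-equivalent to \<open>y\<close> and may be replaced by it,
  so composites can be evaluated without passing to a cover.
\<close>

lemma functional_comp_value:
  assumes \<phi>: "functional X R Y S \<phi>" and \<psi>: "functional Y S Z W \<psi>" and xy: "related \<phi> x y"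
  shows "related (rel_comp C \<psi> \<phi>) x z \<longleftrightarrow> related \<psi> y z"
proof
  note \<phi>' = functionalD(1)[OF \<phi>] and \<psi>' = functionalD(1)[OF \<psi>]
  note x = related_hom(1)[OF \<phi>' xy] and y = related_hom(2)[OF \<phi>' xy]
  show "related \<psi> y z \<Longrightarrow> related (rel_comp C \<psi> \<phi>) x z" by (rule rel_compI[OF \<phi>' \<psi>' xy])
  assume xz: "related (rel_comp C \<psi> \<phi>) x z"
  note z = related_hom(2)[OF Rel_rel_comp(1)[OF \<phi>' \<psi>'] xz]
  show "related \<psi> y z"
  proof (rule rel_comp_elim[OF \<phi>' \<psi>' xz \<psi>' y z])
    fix T e y' assume e: "cover e T (Dom C x)" "related \<phi> (x \<cdot> e) y'" "related \<psi> y' (z \<cdot> e)"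
    note e' = cover_hom[OF e(1)]
    have "related S y' (y \<cdot> e)" by (rule functionalD(3)[OF \<phi> e(2) related_comp[OF \<phi>' xy x e']])
    then show "related \<psi> (y \<cdot> e) (z \<cdot> e)"
      by (rule functionalD(2)[OF \<psi> e(3) _ equivalenceD(2)[OF functionalD(5)[OF \<psi>] Comp_in_hom[OF e' z]]])
  qed
qed

lemma functional_comp:
  assumes \<phi>: "functional X R Y S \<phi>" and \<psi>: "functional Y S Z W \<psi>"
  shows "functional X R Z W (rel_comp C \<psi> \<phi>)"
  unfolding functional_def
proof (intro conjI allI impI ballI)
  note \<phi>' = functionalD(1)[OF \<phi>] and \<psi>' = functionalD(1)[OF \<psi>]
  note R = functionalD(4)[OF \<phi>] and S = functionalD(5)[OF \<phi>] and W = functionalD(5)[OF \<psi>]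
  show R': "equivalence_relation C X R" and W': "equivalence_relation C Z W" by (rule R W)+
  show c: "rel_comp C \<psi> \<phi> \<in> Rel C X Z" by (rule Rel_rel_comp(1)[OF \<phi>' \<psi>'])
  show "related (rel_comp C \<psi> \<phi>) x' z'"
    if xz: "related (rel_comp C \<psi> \<phi>) x z" and xx: "related R x x'" and zz: "related W z z'" for x x' z z'
  proof -
    note x = related_hom[OF equivalenceD(1)[OF R] xx]
    note z = related_hom(2)[OF c xz]
    note z' = related_hom_right[OF equivalenceD(1)[OF W] zz z]
    show ?thesis
    proof (rule rel_comp_elim[OF \<phi>' \<psi>' xz c x(2) z'])
      fix T e y assume e: "cover e T (Dom C x)" "related \<phi> (x \<cdot> e) y" "related \<psi> y (z \<cdot> e)"
      note e' = cover_hom[OF e(1)] and y = related_hom(2)[OF \<phi>' e(2)]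
      have "related \<phi> (x' \<cdot> e) y"
        by (rule functionalD(2)[OF \<phi> e(2) related_comp[OF equivalenceD(1)[OF R] xx x(1) e'] equivalenceD(2)[OF S y]])
      moreover have "related \<psi> y (z' \<cdot> e)"
        by (rule functionalD(2)[OF \<psi> e(3) equivalenceD(2)[OF S y] related_comp[OF equivalenceD(1)[OF W] zz z e']])
      ultimately show "related (rel_comp C \<psi> \<phi>) (x' \<cdot> e) (z' \<cdot> e)" by (rule rel_compI[OF \<phi>' \<psi>'])
    qed
  qed
  show "\<exists>T' e y. cover e T' T \<and> related (rel_comp C \<psi> \<phi>) (x \<cdot> e) y" if x: "x \<in> hom C T X" for T x
  proof -
    obtain T1 e y where e: "cover e T1 T" "related \<phi> (x \<cdot> e) y" by (rule functional_total[OF \<phi> x])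
    note xe = Comp_in_hom[OF cover_hom[OF e(1)] x]
    note y = related_hom_right[OF \<phi>' e(2) xe]
    obtain T2 d z where d: "cover d T2 T1" "related \<psi> (y \<cdot> d) z" by (rule functional_total[OF \<psi> y])
    have "related (rel_comp C \<psi> \<phi>) ((x \<cdot> e) \<cdot> d) z"
      by (rule rel_compI[OF \<phi>' \<psi>' related_comp[OF \<phi>' e(2) xe cover_hom[OF d(1)]] d(2)])
    then show ?thesis
      unfolding Comp_assoc[OF cover_hom[OF d(1)] cover_hom[OF e(1)] x] using cover_comp[OF d(1) e(1)] by blast
  qed
  show "related W z z'"
    if xz: "related (rel_comp C \<psi> \<phi>) x z" and xz': "related (rel_comp C \<psi> \<phi>) x z'" for x z z'
  proof -
    note x = related_hom(1)[OF c xz] and z = related_hom(2)[OF c xz] and z' = related_hom(2)[OF c xz']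
    show ?thesis
    proof (rule rel_comp_elim[OF \<phi>' \<psi>' xz equivalenceD(1)[OF W] z z'])
      fix T e y assume e: "cover e T (Dom C x)" "related \<phi> (x \<cdot> e) y" "related \<psi> y (z \<cdot> e)"
      have "related \<psi> y (z' \<cdot> e)"
        using functional_comp_value[OF \<phi> \<psi> e(2)] related_comp[OF c xz' x cover_hom[OF e(1)]] by blast
      with e(3) show "related W (z \<cdot> e) (z' \<cdot> e)" by (rule functionalD(3)[OF \<psi>])
    qed
  qed
qed

lemma functional_comp_assoc:
  assumes "functional X R Y S \<phi>" "functional Y S Z W \<psi>" "functional Z W U V \<chi>"
  shows "rel_comp C (rel_comp C \<chi> \<psi>) \<phi> = rel_comp C \<chi> (rel_comp C \<psi> \<phi>)"
  by (rule rel_comp_assoc[OF assms[THEN functionalD(1)]])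

lemma functional_total2:
  assumes \<phi>: "functional X R Y S \<phi>" and \<psi>: "functional X R Z W \<psi>" and x: "x \<in> hom C T X"
  obtains T' e y z where "cover e T' T" "related \<phi> (x \<cdot> e) y" "related \<psi> (x \<cdot> e) z"
proof -
  obtain T1 e y where e: "cover e T1 T" "related \<phi> (x \<cdot> e) y" by (rule functional_total[OF \<phi> x])
  note xe = Comp_in_hom[OF cover_hom[OF e(1)] x]
  obtain T2 d z where d: "cover d T2 T1" "related \<psi> ((x \<cdot> e) \<cdot> d) z" by (rule functional_total[OF \<psi> xe])
  note d' = cover_hom[OF d(1)]
  note assoc = Comp_assoc[OF d' cover_hom[OF e(1)] x]
  show thesis
    by (rule that[OF cover_comp[OF d(1) e(1)]])
       (use related_comp[OF functionalD(1)[OF \<phi>] e(2) xe d'] d(2) assoc in simp_all)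
qed

text \<open>
  One common local value at each element is enough, because every other value of either relation
  is \<open>S\<close>-equivalent to it and both relations are closed under \<open>S\<close>.
\<close>

lemma functional_eqI:
  assumes \<phi>: "functional X R Y S \<phi>" and \<psi>: "functional X R Y S \<psi>"
    and common: "\<And>T x. x \<in> hom C T X \<Longrightarrow> \<exists>T' e y. cover e T' T \<and> related \<phi> (x \<cdot> e) y \<and> related \<psi> (x \<cdot> e) y"
  shows "\<phi> = \<psi>"
proof -
  have "related \<psi> x y"
    if \<phi>: "functional X R Y S \<phi>" and \<psi>: "functional X R Y S \<psi>"
      and common: "\<And>T x. x \<in> hom C T X \<Longrightarrow> \<exists>T' e y. cover e T' T \<and> related \<phi> (x \<cdot> e) y \<and> related \<psi> (x \<cdot> e) y"
      and xy: "related \<phi> x y" for \<phi> \<psi> x y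
  proof -
    note \<phi>' = functionalD(1)[OF \<phi>] and \<psi>' = functionalD(1)[OF \<psi>]
    note x = related_hom(1)[OF \<phi>' xy] and y = related_hom(2)[OF \<phi>' xy]
    obtain T' e y' where e: "cover e T' (Dom C x)" "related \<phi> (x \<cdot> e) y'" "related \<psi> (x \<cdot> e) y'"
      using common[OF x] by blast
    note e' = cover_hom[OF e(1)]
    have "related S y' (y \<cdot> e)" by (rule functionalD(3)[OF \<phi> e(2) related_comp[OF \<phi>' xy x e']])
    then have "related \<psi> (x \<cdot> e) (y \<cdot> e)"
      by (rule functionalD(2)[OF \<psi> e(3) equivalenceD(2)[OF functionalD(4)[OF \<psi>] Comp_in_hom[OF e' x]]])
    then show ?thesis by (rule related_local[OF \<psi>' e(1) x y])
  qed
  note this[OF \<phi> \<psi> common] this[OF \<psi> \<phi>]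
  then show ?thesis using common by (intro Rel_eqI[OF functionalD(1)[OF \<phi>] functionalD(1)[OF \<psi>]]) blast
qed

lemma rel_comp_ide:
  assumes \<phi>: "functional X R Y S \<phi>"
  shows "rel_comp C \<phi> R = \<phi>" "rel_comp C S \<phi> = \<phi>"
proof -
  note R = functionalD(4)[OF \<phi>] and S = functionalD(5)[OF \<phi>] and \<phi>' = functionalD(1)[OF \<phi>]
  note iR = functional_ide[OF R] and iS = functional_ide[OF S]
  have common: "\<exists>T' e y. cover e T' T \<and> related (rel_comp C \<phi> R) (x \<cdot> e) y \<and>
      related (rel_comp C S \<phi>) (x \<cdot> e) y \<and> related \<phi> (x \<cdot> e) y" if x: "x \<in> hom C T X" for T x
  proof -
    obtain T' e y where e: "cover e T' T" "related \<phi> (x \<cdot> e) y" by (rule functional_total[OF \<phi> x])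
    note xe = Comp_in_hom[OF cover_hom[OF e(1)] x]
    have "related (rel_comp C \<phi> R) (x \<cdot> e) y"
      by (rule rel_compI[OF equivalenceD(1)[OF R] \<phi>' equivalenceD(2)[OF R xe] e(2)])
    moreover have "related (rel_comp C S \<phi>) (x \<cdot> e) y"
      by (rule rel_compI[OF \<phi>' equivalenceD(1)[OF S] e(2) equivalenceD(2)[OF S related_hom(2)[OF \<phi>' e(2)]]])
    ultimately show ?thesis using e by blast
  qed
  show "rel_comp C \<phi> R = \<phi>" by (rule functional_eqI[OF functional_comp[OF iR \<phi>] \<phi>]) (use common in blast)
  show "rel_comp C S \<phi> = \<phi>" by (rule functional_eqI[OF functional_comp[OF \<phi> iS] \<phi>]) (use common in blast)
qed

section \<open>The exact completion as a category with pullbacks\<close>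

lemma ex_reg_Obj_iff: "(X, R) \<in> Obj (ex_reg C) \<longleftrightarrow> equivalence_relation C X R"
  unfolding ex_reg_def ex_reg_Obj_def using equivalence_obj by auto

lemma hom_ex_reg_iff:
  "f \<in> hom (ex_reg C) (X, R) (Y, S) \<longleftrightarrow> (\<exists>\<phi>. f = ((X, R), \<phi>, (Y, S)) \<and> functional X R Y S \<phi>)"
proof -
  have "f \<in> hom (ex_reg C) (X, R) (Y, S) \<longleftrightarrow> (\<exists>\<phi>. f = ((X, R), \<phi>, (Y, S)) \<and>
      equivalence_relation C X R \<and> equivalence_relation C Y S \<and> ex_reg_rel C (X, R) (Y, S) \<phi>)"
    unfolding hom_def ex_reg_def ex_reg_Obj_def using equivalence_obj by auto
  moreover have "equivalence_relation C X R \<and> equivalence_relation C Y S \<and> ex_reg_rel C (X, R) (Y, S) \<phi> \<longleftrightarrow>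
      functional X R Y S \<phi>" for \<phi>
    using ex_reg_rel_iff[of X R Y S \<phi>] functionalD(4,5)[of X R Y S \<phi>] by blast
  ultimately show ?thesis by simp
qed

lemma ex_reg_Comp: "Comp (ex_reg C) (B', \<psi>, D) (A, \<phi>, B) = (A, rel_comp C \<psi> \<phi>, D)"
  unfolding ex_reg_def by simp

lemma ex_reg_Ide: "Ide (ex_reg C) (X, R) = ((X, R), R, (X, R))"
  unfolding ex_reg_def by simp

lemma category_ex_reg: "category (ex_reg C)"
proof
  show "f \<in> Arr (ex_reg C) \<Longrightarrow> Dom (ex_reg C) f \<in> Obj (ex_reg C)"
    and "f \<in> Arr (ex_reg C) \<Longrightarrow> Cod (ex_reg C) f \<in> Obj (ex_reg C)" for f
    unfolding ex_reg_def by auto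
  show "A \<in> Obj (ex_reg C) \<Longrightarrow> Ide (ex_reg C) A \<in> hom (ex_reg C) A A" for A
    by (cases A) (simp add: ex_reg_Obj_iff hom_ex_reg_iff ex_reg_Ide functional_ide)
  show "g \<cdot>\<^bsub>ex_reg C\<^esub> f \<in> hom (ex_reg C) A D"
    if "f \<in> hom (ex_reg C) A B" "g \<in> hom (ex_reg C) B D" for f g A B D
    using that by (cases A; cases B; cases D) (auto simp: hom_ex_reg_iff ex_reg_Comp intro: functional_comp)
  show "(h \<cdot>\<^bsub>ex_reg C\<^esub> g) \<cdot>\<^bsub>ex_reg C\<^esub> f = h \<cdot>\<^bsub>ex_reg C\<^esub> (g \<cdot>\<^bsub>ex_reg C\<^esub> f)"
    if "f \<in> hom (ex_reg C) A B" "g \<in> hom (ex_reg C) B D" "h \<in> hom (ex_reg C) D E" for f g h A B D E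
    using that by (cases A; cases B; cases D; cases E)
      (auto simp: hom_ex_reg_iff ex_reg_Comp functional_comp_assoc)
  show "f \<cdot>\<^bsub>ex_reg C\<^esub> Ide (ex_reg C) A = f" if "f \<in> hom (ex_reg C) A B" for f A B
    using that by (cases A; cases B) (auto simp: hom_ex_reg_iff ex_reg_Comp ex_reg_Ide rel_comp_ide)
  show "Ide (ex_reg C) B \<cdot>\<^bsub>ex_reg C\<^esub> f = f" if "f \<in> hom (ex_reg C) A B" for f A B
    using that by (cases A; cases B) (auto simp: hom_ex_reg_iff ex_reg_Comp ex_reg_Ide rel_comp_ide)
qed

text \<open>
  The pullback lives on the object of all pairs \<open>(x, y)\<close> with the same value in \<open>(Z, W)\<close>, which is
  the relation \<open>\<psi>\<inverse>\<phi>\<close>, with the equivalence relation inherited from \<open>R\<close> and \<open>S\<close>.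
  The arrow induced by \<open>\<alpha>\<close> and \<open>\<beta>\<close> relates \<open>t\<close> to those pairs \<open>p\<close> for which \<open>\<alpha>\<close> takes
  the value \<open>u \<cdot> p\<close> and \<open>\<beta>\<close> the value \<open>v \<cdot> p\<close>.
\<close>

lemma functional_pullback:
  assumes \<phi>: "functional X R Z W \<phi>" and \<psi>: "functional Y S Z W \<psi>"
  obtains P Q \<pi>\<^sub>1 \<pi>\<^sub>2 where "functional P Q X R \<pi>\<^sub>1" "functional P Q Y S \<pi>\<^sub>2" "rel_comp C \<phi> \<pi>\<^sub>1 = rel_comp C \<psi> \<pi>\<^sub>2"
    "\<forall>T V \<alpha> \<beta>. functional T V X R \<alpha> \<longrightarrow> functional T V Y S \<beta> \<longrightarrow> rel_comp C \<phi> \<alpha> = rel_comp C \<psi> \<beta> \<longrightarrow>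
       (\<exists>\<eta>. functional T V P Q \<eta> \<and> rel_comp C \<pi>\<^sub>1 \<eta> = \<alpha> \<and> rel_comp C \<pi>\<^sub>2 \<eta> = \<beta>)"
    "\<forall>T V \<eta> \<theta>. functional T V P Q \<eta> \<longrightarrow> functional T V P Q \<theta> \<longrightarrow>
       rel_comp C \<pi>\<^sub>1 \<eta> = rel_comp C \<pi>\<^sub>1 \<theta> \<longrightarrow> rel_comp C \<pi>\<^sub>2 \<eta> = rel_comp C \<pi>\<^sub>2 \<theta> \<longrightarrow> \<eta> = \<theta>"
proof -
  note \<phi>' = functionalD(1)[OF \<phi>] and \<psi>' = functionalD(1)[OF \<psi>]
  note R = functionalD(4)[OF \<phi>] and S = functionalD(4)[OF \<psi>]
  note R' = equivalenceD(1)[OF R] and S' = equivalenceD(1)[OF S]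
  note X = Ide_in_hom[OF equivalence_obj[OF R]] and Y = Ide_in_hom[OF equivalence_obj[OF S]]
  note \<psi>c = Rel_converse[OF \<psi>']
  note pb = Rel_rel_comp(1)[OF \<phi>' \<psi>c(1)]
  obtain u v where uv: "(u, v) \<in> rel_comp C (\<psi>\<inverse>) \<phi>" using pb by (rule Rel_nonempty)
  define P where "P = Dom C u"
  have u: "u \<in> hom C P X" and v: "v \<in> hom C P Y"
    using Rel_rep(1)[OF pb uv] unfolding monic_spans_iff P_def by auto
  have puv: "related (rel_comp C (\<psi>\<inverse>) \<phi>) u v"
    unfolding Rel_rep(2)[OF pb uv] by (rule span_factors_refl[OF Rel_rep(1)[OF pb uv]])
  obtain Q1 where Q1: "Q1 \<in> Rel C P P"
    "\<forall>T. \<forall>t \<in> hom C T P. \<forall>t' \<in> hom C T P. related Q1 t t' \<longleftrightarrow> related R (u \<cdot> t) (u \<cdot> t')"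
    by (rule Rel_vimage[OF R' u u])
  obtain Q2 where Q2: "Q2 \<in> Rel C P P"
    "\<forall>T. \<forall>t \<in> hom C T P. \<forall>t' \<in> hom C T P. related Q2 t t' \<longleftrightarrow> related S (v \<cdot> t) (v \<cdot> t')"
    by (rule Rel_vimage[OF S' v v])
  obtain Q where Q: "Q \<in> Rel C P P" "\<forall>t t'. related Q t t' \<longleftrightarrow> related Q1 t t' \<and> related Q2 t t'"
    by (rule Rel_inter[OF Q1(1) Q2(1)])
  have Q_iff: "related Q t t' \<longleftrightarrow> related R (u \<cdot> t) (u \<cdot> t') \<and> related S (v \<cdot> t) (v \<cdot> t')"
    if "t \<in> hom C T P" "t' \<in> hom C T P" for T t t' using Q(2) Q1(2) Q2(2) that by blast
  have ut: "u \<cdot> t \<in> hom C T X" and vt: "v \<cdot> t \<in> hom C T Y" if "t \<in> hom C T P" for T t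
    using Comp_in_hom[OF that u] Comp_in_hom[OF that v] by auto
  have eQ: "equivalence_relation C P Q"
    unfolding equivalence_relation_iff
  proof (intro conjI allI ballI impI)
    show "Q \<in> Rel C P P" by (rule Q(1))
    show "related Q t t" if t: "t \<in> hom C T P" for T t
      unfolding Q_iff[OF t t] using equivalenceD(2)[OF R ut[OF t]] equivalenceD(2)[OF S vt[OF t]] by blast
    show "related Q t' t" if q: "related Q t t'" for t t'
      using q related_hom[OF Q(1) q] Q_iff equivalenceD(3)[OF R] equivalenceD(3)[OF S] by blast
    show "related Q t t''" if q: "related Q t t'" and q': "related Q t' t''" for t t' t''
    proof -
      note t = related_hom[OF Q(1) q]
      note t'' = related_hom_right[OF Q(1) q' t(2)]
      show ?thesis
        using q q' unfolding Q_iff[OF t] Q_iff[OF t(2) t''] Q_iff[OF t(1) t'']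
        using equivalenceD(4)[OF R] equivalenceD(4)[OF S] by blast
    qed
  qed
  have proj: "\<exists>\<pi>. functional P Q A U \<pi> \<and>
      (\<forall>T. \<forall>t \<in> hom C T P. \<forall>x \<in> hom C T A. related \<pi> t x \<longleftrightarrow> related U (w \<cdot> t) x)"
    if U: "equivalence_relation C A U" and w: "w \<in> hom C P A"
      and wQ: "\<And>T t t'. t \<in> hom C T P \<Longrightarrow> t' \<in> hom C T P \<Longrightarrow> related Q t t' \<Longrightarrow> related U (w \<cdot> t) (w \<cdot> t')" for A U w
  proof -
    note A = Ide_in_hom[OF equivalence_obj[OF U]] and U' = equivalenceD(1)[OF U]
    obtain \<pi> where \<pi>: "\<pi> \<in> Rel C P A"
      "\<forall>T. \<forall>t \<in> hom C T P. \<forall>x \<in> hom C T A. related \<pi> t x \<longleftrightarrow> related U (w \<cdot> t) (Ide C A \<cdot> x)"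
      by (rule Rel_vimage[OF U' w A])
    have \<pi>_iff: "related \<pi> t x \<longleftrightarrow> related U (w \<cdot> t) x" if "t \<in> hom C T P" "x \<in> hom C T A" for T t x
      using \<pi>(2) that Comp_Ide_left[OF that(2)] by simp
    have "functional P Q A U \<pi>" unfolding functional_def
    proof (intro conjI allI impI ballI)
      show "equivalence_relation C P Q" "equivalence_relation C A U" "\<pi> \<in> Rel C P A" by (rule eQ U \<pi>(1))+
      show "related \<pi> t' x'" if tx: "related \<pi> t x" and tt: "related Q t t'" and xx: "related U x x'" for t t' x x'
      proof -
        note t = related_hom[OF Q(1) tt]
        note x = related_hom_right[OF \<pi>(1) tx t(1)]
        note x' = related_hom_right[OF U' xx x]
        show ?thesis
          using tx xx wQ[OF t tt] unfolding \<pi>_iff[OF t(1) x] \<pi>_iff[OF t(2) x']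
          using equivalenceD(3,4)[OF U] by blast
      qed
      show "\<exists>T' e y. cover e T' T \<and> related \<pi> (t \<cdot> e) y" if t: "t \<in> hom C T P" for T t
      proof -
        note wt = Comp_in_hom[OF t w]
        have "related \<pi> t (w \<cdot> t)" unfolding \<pi>_iff[OF t wt] by (rule equivalenceD(2)[OF U wt])
        then show ?thesis using cover_ide[OF hom_obj(1)[OF t]] Comp_Ide_right[OF t] by metis
      qed
      show "related U x x'" if tx: "related \<pi> t x" and tx': "related \<pi> t x'" for t x x'
      proof -
        note t = related_hom[OF \<pi>(1) tx] related_hom(2)[OF \<pi>(1) tx']
        show ?thesis
          using tx tx' unfolding \<pi>_iff[OF t(1,2)] \<pi>_iff[OF t(1,3)] using equivalenceD(3,4)[OF U] by blast
      qed
    qed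
    with \<pi>_iff show ?thesis by blast
  qed
  obtain \<pi>1 where \<pi>1: "functional P Q X R \<pi>1"
    and \<pi>1_iff: "\<And>T t x. t \<in> hom C T P \<Longrightarrow> x \<in> hom C T X \<Longrightarrow> related \<pi>1 t x \<longleftrightarrow> related R (u \<cdot> t) x"
    using proj[OF R u] Q_iff by blast
  obtain \<pi>2 where \<pi>2: "functional P Q Y S \<pi>2"
    and \<pi>2_iff: "\<And>T t y. t \<in> hom C T P \<Longrightarrow> y \<in> hom C T Y \<Longrightarrow> related \<pi>2 t y \<longleftrightarrow> related S (v \<cdot> t) y"
    using proj[OF S v] Q_iff by blast
  have \<pi>1u: "related \<pi>1 t (u \<cdot> t)" and \<pi>2v: "related \<pi>2 t (v \<cdot> t)" if t: "t \<in> hom C T P" for T t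
    unfolding \<pi>1_iff[OF t ut[OF t]] \<pi>2_iff[OF t vt[OF t]]
    using equivalenceD(2)[OF R ut[OF t]] equivalenceD(2)[OF S vt[OF t]] by blast+
  have square: "rel_comp C \<phi> \<pi>1 = rel_comp C \<psi> \<pi>2"
  proof (rule functional_eqI[OF functional_comp[OF \<pi>1 \<phi>] functional_comp[OF \<pi>2 \<psi>]])
    fix T t assume t: "t \<in> hom C T P"
    obtain T' e z where e: "cover e T' T" "related \<phi> ((u \<cdot> t) \<cdot> e) z" "related (\<psi>\<inverse>) z ((v \<cdot> t) \<cdot> e)"
      by (rule rel_compE[OF \<phi>' \<psi>c(1) related_comp[OF pb puv u t] ut[OF t]])
    note te = Comp_in_hom[OF cover_hom[OF e(1)] t]
    have z: "related \<phi> (u \<cdot> (t \<cdot> e)) z" "related \<psi> (v \<cdot> (t \<cdot> e)) z"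
      using e(2,3) Comp_assoc[OF cover_hom[OF e(1)] t u] Comp_assoc[OF cover_hom[OF e(1)] t v] \<psi>c(2) by auto
    have "related (rel_comp C \<phi> \<pi>1) (t \<cdot> e) z" "related (rel_comp C \<psi> \<pi>2) (t \<cdot> e) z"
      using functional_comp_value[OF \<pi>1 \<phi> \<pi>1u[OF te]] functional_comp_value[OF \<pi>2 \<psi> \<pi>2v[OF te]] z by blast+
    with e(1) show "\<exists>T' e z. cover e T' T \<and> related (rel_comp C \<phi> \<pi>1) (t \<cdot> e) z \<and> related (rel_comp C \<psi> \<pi>2) (t \<cdot> e) z"
      by blast
  qed
  have unique: "\<eta> = \<theta>"
    if \<eta>: "functional T V P Q \<eta>" and \<theta>: "functional T V P Q \<theta>"
      and eq: "rel_comp C \<pi>1 \<eta> = rel_comp C \<pi>1 \<theta>" "rel_comp C \<pi>2 \<eta> = rel_comp C \<pi>2 \<theta>" for T V \<eta> \<theta>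
  proof (rule functional_eqI[OF \<eta> \<theta>])
    fix T' t assume t: "t \<in> hom C T' T"
    obtain T'' e p p' where e: "cover e T'' T'" "related \<eta> (t \<cdot> e) p" "related \<theta> (t \<cdot> e) p'"
      by (rule functional_total2[OF \<eta> \<theta> t])
    note te = Comp_in_hom[OF cover_hom[OF e(1)] t]
    note p = related_hom_right[OF functionalD(1)[OF \<eta>] e(2) te]
      and p' = related_hom_right[OF functionalD(1)[OF \<theta>] e(3) te]
    have "related \<pi>1 p' (u \<cdot> p)" "related \<pi>2 p' (v \<cdot> p)"
      using functional_comp_value[OF \<eta> \<pi>1 e(2)] functional_comp_value[OF \<theta> \<pi>1 e(3)]
        functional_comp_value[OF \<eta> \<pi>2 e(2)] functional_comp_value[OF \<theta> \<pi>2 e(3)] \<pi>1u[OF p] \<pi>2v[OF p] eq by auto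
    then have "related Q p' p"
      unfolding Q_iff[OF p' p] \<pi>1_iff[OF p' ut[OF p]] \<pi>2_iff[OF p' vt[OF p]] by blast
    then have "related \<theta> (t \<cdot> e) p"
      by (rule functionalD(2)[OF \<theta> e(3) equivalenceD(2)[OF functionalD(4)[OF \<theta>] te]])
    with e show "\<exists>T'' e p. cover e T'' T' \<and> related \<eta> (t \<cdot> e) p \<and> related \<theta> (t \<cdot> e) p" by blast
  qed
  have lift: "\<exists>\<eta>. functional T V P Q \<eta> \<and> rel_comp C \<pi>1 \<eta> = \<alpha> \<and> rel_comp C \<pi>2 \<eta> = \<beta>"
    if \<alpha>: "functional T V X R \<alpha>" and \<beta>: "functional T V Y S \<beta>" and eq: "rel_comp C \<phi> \<alpha> = rel_comp C \<psi> \<beta>" for T V \<alpha> \<beta>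
  proof -
    note \<alpha>' = functionalD(1)[OF \<alpha>] and \<beta>' = functionalD(1)[OF \<beta>] and V = functionalD(4)[OF \<alpha>]
    note T = Ide_in_hom[OF equivalence_obj[OF V]]
    obtain \<eta>1 where \<eta>1: "\<eta>1 \<in> Rel C T P"
      "\<forall>T'. \<forall>t \<in> hom C T' T. \<forall>p \<in> hom C T' P. related \<eta>1 t p \<longleftrightarrow> related \<alpha> (Ide C T \<cdot> t) (u \<cdot> p)"
      by (rule Rel_vimage[OF \<alpha>' T u])
    obtain \<eta>2 where \<eta>2: "\<eta>2 \<in> Rel C T P"
      "\<forall>T'. \<forall>t \<in> hom C T' T. \<forall>p \<in> hom C T' P. related \<eta>2 t p \<longleftrightarrow> related \<beta> (Ide C T \<cdot> t) (v \<cdot> p)"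
      by (rule Rel_vimage[OF \<beta>' T v])
    obtain \<eta> where \<eta>: "\<eta> \<in> Rel C T P" "\<forall>t p. related \<eta> t p \<longleftrightarrow> related \<eta>1 t p \<and> related \<eta>2 t p"
      by (rule Rel_inter[OF \<eta>1(1) \<eta>2(1)])
    have \<eta>_iff: "related \<eta> t p \<longleftrightarrow> related \<alpha> t (u \<cdot> p) \<and> related \<beta> t (v \<cdot> p)"
      if "t \<in> hom C T' T" "p \<in> hom C T' P" for T' t p
      using \<eta>(2) \<eta>1(2) \<eta>2(2) that Comp_Ide_left[OF that(1)] by simp
    have fun_\<eta>: "functional T V P Q \<eta>" unfolding functional_def
    proof (intro conjI allI impI ballI)
      show "equivalence_relation C T V" "equivalence_relation C P Q" "\<eta> \<in> Rel C T P" by (rule V eQ \<eta>(1))+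
      show "related \<eta> t' p'" if tp: "related \<eta> t p" and tt: "related V t t'" and pp: "related Q p p'" for t t' p p'
      proof -
        note t = related_hom[OF equivalenceD(1)[OF V] tt]
        note p = related_hom_right[OF \<eta>(1) tp t(1)]
        note p' = related_hom_right[OF Q(1) pp p]
        show ?thesis
          using tp pp tt unfolding \<eta>_iff[OF t(1) p] \<eta>_iff[OF t(2) p'] Q_iff[OF p p']
          using functionalD(2)[OF \<alpha>] functionalD(2)[OF \<beta>] by blast
      qed
      show "\<exists>T'' e p. cover e T'' T' \<and> related \<eta> (t \<cdot> e) p" if t: "t \<in> hom C T' T" for T' t
      proof -
        obtain T1 e x y where e: "cover e T1 T'" "related \<alpha> (t \<cdot> e) x" "related \<beta> (t \<cdot> e) y"
          by (rule functional_total2[OF \<alpha> \<beta> t])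
        note e' = cover_hom[OF e(1)]
        note te = Comp_in_hom[OF e' t]
        note x = related_hom_right[OF \<alpha>' e(2) te] and y = related_hom_right[OF \<beta>' e(3) te]
        obtain T2 d z where d: "cover d T2 T1" "related \<phi> (x \<cdot> d) z" by (rule functional_total[OF \<phi> x])
        note d' = cover_hom[OF d(1)]
        have \<alpha>d: "related \<alpha> ((t \<cdot> e) \<cdot> d) (x \<cdot> d)" and \<beta>d: "related \<beta> ((t \<cdot> e) \<cdot> d) (y \<cdot> d)"
          using related_comp[OF \<alpha>' e(2) te d'] related_comp[OF \<beta>' e(3) te d'] by blast+
        have "related \<psi> (y \<cdot> d) z"
          using functional_comp_value[OF \<alpha> \<phi> \<alpha>d] functional_comp_value[OF \<beta> \<psi> \<beta>d] d(2) eq by simp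
        then have "related (rel_comp C (\<psi>\<inverse>) \<phi>) (x \<cdot> d) (y \<cdot> d)"
          using rel_compI[OF \<phi>' \<psi>c(1) d(2)] \<psi>c(2) by blast
        then obtain p where p: "p \<in> hom C (Dom C (x \<cdot> d)) P" "u \<cdot> p = x \<cdot> d" "v \<cdot> p = y \<cdot> d"
          unfolding Rel_rep(2)[OF pb uv] span_factors_iff P_def[symmetric] by blast
        have "Dom C (x \<cdot> d) = T2" using Comp_in_hom[OF d' x] by (simp add: hom_def)
        then have p': "p \<in> hom C T2 P" using p(1) by simp
        have "related \<eta> ((t \<cdot> e) \<cdot> d) p"
          unfolding \<eta>_iff[OF Comp_in_hom[OF d' te] p'] p(2,3) using \<alpha>d \<beta>d by blast
        then show ?thesis
          unfolding Comp_assoc[OF d' e' t] using cover_comp[OF d(1) e(1)] by blast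
      qed
      show "related Q p p'" if tp: "related \<eta> t p" and tp': "related \<eta> t p'" for t p p'
      proof -
        note t = related_hom[OF \<eta>(1) tp] related_hom(2)[OF \<eta>(1) tp']
        show ?thesis
          using tp tp' unfolding \<eta>_iff[OF t(1,2)] \<eta>_iff[OF t(1,3)] Q_iff[OF t(2,3)]
          using functionalD(3)[OF \<alpha>] functionalD(3)[OF \<beta>] by blast
      qed
    qed
    have common: "\<exists>T'' e p. cover e T'' T' \<and> p \<in> hom C T'' P \<and> related \<eta> (t \<cdot> e) p \<and>
        related \<alpha> (t \<cdot> e) (u \<cdot> p) \<and> related \<beta> (t \<cdot> e) (v \<cdot> p)"
      if t: "t \<in> hom C T' T" for T' t
    proof -
      obtain T'' e p where e: "cover e T'' T'" "related \<eta> (t \<cdot> e) p" by (rule functional_total[OF fun_\<eta> t])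
      note te = Comp_in_hom[OF cover_hom[OF e(1)] t]
      note p = related_hom_right[OF \<eta>(1) e(2) te]
      show ?thesis using e p e(2)[unfolded \<eta>_iff[OF te p]] by blast
    qed
    have "rel_comp C \<pi>1 \<eta> = \<alpha>"
      by (rule functional_eqI[OF functional_comp[OF fun_\<eta> \<pi>1] \<alpha>])
         (use common \<pi>1u functional_comp_value[OF fun_\<eta> \<pi>1] in blast)
    moreover have "rel_comp C \<pi>2 \<eta> = \<beta>"
      by (rule functional_eqI[OF functional_comp[OF fun_\<eta> \<pi>2] \<beta>])
         (use common \<pi>2v functional_comp_value[OF fun_\<eta> \<pi>2] in blast)
    ultimately show ?thesis using fun_\<eta> by blast
  qed
  show thesis by (rule that[OF \<pi>1 \<pi>2 square]) (use lift unique in blast)+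
qed

lemma has_pullbacks_ex_reg: "has_pullbacks (ex_reg C)"
  unfolding has_pullbacks_def
proof (intro ballI impI)
  interpret E: category "ex_reg C" by (rule category_ex_reg)
  fix f g assume "f \<in> Arr (ex_reg C)" "g \<in> Arr (ex_reg C)" "Cod (ex_reg C) f = Cod (ex_reg C) g"
  then have "f \<in> hom (ex_reg C) (Dom (ex_reg C) f) (Cod (ex_reg C) g)"
    "g \<in> hom (ex_reg C) (Dom (ex_reg C) g) (Cod (ex_reg C) g)" by (auto simp: hom_def)
  moreover obtain X R Y S Z W where
    "Dom (ex_reg C) f = (X, R)" "Dom (ex_reg C) g = (Y, S)" "Cod (ex_reg C) g = (Z, W)"
    by (metis surj_pair)
  ultimately have f: "f \<in> hom (ex_reg C) (X, R) (Z, W)" and g: "g \<in> hom (ex_reg C) (Y, S) (Z, W)" by simp_all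
  then obtain \<phi> \<psi> where \<phi>: "f = ((X, R), \<phi>, (Z, W))" "functional X R Z W \<phi>"
    and \<psi>: "g = ((Y, S), \<psi>, (Z, W))" "functional Y S Z W \<psi>" unfolding hom_ex_reg_iff by blast
  obtain P Q \<pi>\<^sub>1 \<pi>\<^sub>2 where \<pi>: "functional P Q X R \<pi>\<^sub>1" "functional P Q Y S \<pi>\<^sub>2" "rel_comp C \<phi> \<pi>\<^sub>1 = rel_comp C \<psi> \<pi>\<^sub>2"
    "\<forall>T V \<alpha> \<beta>. functional T V X R \<alpha> \<longrightarrow> functional T V Y S \<beta> \<longrightarrow> rel_comp C \<phi> \<alpha> = rel_comp C \<psi> \<beta> \<longrightarrow>
       (\<exists>\<eta>. functional T V P Q \<eta> \<and> rel_comp C \<pi>\<^sub>1 \<eta> = \<alpha> \<and> rel_comp C \<pi>\<^sub>2 \<eta> = \<beta>)"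
    "\<forall>T V \<eta> \<theta>. functional T V P Q \<eta> \<longrightarrow> functional T V P Q \<theta> \<longrightarrow>
       rel_comp C \<pi>\<^sub>1 \<eta> = rel_comp C \<pi>\<^sub>1 \<theta> \<longrightarrow> rel_comp C \<pi>\<^sub>2 \<eta> = rel_comp C \<pi>\<^sub>2 \<theta> \<longrightarrow> \<eta> = \<theta>"
    by (rule functional_pullback[OF \<phi>(2) \<psi>(2)])
  have "is_pullback (ex_reg C) f g ((P, Q), \<pi>\<^sub>1, (X, R)) ((P, Q), \<pi>\<^sub>2, (Y, S))"
  proof (rule E.is_pullbackI[OF f g])
    show "((P, Q), \<pi>\<^sub>1, (X, R)) \<in> hom (ex_reg C) (P, Q) (X, R)"
      "((P, Q), \<pi>\<^sub>2, (Y, S)) \<in> hom (ex_reg C) (P, Q) (Y, S)"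
      unfolding hom_ex_reg_iff using \<pi>(1,2) by blast+
    show "f \<cdot>\<^bsub>ex_reg C\<^esub> ((P, Q), \<pi>\<^sub>1, (X, R)) = g \<cdot>\<^bsub>ex_reg C\<^esub> ((P, Q), \<pi>\<^sub>2, (Y, S))"
      unfolding \<phi>(1) \<psi>(1) ex_reg_Comp \<pi>(3) ..
  next
    fix T a b
    assume ab: "a \<in> hom (ex_reg C) T (X, R)" "b \<in> hom (ex_reg C) T (Y, S)" "f \<cdot>\<^bsub>ex_reg C\<^esub> a = g \<cdot>\<^bsub>ex_reg C\<^esub> b"
    obtain T' V where T: "T = (T', V)" by (rule prod.exhaust)
    obtain \<alpha> \<beta> where \<alpha>: "a = (T, \<alpha>, (X, R))" "functional T' V X R \<alpha>" and \<beta>: "b = (T, \<beta>, (Y, S))" "functional T' V Y S \<beta>"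
      using ab(1,2) unfolding T hom_ex_reg_iff by blast
    have "rel_comp C \<phi> \<alpha> = rel_comp C \<psi> \<beta>" using ab(3) unfolding \<phi>(1) \<psi>(1) \<alpha>(1) \<beta>(1) ex_reg_Comp by simp
    then obtain \<eta> where \<eta>: "functional T' V P Q \<eta>" "rel_comp C \<pi>\<^sub>1 \<eta> = \<alpha>" "rel_comp C \<pi>\<^sub>2 \<eta> = \<beta>"
      using \<pi>(4) \<alpha>(2) \<beta>(2) by blast
    show "\<exists>h \<in> hom (ex_reg C) T (P, Q). ((P, Q), \<pi>\<^sub>1, (X, R)) \<cdot>\<^bsub>ex_reg C\<^esub> h = a \<and>
        ((P, Q), \<pi>\<^sub>2, (Y, S)) \<cdot>\<^bsub>ex_reg C\<^esub> h = b"
      by (rule bexI[of _ "(T, \<eta>, (P, Q))"]) (use \<eta> in \<open>auto simp: ex_reg_Comp \<alpha>(1) \<beta>(1) T hom_ex_reg_iff\<close>)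
  next
    fix T h k
    assume hk: "h \<in> hom (ex_reg C) T (P, Q)" "k \<in> hom (ex_reg C) T (P, Q)"
      "((P, Q), \<pi>\<^sub>1, (X, R)) \<cdot>\<^bsub>ex_reg C\<^esub> h = ((P, Q), \<pi>\<^sub>1, (X, R)) \<cdot>\<^bsub>ex_reg C\<^esub> k"
      "((P, Q), \<pi>\<^sub>2, (Y, S)) \<cdot>\<^bsub>ex_reg C\<^esub> h = ((P, Q), \<pi>\<^sub>2, (Y, S)) \<cdot>\<^bsub>ex_reg C\<^esub> k"
    obtain T' V where T: "T = (T', V)" by (rule prod.exhaust)
    obtain \<eta> \<theta> where \<eta>: "h = (T, \<eta>, (P, Q))" "functional T' V P Q \<eta>" and \<theta>: "k = (T, \<theta>, (P, Q))" "functional T' V P Q \<theta>"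
      using hk(1,2) unfolding T hom_ex_reg_iff by blast
    have "rel_comp C \<pi>\<^sub>1 \<eta> = rel_comp C \<pi>\<^sub>1 \<theta>" "rel_comp C \<pi>\<^sub>2 \<eta> = rel_comp C \<pi>\<^sub>2 \<theta>"
      using hk(3,4) unfolding \<eta>(1) \<theta>(1) ex_reg_Comp by simp_all
    then have "\<eta> = \<theta>" using \<pi>(5) \<eta>(2) \<theta>(2) by blast
    then show "h = k" unfolding \<eta>(1) \<theta>(1) by simp
  qed
  then show "\<exists>p q. is_pullback (ex_reg C) f g p q" by blast
qed

end

section \<open>Protomodularity of the exact completion\<close>

context regular_category
begin

text \<open>
  The use of protomodularity in the base category. Here \<open>p : (X, R) \<rightarrow> (Y, S)\<close> is split by \<open>s\<close> in
  the exact completion, and \<open>\<theta>\<close> stands for the subobject \<open>{x | \<theta> x x}\<close> of \<open>X\<close>; it contains the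
  elements over the image of \<open>f\<close> and the image of \<open>s\<close>, and is to be all of \<open>X\<close>.

  Let \<open>\<kappa>\<close> be the idempotent \<open>sp\<close>, a relation on \<open>X\<close>. The object \<open>Z = {(x, y) | \<kappa> x y}\<close>
  projects to \<open>K = {y | \<kappa> y y}\<close>, the elements in the image of \<open>s\<close>, and this projection is
  split by the diagonal. It is a split epimorphism of the base category that covers \<open>p\<close>
  compatibly with the sections. Similarly \<open>A = {(a, y) | (sf) a y}\<close> with its projection to \<open>K\<close>
  covers \<open>f\<close>. Let \<open>N\<close> be the preimage of the subobject under \<open>(x, y) \<mapsto> x\<close>. The diagonal of \<open>K\<close>
  and the projection to \<open>Z\<close> from the pullback of \<open>A\<close> and \<open>Z\<close> over \<open>K\<close> factor through \<open>N\<close>, so \<open>N\<close>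
  is all of \<open>Z\<close>; and every element of \<open>X\<close> is on a cover the first component of an element of \<open>Z\<close>.
\<close>

lemma split_epi_covering_elements:
  assumes proto: "protomodular_category C"
    and p: "functional X R Y S p" and s: "functional Y S X R s" and ps: "rel_comp C p s = S"
    and f: "functional W V Y S f" and \<theta>: "\<theta> \<in> Rel C X X"
    and pb: "\<And>a b x. related f a b \<Longrightarrow> related p x b \<Longrightarrow> related \<theta> x x"
    and sec: "\<And>b x. related s b x \<Longrightarrow> related \<theta> x x"
    and x: "x \<in> hom C T X"
  shows "related \<theta> x x"
proof -
  interpret protomodular_category C by (rule proto)
  note p' = functionalD(1)[OF p] and s' = functionalD(1)[OF s] and f' = functionalD(1)[OF f]
  note S = functionalD(5)[OF p]
  define \<kappa> where "\<kappa> = rel_comp C s p"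
  have \<kappa>: "\<kappa> \<in> Rel C X X" unfolding \<kappa>_def by (rule Rel_rel_comp(1)[OF p' s'])
  have \<kappa>I: "related \<kappa> x y" if "related p x b" "related s b y" for x b y
    unfolding \<kappa>_def by (rule rel_compI[OF p' s' that])
  have sp: "related p y b" if sb: "related s b y" for b y
  proof -
    note b = related_hom(1)[OF s' sb]
    show ?thesis using functional_comp_value[OF s p sb, of b] equivalenceD(2)[OF S b] unfolding ps by blast
  qed
  have \<kappa>_image: "related \<kappa> y y" if xy: "related \<kappa> x y" for x y
  proof -
    note y = related_hom(2)[OF \<kappa> xy]
    show ?thesis
      by (rule rel_comp_elim[OF p' s' xy[unfolded \<kappa>_def] \<kappa> y y]) (use \<kappa>I sp in blast)
  qed
  \<comment> \<open>Since \<open>y\<close> is equivalent to \<open>s\<close> of the value of \<open>x\<close>, the elements \<open>x\<close> and \<open>y\<close> lie over the same \<open>b\<close>.\<close>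
  have \<kappa>_value: "related p x b" if xy: "related \<kappa> x y" and yb: "related p y b" for x y b
  proof -
    note x = related_hom[OF \<kappa> xy] and b = related_hom_right[OF p' yb related_hom(2)[OF \<kappa> xy]]
    show ?thesis
    proof (rule rel_comp_elim[OF p' s' xy[unfolded \<kappa>_def] p' x(1) b])
      fix T e b' assume e: "cover e T (Dom C x)" "related p (x \<cdot> e) b'" "related s b' (y \<cdot> e)"
      note e' = cover_hom[OF e(1)]
      have "related S b' (b \<cdot> e)" by (rule functionalD(3)[OF p sp[OF e(3)] related_comp[OF p' yb x(2) e']])
      then show "related p (x \<cdot> e) (b \<cdot> e)"
        by (rule functionalD(2)[OF p e(2) equivalenceD(2)[OF functionalD(4)[OF p] Comp_in_hom[OF e' x(1)]]])
    qed
  qed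
  obtain z1 z2 where z: "(z1, z2) \<in> \<kappa>" using \<kappa> by (rule Rel_nonempty)
  define Z where "Z = Dom C z1"
  have z1: "z1 \<in> hom C Z X" and z2: "z2 \<in> hom C Z X" and jm: "jointly_monic C z1 z2"
    using Rel_rep(1)[OF \<kappa> z] unfolding monic_spans_iff Z_def by auto
  have \<kappa>z: "related \<kappa> z1 z2"
    unfolding Rel_rep(2)[OF \<kappa> z] by (rule span_factors_refl[OF Rel_rep(1)[OF \<kappa> z]])
  obtain K j where j: "j \<in> hom C K X" "is_mono C j"
    "\<forall>T. \<forall>x \<in> hom C T X. related \<kappa> x x \<longleftrightarrow> (\<exists>h \<in> hom C T K. j \<cdot> h = x)"
    by (rule subobject_of_reflexive_elements[OF \<kappa>])
  note K = Ide_in_hom[OF hom_obj(1)[OF j(1)]] and ZI = Ide_in_hom[OF hom_obj(1)[OF z1]]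
  \<comment> \<open>The split epimorphism \<open>(x, y) \<mapsto> y\<close> from \<open>Z\<close> to \<open>K\<close> and its section \<open>y \<mapsto> (y, y)\<close>.\<close>
  obtain p0 where p0: "p0 \<in> hom C Z K" "j \<cdot> p0 = z2" using j(3) z2 \<kappa>_image[OF \<kappa>z] by blast
  have \<kappa>j: "related \<kappa> j j" using j(3)[rule_format, OF j(1)] K Comp_Ide_right[OF j(1)] by blast
  have "Dom C j = K" using j(1) by (simp add: hom_def)
  then obtain s0 where s0: "s0 \<in> hom C K Z" "z1 \<cdot> s0 = j" "z2 \<cdot> s0 = j"
    using \<kappa>j unfolding Rel_rep(2)[OF \<kappa> z] span_factors_iff Z_def[symmetric] by blast
  have ps0: "p0 \<cdot> s0 = Ide C K"
    by (rule is_monoD[OF j(2,1) Comp_in_hom[OF s0(1) p0(1)] K])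
       (use comp_eq[OF p0(2,1) j(1) s0(1)] s0(3) Comp_Ide_right[OF j(1)] in simp)
  define \<omega> where "\<omega> = rel_comp C s f"
  have \<omega>: "\<omega> \<in> Rel C W X" unfolding \<omega>_def by (rule Rel_rel_comp(1)[OF f' s'])
  obtain a1 a2 where a: "(a1, a2) \<in> \<omega>" using \<omega> by (rule Rel_nonempty)
  define A where "A = Dom C a1"
  have a1: "a1 \<in> hom C A W" and a2: "a2 \<in> hom C A X"
    using Rel_rep(1)[OF \<omega> a] unfolding monic_spans_iff A_def by auto
  have \<omega>a: "related \<omega> a1 a2"
    unfolding Rel_rep(2)[OF \<omega> a] by (rule span_factors_refl[OF Rel_rep(1)[OF \<omega> a]])
  have "related \<kappa> a2 a2"
    by (rule rel_comp_elim[OF f' s' \<omega>a[unfolded \<omega>_def] \<kappa>])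
       (use related_hom[OF \<omega> \<omega>a] \<kappa>I sp in blast)+
  then obtain f0 where f0: "f0 \<in> hom C A K" "j \<cdot> f0 = a2" using j(3) a2 by blast
  obtain D q0 g0 where D: "q0 \<in> hom C D A" "g0 \<in> hom C D Z" "f0 \<cdot> q0 = p0 \<cdot> g0" "is_pullback C f0 p0 q0 g0"
    by (rule pullback_exists[OF f0(1) p0(1)])
  have epic: "jointly_strongly_epic C g0 s0" by (rule protomodular[OF p0(1) s0(1) ps0 f0(1) D(4)])
  obtain \<theta>' where \<theta>': "\<theta>' \<in> Rel C Z Z"
    "\<forall>T. \<forall>t \<in> hom C T Z. \<forall>t' \<in> hom C T Z. related \<theta>' t t' \<longleftrightarrow> related \<theta> (z1 \<cdot> t) (z1 \<cdot> t')"
    by (rule Rel_vimage[OF \<theta> z1 z1])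
  \<comment> \<open>\<open>N\<close> is the preimage of the subobject \<open>{x | \<theta> x x}\<close> under the first projection of \<open>Z\<close>.\<close>
  obtain N n where n: "n \<in> hom C N Z" "is_mono C n"
    "\<forall>T. \<forall>t \<in> hom C T Z. related \<theta>' t t \<longleftrightarrow> (\<exists>h \<in> hom C T N. n \<cdot> h = t)"
    by (rule subobject_of_reflexive_elements[OF \<theta>'(1)])
  have n_iff: "(\<exists>h \<in> hom C T N. n \<cdot> h = t) \<longleftrightarrow> related \<theta> (z1 \<cdot> t) (z1 \<cdot> t)" if "t \<in> hom C T Z" for T t
    using n(3) \<theta>'(2) that by blast
  have "related \<theta> j j"
    by (rule rel_comp_elim[OF p' s' \<kappa>j[unfolded \<kappa>_def] \<theta>])
       (use related_hom[OF \<kappa> \<kappa>j] sec in blast)+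
  then have ns: "\<exists>h \<in> hom C K N. n \<cdot> h = s0" unfolding n_iff[OF s0(1)] s0(2) .
  have "related \<theta> (z1 \<cdot> g0) (z1 \<cdot> g0)"
  proof -
    note z1g = Comp_in_hom[OF D(2) z1]
    have y: "z2 \<cdot> g0 = a2 \<cdot> q0"
      using comp_eq[OF p0(2,1) j(1) D(2)] comp_eq[OF f0(2,1) j(1) D(1)] D(3) by simp
    have xy: "related \<kappa> (z1 \<cdot> g0) (a2 \<cdot> q0)" using related_comp[OF \<kappa> \<kappa>z z1 D(2)] unfolding y .
    have ay: "related \<omega> (a1 \<cdot> q0) (a2 \<cdot> q0)" by (rule related_comp[OF \<omega> \<omega>a a1 D(1)])
    have Dom: "Dom C (a1 \<cdot> q0) = D" using Comp_in_hom[OF D(1) a1] by (simp add: hom_def)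
    show ?thesis
    proof (rule rel_comp_elim[OF f' s' ay[unfolded \<omega>_def] \<theta>], unfold Dom, rule z1g, rule z1g)
      fix T e b
      assume e: "cover e T D" "related f ((a1 \<cdot> q0) \<cdot> e) b" "related s b ((a2 \<cdot> q0) \<cdot> e)"
      have "related p ((z1 \<cdot> g0) \<cdot> e) b"
        by (rule \<kappa>_value[OF related_comp[OF \<kappa> xy z1g cover_hom[OF e(1)]] sp[OF e(3)]])
      then show "related \<theta> ((z1 \<cdot> g0) \<cdot> e) ((z1 \<cdot> g0) \<cdot> e)" by (rule pb[OF e(2)])
    qed
  qed
  then have ng: "\<exists>h \<in> hom C D N. n \<cdot> h = g0" unfolding n_iff[OF D(2)] .
  have Doms: "Dom C g0 = D" "Dom C s0 = K" "Dom C n = N" "Cod C n = Cod C g0"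
    using D(2) s0(1) n(1) by (auto simp: hom_def)
  have "is_iso C n"
    using epic n(2) ng ns Doms unfolding jointly_strongly_epic_def by metis
  then obtain k where k: "k \<in> hom C Z N" "n \<cdot> k = Ide C Z" using is_isoD[OF _ n(1)] by blast
  then have \<theta>z: "related \<theta> z1 z1" using n_iff[OF ZI] Comp_Ide_right[OF z1] by auto
  obtain T1 e b where e: "cover e T1 T" "related p (x \<cdot> e) b" by (rule functional_total[OF p x])
  note e' = cover_hom[OF e(1)]
  note xe = Comp_in_hom[OF e' x]
  note b = related_hom_right[OF p' e(2) xe]
  obtain T2 d y where d: "cover d T2 T1" "related s (b \<cdot> d) y" by (rule functional_total[OF s b])
  note d' = cover_hom[OF d(1)]
  have "related \<kappa> ((x \<cdot> e) \<cdot> d) y" by (rule \<kappa>I[OF related_comp[OF p' e(2) xe d'] d(2)])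
  then obtain t where t: "t \<in> hom C (Dom C ((x \<cdot> e) \<cdot> d)) Z" "z1 \<cdot> t = (x \<cdot> e) \<cdot> d"
    unfolding Rel_rep(2)[OF \<kappa> z] span_factors_iff Z_def[symmetric] by blast
  have "related \<theta> ((x \<cdot> e) \<cdot> d) ((x \<cdot> e) \<cdot> d)"
    using related_comp[OF \<theta> \<theta>z z1 t(1)] unfolding t(2) .
  then have "related \<theta> (x \<cdot> e) (x \<cdot> e)" by (rule related_local[OF \<theta> d(1) xe xe])
  then show ?thesis by (rule related_local[OF \<theta> e(1) x x])
qed

lemma equivalence_ide:
  assumes "X \<in> Obj C"
  obtains \<Delta> where "equivalence_relation C X \<Delta>" "\<forall>x y. related \<Delta> x y \<longleftrightarrow> x = y \<and> x \<in> hom C (Dom C x) X"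
proof -
  obtain \<Delta> where \<Delta>: "\<Delta> \<in> Rel C X X" "\<forall>x y. related \<Delta> x y \<longleftrightarrow> x = y \<and> x \<in> hom C (Dom C x) X"
    by (rule Rel_ide[OF assms])
  have "equivalence_relation C X \<Delta>" unfolding equivalence_relation_iff using \<Delta> by (auto simp: hom_def)
  then show thesis by (rule that[OF _ \<Delta>(2)])
qed

text \<open>
  A generalized element of \<open>X\<close> at stage \<open>T\<close> is an arrow into \<open>(X, R)\<close> from \<open>T\<close> with its discrete
  equivalence relation.
\<close>

lemma functional_element:
  assumes R: "equivalence_relation C X R" and x: "x \<in> hom C T X"
    and \<Delta>: "equivalence_relation C T \<Delta>" "\<forall>t t'. related \<Delta> t t' \<longleftrightarrow> t = t' \<and> t \<in> hom C (Dom C t) T"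
  obtains \<rho> where "functional T \<Delta> X R \<rho>"
    "\<forall>T'. \<forall>t \<in> hom C T' T. \<forall>x' \<in> hom C T' X. related \<rho> t x' \<longleftrightarrow> related R (x \<cdot> t) x'"
proof -
  note R' = equivalenceD(1)[OF R]
  obtain \<rho> where \<rho>: "\<rho> \<in> Rel C T X"
    "\<forall>T'. \<forall>t \<in> hom C T' T. \<forall>x' \<in> hom C T' X. related \<rho> t x' \<longleftrightarrow> related R (x \<cdot> t) (Ide C X \<cdot> x')"
    by (rule Rel_vimage[OF R' x Ide_in_hom[OF equivalence_obj[OF R]]])
  have \<rho>_iff: "related \<rho> t x' \<longleftrightarrow> related R (x \<cdot> t) x'" if "t \<in> hom C T' T" "x' \<in> hom C T' X" for T' t x'
    using \<rho>(2) that Comp_Ide_left[OF that(2)] by simp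
  have "functional T \<Delta> X R \<rho>" unfolding functional_def
  proof (intro conjI allI impI ballI)
    show "equivalence_relation C T \<Delta>" "equivalence_relation C X R" "\<rho> \<in> Rel C T X" by (rule \<Delta>(1) R \<rho>(1))+
    show "related \<rho> t' y'" if ty: "related \<rho> t y" and tt: "related \<Delta> t t'" and yy: "related R y y'" for t t' y y'
    proof -
      note t = related_hom[OF \<rho>(1) ty]
      note y' = related_hom_right[OF R' yy t(2)]
      have "related \<rho> t y'" using ty yy unfolding \<rho>_iff[OF t] \<rho>_iff[OF t(1) y'] by (rule equivalenceD(4)[OF R])
      then show ?thesis using tt \<Delta>(2) by auto
    qed
    show "\<exists>T'' e y. cover e T'' T' \<and> related \<rho> (t \<cdot> e) y" if t: "t \<in> hom C T' T" for T' t
    proof -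
      note xt = Comp_in_hom[OF t x]
      have "related \<rho> t (x \<cdot> t)" unfolding \<rho>_iff[OF t xt] by (rule equivalenceD(2)[OF R xt])
      then show ?thesis using cover_ide[OF hom_obj(1)[OF t]] Comp_Ide_right[OF t] by metis
    qed
    show "related R y y'" if ty: "related \<rho> t y" and ty': "related \<rho> t y'" for t y y'
    proof -
      note t = related_hom[OF \<rho>(1) ty] related_hom(2)[OF \<rho>(1) ty']
      show ?thesis
        using ty ty' unfolding \<rho>_iff[OF t(1,2)] \<rho>_iff[OF t(1,3)] using equivalenceD(3,4)[OF R] by blast
    qed
  qed
  then show thesis using \<rho>_iff by (intro that) blast+
qed

text \<open>
  Two elements of \<open>M\<close> with the same value under \<open>\<mu>\<close> give two arrows out of a discrete object which
  become equal after \<open>\<mu>\<close>; a monomorphism therefore identifies them up to \<open>N\<close>.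
\<close>

lemma ex_reg_mono_injective:
  assumes mono: "is_mono (ex_reg C) ((M, N), \<mu>, (X, R))" and \<mu>: "functional M N X R \<mu>"
    and mx: "related \<mu> m x" and mx': "related \<mu> m' x"
  shows "related N m m'"
proof -
  interpret E: category "ex_reg C" by (rule category_ex_reg)
  note \<mu>' = functionalD(1)[OF \<mu>] and N = functionalD(4)[OF \<mu>]
  define T where "T = Dom C x"
  have x: "x \<in> hom C T X" using related_hom[OF \<mu>' mx] unfolding T_def hom_def by auto
  note m = related_hom_left[OF \<mu>' mx x] and m' = related_hom_left[OF \<mu>' mx' x]
  note TI = Ide_in_hom[OF hom_obj(1)[OF x]]
  obtain \<Delta> where \<Delta>: "equivalence_relation C T \<Delta>" "\<forall>t t'. related \<Delta> t t' \<longleftrightarrow> t = t' \<and> t \<in> hom C (Dom C t) T"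
    by (rule equivalence_ide[OF hom_obj(1)[OF x]])
  obtain \<rho> where \<rho>: "functional T \<Delta> M N \<rho>"
    "\<forall>T'. \<forall>t \<in> hom C T' T. \<forall>x' \<in> hom C T' M. related \<rho> t x' \<longleftrightarrow> related N (m \<cdot> t) x'"
    by (rule functional_element[OF N m \<Delta>])
  obtain \<rho>' where \<rho>': "functional T \<Delta> M N \<rho>'"
    "\<forall>T'. \<forall>t \<in> hom C T' T. \<forall>x' \<in> hom C T' M. related \<rho>' t x' \<longleftrightarrow> related N (m' \<cdot> t) x'"
    by (rule functional_element[OF N m' \<Delta>])
  have val: "related \<rho> t (m \<cdot> t)" "related \<rho>' t (m' \<cdot> t)" if t: "t \<in> hom C T' T" for T' t
    using \<rho>(2) \<rho>'(2) t Comp_in_hom[OF t m] Comp_in_hom[OF t m'] equivalenceD(2)[OF N] by blast+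
  have "rel_comp C \<mu> \<rho> = rel_comp C \<mu> \<rho>'"
  proof (rule functional_eqI[OF functional_comp[OF \<rho>(1) \<mu>] functional_comp[OF \<rho>'(1) \<mu>]])
    fix T' t assume t: "t \<in> hom C T' T"
    have "related (rel_comp C \<mu> \<rho>) t (x \<cdot> t)" "related (rel_comp C \<mu> \<rho>') t (x \<cdot> t)"
      using functional_comp_value[OF \<rho>(1) \<mu> val(1)[OF t]] functional_comp_value[OF \<rho>'(1) \<mu> val(2)[OF t]]
        related_comp[OF \<mu>' mx m t] related_comp[OF \<mu>' mx' m' t] by blast+
    then show "\<exists>T'' e y. cover e T'' T' \<and> related (rel_comp C \<mu> \<rho>) (t \<cdot> e) y \<and> related (rel_comp C \<mu> \<rho>') (t \<cdot> e) y"
      using cover_ide[OF hom_obj(1)[OF t]] Comp_Ide_right[OF t] by metis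
  qed
  then have eq: "((M, N), \<mu>, (X, R)) \<cdot>\<^bsub>ex_reg C\<^esub> ((T, \<Delta>), \<rho>, (M, N)) =
      ((M, N), \<mu>, (X, R)) \<cdot>\<^bsub>ex_reg C\<^esub> ((T, \<Delta>), \<rho>', (M, N))"
    unfolding ex_reg_Comp by simp
  have "((T, \<Delta>), \<rho>, (M, N)) = ((T, \<Delta>), \<rho>', (M, N))"
    by (rule E.is_monoD[OF mono _ _ _ eq]) (use \<mu> \<rho>(1) \<rho>'(1) hom_ex_reg_iff in blast)+
  then have "\<rho> = \<rho>'" by simp
  then have "related \<rho> (Ide C T) m" "related \<rho> (Ide C T) m'"
    using val[OF TI] Comp_Ide_right[OF m] Comp_Ide_right[OF m'] by simp_all
  then show ?thesis by (rule functionalD(3)[OF \<rho>(1)])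
qed

text \<open>
  Injectivity makes the opposite relation single-valued and surjectivity makes it total, so it is
  an arrow, inverse to \<open>\<mu>\<close>. Surjectivity at \<open>x\<close> is the reflexivity of \<open>\<mu>\<mu>\<inverse>\<close> at \<open>x\<close>.
\<close>

lemma ex_reg_iso_of_injective_surjective:
  assumes \<mu>: "functional M N X R \<mu>"
    and inj: "\<And>m m' x. related \<mu> m x \<Longrightarrow> related \<mu> m' x \<Longrightarrow> related N m m'"
    and surj: "\<And>T x. x \<in> hom C T X \<Longrightarrow> related (rel_comp C \<mu> (\<mu>\<inverse>)) x x"
  shows "is_iso (ex_reg C) ((M, N), \<mu>, (X, R))"
proof -
  interpret E: category "ex_reg C" by (rule category_ex_reg)
  note \<mu>' = functionalD(1)[OF \<mu>] and N = functionalD(4)[OF \<mu>] and R = functionalD(5)[OF \<mu>]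
  note c = Rel_converse[OF \<mu>']
  have total: "\<exists>T' e m. cover e T' T \<and> related (\<mu>\<inverse>) (x \<cdot> e) m" if x: "x \<in> hom C T X" for T x
    by (rule rel_compE[OF c(1) \<mu>' surj[OF x] x]) blast
  have inv: "functional X R M N (\<mu>\<inverse>)"
    unfolding functional_def c(2) using R N c(1) functionalD(2)[OF \<mu>] inj total unfolding c(2) by blast
  have left: "rel_comp C (\<mu>\<inverse>) \<mu> = N"
  proof (rule functional_eqI[OF functional_comp[OF \<mu> inv] functional_ide[OF N]])
    fix T m assume m: "m \<in> hom C T M"
    obtain T' e x where e: "cover e T' T" "related \<mu> (m \<cdot> e) x" by (rule functional_total[OF \<mu> m])
    have "related (rel_comp C (\<mu>\<inverse>) \<mu>) (m \<cdot> e) (m \<cdot> e)"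
      using rel_compI[OF \<mu>' c(1) e(2)] e(2) c(2) by blast
    then show "\<exists>T' e y. cover e T' T \<and> related (rel_comp C (\<mu>\<inverse>) \<mu>) (m \<cdot> e) y \<and> related N (m \<cdot> e) y"
      using e(1) equivalenceD(2)[OF N Comp_in_hom[OF cover_hom[OF e(1)] m]] by blast
  qed
  have right: "rel_comp C \<mu> (\<mu>\<inverse>) = R"
  proof (rule functional_eqI[OF functional_comp[OF inv \<mu>] functional_ide[OF R]])
    fix T x assume x: "x \<in> hom C T X"
    show "\<exists>T' e y. cover e T' T \<and> related (rel_comp C \<mu> (\<mu>\<inverse>)) (x \<cdot> e) y \<and> related R (x \<cdot> e) y"
      using cover_ide[OF hom_obj(1)[OF x]] Comp_Ide_right[OF x] surj[OF x] equivalenceD(2)[OF R x] by metis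
  qed
  show ?thesis
    by (rule E.is_isoI[of _ "(M, N)" "(X, R)" "((X, R), \<mu>\<inverse>, (M, N))"])
       (use \<mu> inv left right in \<open>auto simp: hom_ex_reg_iff ex_reg_Comp ex_reg_Ide\<close>)
qed

text \<open>
  The elements \<open>a\<close> and \<open>x\<close>, seen as arrows out of a discrete object, induce an arrow into the
  pullback, whose local value is the required \<open>d\<close>. This uses only the universal property, so that
  it applies to every pullback square.
\<close>

lemma ex_reg_pullback_elements:
  assumes pb: "is_pullback (ex_reg C) ((W, V), f, (Y, S)) ((X, R), p, (Y, S)) ((D, Q), q, (W, V)) ((D, Q), g, (X, R))"
    and f: "functional W V Y S f" and p: "functional X R Y S p"
    and q: "functional D Q W V q" and g: "functional D Q X R g"
    and ab: "related f a b" and xb: "related p x b"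
  obtains T' e d where "cover e T' (Dom C x)" "related g d (x \<cdot> e)"
proof -
  interpret E: category "ex_reg C" by (rule category_ex_reg)
  note f' = functionalD(1)[OF f] and p' = functionalD(1)[OF p] and g' = functionalD(1)[OF g]
  define T where "T = Dom C x"
  note x = related_hom[OF p' xb, folded T_def]
  note a = related_hom_left[OF f' ab x(2)]
  note TI = Ide_in_hom[OF hom_obj(1)[OF x(1)]]
  obtain \<Delta> where \<Delta>: "equivalence_relation C T \<Delta>" "\<forall>t t'. related \<Delta> t t' \<longleftrightarrow> t = t' \<and> t \<in> hom C (Dom C t) T"
    by (rule equivalence_ide[OF hom_obj(1)[OF x(1)]])
  obtain \<alpha> where \<alpha>: "functional T \<Delta> W V \<alpha>"
    "\<forall>T'. \<forall>t \<in> hom C T' T. \<forall>x' \<in> hom C T' W. related \<alpha> t x' \<longleftrightarrow> related V (a \<cdot> t) x'"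
    by (rule functional_element[OF functionalD(4)[OF f] a \<Delta>])
  obtain \<xi> where \<xi>: "functional T \<Delta> X R \<xi>"
    "\<forall>T'. \<forall>t \<in> hom C T' T. \<forall>x' \<in> hom C T' X. related \<xi> t x' \<longleftrightarrow> related R (x \<cdot> t) x'"
    by (rule functional_element[OF functionalD(4)[OF p] x(1) \<Delta>])
  have val: "related \<alpha> t (a \<cdot> t)" "related \<xi> t (x \<cdot> t)" if t: "t \<in> hom C T' T" for T' t
    using \<alpha>(2) \<xi>(2) t Comp_in_hom[OF t a] Comp_in_hom[OF t x(1)]
      equivalenceD(2)[OF functionalD(4)[OF f]] equivalenceD(2)[OF functionalD(4)[OF p]] by blast+
  have "rel_comp C f \<alpha> = rel_comp C p \<xi>"
  proof (rule functional_eqI[OF functional_comp[OF \<alpha>(1) f] functional_comp[OF \<xi>(1) p]])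
    fix T' t assume t: "t \<in> hom C T' T"
    have "related (rel_comp C f \<alpha>) t (b \<cdot> t)" "related (rel_comp C p \<xi>) t (b \<cdot> t)"
      using functional_comp_value[OF \<alpha>(1) f val(1)[OF t]] functional_comp_value[OF \<xi>(1) p val(2)[OF t]]
        related_comp[OF f' ab a t] related_comp[OF p' xb x(1) t] by blast+
    then show "\<exists>T'' e y. cover e T'' T' \<and> related (rel_comp C f \<alpha>) (t \<cdot> e) y \<and> related (rel_comp C p \<xi>) (t \<cdot> e) y"
      using cover_ide[OF hom_obj(1)[OF t]] Comp_Ide_right[OF t] by metis
  qed
  then have eq: "((W, V), f, (Y, S)) \<cdot>\<^bsub>ex_reg C\<^esub> ((T, \<Delta>), \<alpha>, (W, V)) =
      ((X, R), p, (Y, S)) \<cdot>\<^bsub>ex_reg C\<^esub> ((T, \<Delta>), \<xi>, (X, R))"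
    unfolding ex_reg_Comp by simp
  have homs: "((W, V), f, (Y, S)) \<in> hom (ex_reg C) (W, V) (Y, S)" "((X, R), p, (Y, S)) \<in> hom (ex_reg C) (X, R) (Y, S)"
    "((D, Q), q, (W, V)) \<in> hom (ex_reg C) (D, Q) (W, V)"
    "((T, \<Delta>), \<alpha>, (W, V)) \<in> hom (ex_reg C) (T, \<Delta>) (W, V)" "((T, \<Delta>), \<xi>, (X, R)) \<in> hom (ex_reg C) (T, \<Delta>) (X, R)"
    unfolding hom_ex_reg_iff using f p q \<alpha>(1) \<xi>(1) by blast+
  obtain h where h: "h \<in> hom (ex_reg C) (T, \<Delta>) (D, Q)" "((D, Q), g, (X, R)) \<cdot>\<^bsub>ex_reg C\<^esub> h = ((T, \<Delta>), \<xi>, (X, R))"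
    using E.pullback_lift[OF pb homs eq] by blast
  then obtain \<eta> where \<eta>: "h = ((T, \<Delta>), \<eta>, (D, Q))" "functional T \<Delta> D Q \<eta>" unfolding hom_ex_reg_iff by blast
  have \<xi>_eq: "rel_comp C g \<eta> = \<xi>" using h(2) unfolding \<eta>(1) ex_reg_Comp by simp
  have "related (rel_comp C g \<eta>) (Ide C T) x" using val(2)[OF TI] Comp_Ide_right[OF x(1)] unfolding \<xi>_eq by simp
  then obtain T' e d where "cover e T' T" "related g d (x \<cdot> e)"
    by (rule rel_compE[OF functionalD(1)[OF \<eta>(2)] g' _ TI])
  then show thesis using that unfolding T_def by blast
qed

end

theorem proposition5p2:
  fixes X :: "('o, 'a) cat"
  assumes "regular_category X"
    and "protomodular_category X"
  shows "protomodular_category (ex_reg X)"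
proof -
  interpret regular_category X by (rule assms(1))
  interpret E: category "ex_reg X" by (rule category_ex_reg)
  show ?thesis
  proof
    show "has_pullbacks (ex_reg X)" by (rule has_pullbacks_ex_reg)
  next
    fix p E B s f A q g
    assume p: "p \<in> hom (ex_reg X) E B" and s: "s \<in> hom (ex_reg X) B E"
      and ps: "p \<cdot>\<^bsub>ex_reg X\<^esub> s = Ide (ex_reg X) B" and f: "f \<in> hom (ex_reg X) A B"
      and pb: "is_pullback (ex_reg X) f p q g"
    define D where "D = Dom (ex_reg X) q"
    note qg = E.pullback_square(1,2)[OF pb f p, folded D_def]
    obtain X0 R where E: "E = (X0, R)" by (rule prod.exhaust)
    obtain Y S where B: "B = (Y, S)" by (rule prod.exhaust)
    obtain W V where A: "A = (W, V)" by (rule prod.exhaust)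
    obtain D0 Q where D: "D = (D0, Q)" by (rule prod.exhaust)
    obtain \<pi> where \<pi>: "p = (E, \<pi>, B)" "functional X0 R Y S \<pi>" using p unfolding E B hom_ex_reg_iff by blast
    obtain \<sigma> where \<sigma>: "s = (B, \<sigma>, E)" "functional Y S X0 R \<sigma>" using s unfolding E B hom_ex_reg_iff by blast
    obtain \<phi> where \<phi>: "f = (A, \<phi>, B)" "functional W V Y S \<phi>" using f unfolding A B hom_ex_reg_iff by blast
    obtain \<chi> where \<chi>: "q = (D, \<chi>, A)" "functional D0 Q W V \<chi>" using qg(1) unfolding D A hom_ex_reg_iff by blast
    obtain \<gamma> where \<gamma>: "g = (D, \<gamma>, E)" "functional D0 Q X0 R \<gamma>" using qg(2) unfolding D E hom_ex_reg_iff by blast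
    have \<pi>\<sigma>: "rel_comp X \<pi> \<sigma> = S" using ps unfolding \<pi>(1) \<sigma>(1) B ex_reg_Comp ex_reg_Ide by simp
    have arr: "g \<in> Arr (ex_reg X)" "s \<in> Arr (ex_reg X)" "Dom (ex_reg X) g = D" "Dom (ex_reg X) s = B"
      "Cod (ex_reg X) g = E" "Cod (ex_reg X) s = E"
      using qg s by (auto simp: hom_def)
    have "is_iso (ex_reg X) m"
      if mono: "is_mono (ex_reg X) m" and cod: "Cod (ex_reg X) m = E"
        and a: "a \<in> hom (ex_reg X) D (Dom (ex_reg X) m)" "m \<cdot>\<^bsub>ex_reg X\<^esub> a = g"
        and b: "b \<in> hom (ex_reg X) B (Dom (ex_reg X) m)" "m \<cdot>\<^bsub>ex_reg X\<^esub> b = s" for m a b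
    proof -
      obtain M N where M: "Dom (ex_reg X) m = (M, N)" by (rule prod.exhaust)
      have "m \<in> hom (ex_reg X) (M, N) (X0, R)" using mono cod M E unfolding is_mono_def hom_def by auto
      then obtain \<mu> where \<mu>: "m = ((M, N), \<mu>, (X0, R))" "functional M N X0 R \<mu>" unfolding hom_ex_reg_iff by blast
      obtain \<alpha> where \<alpha>: "a = (D, \<alpha>, (M, N))" "functional D0 Q M N \<alpha>" using a(1) unfolding M D hom_ex_reg_iff by blast
      obtain \<beta> where \<beta>: "b = (B, \<beta>, (M, N))" "functional Y S M N \<beta>" using b(1) unfolding M B hom_ex_reg_iff by blast
      have \<mu>\<alpha>: "rel_comp X \<mu> \<alpha> = \<gamma>" and \<mu>\<beta>: "rel_comp X \<mu> \<beta> = \<sigma>"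
        using a(2) b(2) unfolding \<mu>(1) \<alpha>(1) \<beta>(1) \<gamma>(1) \<sigma>(1) ex_reg_Comp by simp_all
      note \<mu>' = functionalD(1)[OF \<mu>(2)]
      note c = Rel_converse[OF \<mu>']
      have \<theta>: "rel_comp X \<mu> (\<mu>\<inverse>) \<in> Rel X X0 X0" by (rule Rel_rel_comp(1)[OF c(1) \<mu>'])
      \<comment> \<open>An element that some composite \<open>\<mu>\<delta>\<close> takes as a value is on a cover a value of \<open>\<mu>\<close>.\<close>
      have image: "related (rel_comp X \<mu> (\<mu>\<inverse>)) x x"
        if \<delta>: "functional T U M N \<delta>" and dx: "related (rel_comp X \<mu> \<delta>) d x" for T U \<delta> d x
      proof -
        note \<delta>' = functionalD(1)[OF \<delta>]
        note x = related_hom(2)[OF Rel_rel_comp(1)[OF \<delta>' \<mu>'] dx]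
        show ?thesis
          by (rule rel_comp_elim[OF \<delta>' \<mu>' dx \<theta> x x]) (use rel_compI[OF c(1) \<mu>'] c(2) in blast)
      qed
      show "is_iso (ex_reg X) m"
        unfolding \<mu>(1)
      proof (rule ex_reg_iso_of_injective_surjective[OF \<mu>(2)])
        show "related N m m'" if "related \<mu> m x" "related \<mu> m' x" for m m' x
          by (rule ex_reg_mono_injective[OF mono[unfolded \<mu>(1)] \<mu>(2) that])
      next
        fix T x assume x: "x \<in> hom X T X0"
        show "related (rel_comp X \<mu> (\<mu>\<inverse>)) x x"
        proof (rule split_epi_covering_elements[OF assms(2) \<pi>(2) \<sigma>(2) \<pi>\<sigma> \<phi>(2) \<theta> _ _ x])
          show "related (rel_comp X \<mu> (\<mu>\<inverse>)) x x" if "related \<sigma> b x" for b x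
            using image[OF \<beta>(2)] that unfolding \<mu>\<beta> .
          show "related (rel_comp X \<mu> (\<mu>\<inverse>)) x x" if ab: "related \<phi> a b" and xb: "related \<pi> x b" for a b x
          proof -
            obtain T' e d where e: "cover e T' (Dom X x)" "related \<gamma> d (x \<cdot>\<^bsub>X\<^esub> e)"
              by (rule ex_reg_pullback_elements[OF pb[unfolded \<pi>(1) \<phi>(1) \<chi>(1) \<gamma>(1) A B E D]
                    \<phi>(2) \<pi>(2) \<chi>(2) \<gamma>(2) ab xb])
            note x = related_hom(1)[OF functionalD(1)[OF \<pi>(2)] xb]
            have "related (rel_comp X \<mu> (\<mu>\<inverse>)) (x \<cdot>\<^bsub>X\<^esub> e) (x \<cdot>\<^bsub>X\<^esub> e)" using image[OF \<alpha>(2)] e(2) unfolding \<mu>\<alpha> .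
            then show ?thesis by (rule related_local[OF \<theta> e(1) x x])
          qed
        qed
      qed
    qed
    then show "jointly_strongly_epic (ex_reg X) g s"
      unfolding jointly_strongly_epic_def using arr by auto
  qed
qed

end
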